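(* (Family $\mathtt{ExpRK6s15}$.) Let $c_2,\ldots,c_{15}>0$ be nodes such that $c_3\ne c_4$; $c_5,c_6,c_7$ are pairwise distinct; $c_8,\ldots,c_{11}$ are pairwise distinct; $c_{12},\ldots,c_{15}$ are pairwise distinct; and $$\frac15\sum_{i}c_i-\frac14\sum_{i<j}c_ic_j+\frac13\sum_{i<j<k}c_ic_jc_k-\frac12\,c_{12}c_{13}c_{14}c_{15}=\frac16,$$ where all indices in the sums range over $\{12,13,14,15\}$. Consider the 15-stage explicit exponential Runge--Kutta method with, writing $\varphi_{r,i}(z)=\varphi_r(c_iz)$, - $a_{i2}(z)=\frac{c_i^2}{c_2}\varphi_{2,i}(z)$ for $i=3,4$; - $a_{ij}(z)=\frac{-c_i^2c_k\varphi_{2,i}(z)+2c_i^3\varphi_{3,i}(z)}{c_j(c_j-c_k)}$ for $i=5,6,7$ and $\{j,k\}=\{3,4\}$; - $a_{ij}(z)=\frac{c_i^2c_kc_l\varphi_{2,i}(z)-2c_i^3(c_k+c_l)\varphi_{3,i}(z)+6c_i^4\varphi_{4,i}(z)}{c_j(c_j-c_k)(c_j-c_l)}$ for $i=8,\ldots,11$ and $\{j,k,l\}=\{5,6,7\}$; - $a_{ij}(z)=\frac{-c_i^2c_dc_kc_l\varphi_{2,i}(z)+2c_i^3(c_dc_k+c_dc_l+c_kc_l)\varphi_{3,i}(z)-6c_i^4(c_d+c_k+c_l)\varphi_{4,i}(z)+24c_i^5\varphi_{5,i}(z)}{c_j(c_j-c_d)(c_j-c_k)(c_j-c_l)}$ for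 $i=12,\ldots,15$ and $\{j,d,k,l\}=\{8,9,10,11\}$; - $b_i(z)=\frac{-c_dc_kc_l\varphi_2(z)+2(c_dc_k+c_dc_l+c_kc_l)\varphi_3(z)-6(c_d+c_k+c_l)\varphi_4(z)+24\varphi_5(z)}{c_i(c_i-c_d)(c_i-c_k)(c_i-c_l)}$ for $\{i,d,k,l\}=\{12,13,14,15\}$; and all other $a_{ij}$ and $b_i$ equal to zero. Then this method satisfies all of the 36 stiff order conditions listed in the context in the strong sense, except that condition No. 17 is satisfied in the weakened form $\sum_{i=2}^{15}b_i(0)\frac{c_i^5}{5!}=\varphi_6(0)=\frac1{6!}$. The method is of sixth order: whenever $A$ generates an analytic semigroup on a Banach space $X$, $g\colon X\to X$ is sufficiently often Fr\'echet differentiable in a strip along the exact solution $u\colon[t_0,t_{\mathrm{end}}]\to X$ of $u'=Au+g(u)$, $u(t_0)=u_0$, and $u$ is sufficiently smooth with derivatives in $X$ (all occurring derivatives uniformly bounded), the numerical solution satisfies $\|u_n-u(t_n)\|\le Ch^6$ uniformly on $t_0\le t_n=t_0+nh\le t_{\mathrm{end}}$ with $C$ independent of $n$ and $h$. Moreover, within each of the groups $\{U_{nj}\}_{j=3,4}$, $\{U_{nj}\}_{j=5,6,7}$, $\{U_{nj}\}_{j=8,\ldots,11}$, $\{U_{nj}\}_{j=12,\ldots,15}$ the stages are independent of each other.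
   Context: **Functions.** $\varphi_k(z)=\int_0^1 \mathrm{e}^{(1-\theta)z}\frac{\theta^{k-1}}{(k-1)!}\,d\theta$ for $k\ge1$; $\varphi_k(chA)$ ($c\ge0$, $h>0$) is defined by the same integral using the semigroup. **Method.** The explicit $s$-stage exponential Runge--Kutta method with nodes $c_i$ and coefficient functions $a_{ij}(z)$, $b_i(z)$, applied to $u'=F(u)=Au+g(u)$ with constant step size $h$, is $$U_{ni}=u_n+c_ih\,\varphi_1(c_ihA)F(u_n)+h\sum_{j=2}^{i-1}a_{ij}(hA)D_{nj},\quad 2\le i\le s,$$ $$u_{n+1}=u_n+h\,\varphi_1(hA)F(u_n)+h\sum_{i=2}^{s}b_i(hA)D_{ni},\qquad D_{ni}=g(U_{ni})-g(u_n).$$ A group of stages is independent of each other if $a_{ij}=0$ whenever $i,j$ both belong to the group. **The functions $\psi_{q,i}$.** $\psi_{q,i}(Z)=\sum_{k=2}^{i-1}a_{ik}(Z)\frac{c_k^{q-1}}{(q-1)!}-c_i^q\varphi_q(c_iZ)$. **The 36 stiff order conditions.** Below, $a_{ij}=a_{ij}(Z)$, $b_i=b_i(Z)$, $\varphi_q=\varphi_q(Z)$, $\psi_{q,i}=\psi_{q,i}(Z)$; $\sum_i$ runs over $2\le i\le s$, $\sum_j$ over $2\le j\le i-1$, $\sum_k$ over $2\le k\le j-1$, $\sum_l$ over $2\le l\le k-1$. Each condition (strong sense) is to hold for arbitrary square matrices $Z,J,K,L$ and arbitrary bilinear maps $B$ of appropriate dimensions (likewise with $Z=hA$, bounded operators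 $J,K,L$ and bounded bilinear $B$ on a Banach space); $B(P,Q)$ with operators $P,Q$ stands for $(v,w)\mapsto B(Pv,Qw)$. Order 2: $\sum_i b_ic_i=\varphi_2$. Order 3: $\sum_i b_i\frac{c_i^2}{2!}=\varphi_3$; $\sum_i b_iJ\psi_{2,i}=0$. Order 4: $\sum_i b_i\frac{c_i^3}{3!}=\varphi_4$; $\sum_i b_iJ\psi_{3,i}=0$; $\sum_i b_iJ\sum_j a_{ij}J\psi_{2,j}=0$; $\sum_i b_ic_iK\psi_{2,i}=0$. Order 5: $\sum_i b_i\frac{c_i^4}{4!}=\varphi_5$; $\sum_i b_iJ\psi_{4,i}=0$; $\sum_i b_iJ\sum_j a_{ij}J\psi_{3,j}=0$; $\sum_i b_iJ\sum_j a_{ij}J\sum_k a_{jk}J\psi_{2,k}=0$; $\sum_i b_iJ\sum_j a_{ij}c_jK\psi_{2,j}=0$; $\sum_i b_ic_iK\psi_{3,i}=0$; $\sum_i b_ic_iK\sum_j a_{ij}J\psi_{2,j}=0$; $\sum_i b_iB(\psi_{2,i},\psi_{2,i})=0$; $\sum_i b_ic_i^2L\psi_{2,i}=0$. Order 6: condition No. 17: $\sum_i b_i\frac{c_i^5}{5!}=\varphi_6$; and conditions No. 18--36: $\sum_i b_iJ\psi_{5,i}=0$; $\sum_i b_iJ\sum_j a_{ij}J\psi_{4,j}=0$; $\sum_i b_iJ\sum_j a_{ij}J\sum_k a_{jk}J\psi_{3,k}=0$; $\sum_i b_iJ\sum_j a_{ij}J\sum_k a_{jk}J\sum_l a_{kl}J\psi_{2,l}=0$;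 $\sum_i b_iJ\sum_j a_{ij}J\sum_k a_{jk}c_kK\psi_{2,k}=0$; $\sum_i b_iJ\sum_j a_{ij}c_jK\psi_{3,j}=0$; $\sum_i b_iJ\sum_j a_{ij}c_jK\sum_k a_{jk}J\psi_{2,k}=0$; $\sum_i b_iJ\sum_j a_{ij}B(\psi_{2,j},\psi_{2,j})=0$; $\sum_i b_iJ\sum_j a_{ij}c_j^2L\psi_{2,j}=0$; $\sum_i b_ic_iK\psi_{4,i}=0$; $\sum_i b_ic_iK\sum_j a_{ij}J\psi_{3,j}=0$; $\sum_i b_ic_iK\sum_j a_{ij}J\sum_k a_{jk}J\psi_{2,k}=0$; $\sum_i b_ic_iK\sum_j a_{ij}c_jK\psi_{2,j}=0$; $\sum_i b_iB(\psi_{2,i},\psi_{3,i})=0$; $\sum_i b_iB\big(\psi_{2,i},\sum_j a_{ij}J\psi_{2,j}\big)=0$; $\sum_i b_ic_i^2L\psi_{3,i}=0$; $\sum_i b_ic_i^2L\sum_j a_{ij}J\psi_{2,j}=0$; $\sum_i b_ic_iB(\psi_{2,i},\psi_{2,i})=0$; $\sum_i b_ic_i^3L\psi_{2,i}=0$.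
   Formalization: The bound ‖u_n−u(t_n)‖≤Ch^6 is stated for step sizes h≤h_0, with some h_0>0 depending on the problem; for all h it can fail, since for large h stages may leave the strip, where g is arbitrary and may be unbounded. *)

theory Defs
  imports "HOL-Analysis.Analysis"
begin

section \<open>Semigroups and their generators\<close>

definition C0_semigroup :: "(real \<Rightarrow> 'a::banach \<Rightarrow>\<^sub>L 'a) \<Rightarrow> bool" where
  "C0_semigroup T \<longleftrightarrow>
     T 0 = id_blinfun \<and>
     (\<forall>s\<ge>0. \<forall>t\<ge>0. T (s + t) = T s o\<^sub>L T t) \<and>
     (\<forall>x. ((\<lambda>t. T t x) \<longlongrightarrow> x) (at_right 0))"

text \<open>An unbounded operator is a set \<open>D\<close> (its domain) together with a function \<open>A\<close> whose values
  outside \<open>D\<close> are irrelevant.\<close>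

definition generates :: "('a::banach \<Rightarrow> 'a) \<Rightarrow> 'a set \<Rightarrow> (real \<Rightarrow> 'a \<Rightarrow>\<^sub>L 'a) \<Rightarrow> bool" where
  "generates A D T \<longleftrightarrow>
     D = {x. \<exists>y. ((\<lambda>t. (T t x - x) /\<^sub>R t) \<longlongrightarrow> y) (at_right 0)} \<and>
     (\<forall>x\<in>D. ((\<lambda>t. (T t x - x) /\<^sub>R t) \<longlongrightarrow> A x) (at_right 0))"

text \<open>The complexification of the real Banach space \<open>'a\<close> is \<open>'a \<times> 'a\<close>, the pair \<open>(x, y)\<close> standing
  for \<open>x + \<i> y\<close>. Its product norm is not homogeneous for complex scalars, but it is equivalent to
  one that is, and only limits are used.\<close>

lift_definition cmul :: "complex \<Rightarrow> ('a::real_normed_vector \<times> 'a) \<Rightarrow>\<^sub>L ('a \<times> 'a)"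
  is "\<lambda>z p. (Re z *\<^sub>R fst p - Im z *\<^sub>R snd p, Re z *\<^sub>R snd p + Im z *\<^sub>R fst p)"
  by (intro bounded_linear_intros bounded_linear_fst bounded_linear_snd)

definition sector :: "real \<Rightarrow> complex set" where
  "sector \<delta> = {z. z \<noteq> 0 \<and> \<bar>Arg z\<bar> < \<delta>}"

text \<open>A \<open>C\<^sub>0\<close>-semigroup is analytic if its complexification extends to a holomorphic (in operator
  norm) semigroup of complex-linear operators on a sector around the positive real axis that is
  strongly continuous at the origin. A complex Banach space is covered as well, as a real one.\<close>

definition analytic_semigroup :: "(real \<Rightarrow> 'a::banach \<Rightarrow>\<^sub>L 'a) \<Rightarrow> bool" where
  "analytic_semigroup T \<longleftrightarrow> C0_semigroup T \<and>
     (\<exists>\<delta>>0. \<delta> \<le> pi / 2 \<and>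
       (\<exists>S :: complex \<Rightarrow> ('a \<times> 'a) \<Rightarrow>\<^sub>L ('a \<times> 'a).
         (\<forall>t>0. \<forall>x y. blinfun_apply (S (complex_of_real t)) (x, y) = (T t x, T t y)) \<and>
         (\<forall>z\<in>sector \<delta>. \<forall>w. S z o\<^sub>L cmul w = cmul w o\<^sub>L S z) \<and>
         (\<forall>z\<in>sector \<delta>. \<forall>w\<in>sector \<delta>. S (z + w) = S z o\<^sub>L S w) \<and>
         (\<forall>z\<in>sector \<delta>. \<exists>S'. ((\<lambda>w. cmul (inverse (w - z)) o\<^sub>L (S w - S z)) \<longlongrightarrow> S') (at z)) \<and>
         (\<forall>p. ((\<lambda>z. blinfun_apply (S z) p) \<longlongrightarrow> p) (at 0 within sector \<delta>))))"

section \<open>The \<open>\<phi>\<close>-functions\<close>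

definition phi_fun :: "nat \<Rightarrow> complex \<Rightarrow> complex" where
  "phi_fun k z =
     integral {0..1} (\<lambda>\<theta>. exp (complex_of_real (1 - \<theta>) * z) * complex_of_real (\<theta> ^ (k - 1) / fact (k - 1)))"

text \<open>If \<open>E t = e\<^bsup>tZ\<^esup>\<close>, then \<open>phi_op E k r\<close> is the operator \<open>\<phi>\<^sub>k(rZ)\<close>, for \<open>k \<ge> 1\<close> and \<open>r \<ge> 0\<close>.\<close>

definition phi_op :: "(real \<Rightarrow> 'a::banach \<Rightarrow> 'a) \<Rightarrow> nat \<Rightarrow> real \<Rightarrow> 'a \<Rightarrow> 'a" where
  "phi_op E k r v = integral {0..1} (\<lambda>\<theta>. (\<theta> ^ (k - 1) / fact (k - 1)) *\<^sub>R E ((1 - \<theta>) * r) v)"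

text \<open>The two kinds of \<open>e\<^bsup>tZ\<^esup>\<close> in use: \<open>Z\<close> a square matrix, and \<open>Z = hA\<close> with \<open>A\<close> the generator of \<open>T\<close>.\<close>

definition exp_matrix :: "'k::{real_normed_field,banach}^'n^'n \<Rightarrow> real \<Rightarrow> 'k^'n \<Rightarrow> 'k^'n" where
  "exp_matrix Z t v = (\<Sum>m. (t ^ m / fact m) *\<^sub>R (((*v) Z) ^^ m) v)"

definition exp_scaled :: "(real \<Rightarrow> 'a::banach \<Rightarrow>\<^sub>L 'a) \<Rightarrow> real \<Rightarrow> real \<Rightarrow> 'a \<Rightarrow> 'a" where
  "exp_scaled T h t v = T (t * h) v"

section \<open>Explicit exponential Runge--Kutta methods\<close>

text \<open>In this and the next section \<open>a i j\<close>, \<open>b i\<close> and \<open>phi k r\<close> are the operators \<open>a\<^sub>i\<^sub>j(Z)\<close>, \<open>b\<^sub>i(Z)\<close>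
  and \<open>\<phi>\<^sub>k(rZ)\<close>, with \<open>Z = hA\<close> in the method itself.\<close>

declare sum.cong [fundef_cong]

fun exp_rk_stage ::
  "real \<Rightarrow> (nat \<Rightarrow> real) \<Rightarrow> (nat \<Rightarrow> nat \<Rightarrow> 'a \<Rightarrow> 'a) \<Rightarrow> (nat \<Rightarrow> real \<Rightarrow> 'a \<Rightarrow> 'a) \<Rightarrow>
   ('a \<Rightarrow> 'a) \<Rightarrow> ('a \<Rightarrow> 'a) \<Rightarrow> 'a \<Rightarrow> nat \<Rightarrow> 'a::real_vector" where
  "exp_rk_stage h c a phi F g u i =
     u + (c i * h) *\<^sub>R phi 1 (c i) (F u)
       + h *\<^sub>R (\<Sum>j\<in>{2..<i}. a i j (g (exp_rk_stage h c a phi F g u j) - g u))"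

declare exp_rk_stage.simps [simp del]

definition exp_rk_step ::
  "nat \<Rightarrow> real \<Rightarrow> (nat \<Rightarrow> real) \<Rightarrow> (nat \<Rightarrow> nat \<Rightarrow> 'a \<Rightarrow> 'a) \<Rightarrow> (nat \<Rightarrow> 'a \<Rightarrow> 'a) \<Rightarrow>
   (nat \<Rightarrow> real \<Rightarrow> 'a \<Rightarrow> 'a) \<Rightarrow> ('a \<Rightarrow> 'a) \<Rightarrow> ('a \<Rightarrow> 'a) \<Rightarrow> 'a \<Rightarrow> 'a::real_vector" where
  "exp_rk_step s h c a b phi F g u =
     u + h *\<^sub>R phi 1 1 (F u)
       + h *\<^sub>R (\<Sum>i\<in>{2..s}. b i (g (exp_rk_stage h c a phi F g u i) - g u))"

text \<open>Here \<open>a i j\<close> is the scalar coefficient function \<open>a\<^sub>i\<^sub>j(z)\<close>.\<close>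

definition independent_stages :: "(nat \<Rightarrow> nat \<Rightarrow> complex \<Rightarrow> complex) \<Rightarrow> nat set \<Rightarrow> bool" where
  "independent_stages a I \<longleftrightarrow> (\<forall>i\<in>I. \<forall>j\<in>I. \<forall>z. a i j z = 0)"

section \<open>The stiff order conditions up to order six\<close>

definition psi ::
  "(nat \<Rightarrow> real) \<Rightarrow> (nat \<Rightarrow> nat \<Rightarrow> 'a \<Rightarrow> 'a) \<Rightarrow> (nat \<Rightarrow> real \<Rightarrow> 'a \<Rightarrow> 'a) \<Rightarrow>
   nat \<Rightarrow> nat \<Rightarrow> 'a \<Rightarrow> 'a::real_vector" where
  "psi c a phi q i v =
     (\<Sum>k\<in>{2..<i}. (c k ^ (q - 1) / fact (q - 1)) *\<^sub>R a i k v) - (c i ^ q) *\<^sub>R phi q (c i) v"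

text \<open>\<open>stiff_order_condition s c a b phi J K L B n\<close> is condition number \<open>n\<close>, \<open>1 \<le> n \<le> 36\<close>, as an
  identity between operators (or bilinear maps), for the given \<open>J\<close>, \<open>K\<close>, \<open>L\<close> and \<open>B\<close>.\<close>

definition stiff_order_condition ::
  "nat \<Rightarrow> (nat \<Rightarrow> real) \<Rightarrow> (nat \<Rightarrow> nat \<Rightarrow> 'a \<Rightarrow> 'a) \<Rightarrow> (nat \<Rightarrow> 'a \<Rightarrow> 'a) \<Rightarrow>
   (nat \<Rightarrow> real \<Rightarrow> 'a \<Rightarrow> 'a) \<Rightarrow> ('a \<Rightarrow> 'a) \<Rightarrow> ('a \<Rightarrow> 'a) \<Rightarrow> ('a \<Rightarrow> 'a) \<Rightarrow>
   ('a \<Rightarrow> 'a \<Rightarrow> 'a::real_vector) \<Rightarrow> nat \<Rightarrow> bool" where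
  "stiff_order_condition s c a b phi J K L B n \<longleftrightarrow> (let \<psi> = psi c a phi in
     (n = 1 \<longrightarrow> (\<forall>v. (\<Sum>i\<in>{2..s}. c i *\<^sub>R b i v) = phi 2 1 v)) \<and>

     (n = 2 \<longrightarrow> (\<forall>v. (\<Sum>i\<in>{2..s}. (c i ^ 2 / fact 2) *\<^sub>R b i v) = phi 3 1 v)) \<and>
     (n = 3 \<longrightarrow> (\<forall>v. (\<Sum>i\<in>{2..s}. b i (J (\<psi> 2 i v))) = 0)) \<and>

     (n = 4 \<longrightarrow> (\<forall>v. (\<Sum>i\<in>{2..s}. (c i ^ 3 / fact 3) *\<^sub>R b i v) = phi 4 1 v)) \<and>
     (n = 5 \<longrightarrow> (\<forall>v. (\<Sum>i\<in>{2..s}. b i (J (\<psi> 3 i v))) = 0)) \<and>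
     (n = 6 \<longrightarrow> (\<forall>v. (\<Sum>i\<in>{2..s}. b i (J (\<Sum>j\<in>{2..<i}. a i j (J (\<psi> 2 j v))))) = 0)) \<and>
     (n = 7 \<longrightarrow> (\<forall>v. (\<Sum>i\<in>{2..s}. c i *\<^sub>R b i (K (\<psi> 2 i v))) = 0)) \<and>

     (n = 8 \<longrightarrow> (\<forall>v. (\<Sum>i\<in>{2..s}. (c i ^ 4 / fact 4) *\<^sub>R b i v) = phi 5 1 v)) \<and>
     (n = 9 \<longrightarrow> (\<forall>v. (\<Sum>i\<in>{2..s}. b i (J (\<psi> 4 i v))) = 0)) \<and>
     (n = 10 \<longrightarrow> (\<forall>v. (\<Sum>i\<in>{2..s}. b i (J (\<Sum>j\<in>{2..<i}. a i j (J (\<psi> 3 j v))))) = 0)) \<and>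
     (n = 11 \<longrightarrow> (\<forall>v. (\<Sum>i\<in>{2..s}. b i (J (\<Sum>j\<in>{2..<i}. a i j (J
        (\<Sum>k\<in>{2..<j}. a j k (J (\<psi> 2 k v))))))) = 0)) \<and>
     (n = 12 \<longrightarrow> (\<forall>v. (\<Sum>i\<in>{2..s}. b i (J (\<Sum>j\<in>{2..<i}. c j *\<^sub>R a i j (K (\<psi> 2 j v))))) = 0)) \<and>
     (n = 13 \<longrightarrow> (\<forall>v. (\<Sum>i\<in>{2..s}. c i *\<^sub>R b i (K (\<psi> 3 i v))) = 0)) \<and>
     (n = 14 \<longrightarrow> (\<forall>v. (\<Sum>i\<in>{2..s}. c i *\<^sub>R b i (K (\<Sum>j\<in>{2..<i}. a i j (J (\<psi> 2 j v))))) = 0)) \<and>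
     (n = 15 \<longrightarrow> (\<forall>v w. (\<Sum>i\<in>{2..s}. b i (B (\<psi> 2 i v) (\<psi> 2 i w))) = 0)) \<and>
     (n = 16 \<longrightarrow> (\<forall>v. (\<Sum>i\<in>{2..s}. (c i ^ 2) *\<^sub>R b i (L (\<psi> 2 i v))) = 0)) \<and>

     (n = 17 \<longrightarrow> (\<forall>v. (\<Sum>i\<in>{2..s}. (c i ^ 5 / fact 5) *\<^sub>R b i v) = phi 6 1 v)) \<and>
     (n = 18 \<longrightarrow> (\<forall>v. (\<Sum>i\<in>{2..s}. b i (J (\<psi> 5 i v))) = 0)) \<and>
     (n = 19 \<longrightarrow> (\<forall>v. (\<Sum>i\<in>{2..s}. b i (J (\<Sum>j\<in>{2..<i}. a i j (J (\<psi> 4 j v))))) = 0)) \<and>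
     (n = 20 \<longrightarrow> (\<forall>v. (\<Sum>i\<in>{2..s}. b i (J (\<Sum>j\<in>{2..<i}. a i j (J
        (\<Sum>k\<in>{2..<j}. a j k (J (\<psi> 3 k v))))))) = 0)) \<and>
     (n = 21 \<longrightarrow> (\<forall>v. (\<Sum>i\<in>{2..s}. b i (J (\<Sum>j\<in>{2..<i}. a i j (J
        (\<Sum>k\<in>{2..<j}. a j k (J (\<Sum>l\<in>{2..<k}. a k l (J (\<psi> 2 l v))))))))) = 0)) \<and>
     (n = 22 \<longrightarrow> (\<forall>v. (\<Sum>i\<in>{2..s}. b i (J (\<Sum>j\<in>{2..<i}. a i j (J
        (\<Sum>k\<in>{2..<j}. c k *\<^sub>R a j k (K (\<psi> 2 k v))))))) = 0)) \<and>
     (n = 23 \<longrightarrow> (\<forall>v. (\<Sum>i\<in>{2..s}. b i (J (\<Sum>j\<in>{2..<i}. c j *\<^sub>R a i j (K (\<psi> 3 j v))))) = 0)) \<and>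
     (n = 24 \<longrightarrow> (\<forall>v. (\<Sum>i\<in>{2..s}. b i (J (\<Sum>j\<in>{2..<i}. c j *\<^sub>R a i j (K
        (\<Sum>k\<in>{2..<j}. a j k (J (\<psi> 2 k v))))))) = 0)) \<and>
     (n = 25 \<longrightarrow> (\<forall>v w. (\<Sum>i\<in>{2..s}. b i (J (\<Sum>j\<in>{2..<i}. a i j (B (\<psi> 2 j v) (\<psi> 2 j w))))) = 0)) \<and>
     (n = 26 \<longrightarrow> (\<forall>v. (\<Sum>i\<in>{2..s}. b i (J (\<Sum>j\<in>{2..<i}. (c j ^ 2) *\<^sub>R a i j (L (\<psi> 2 j v))))) = 0)) \<and>
     (n = 27 \<longrightarrow> (\<forall>v. (\<Sum>i\<in>{2..s}. c i *\<^sub>R b i (K (\<psi> 4 i v))) = 0)) \<and>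
     (n = 28 \<longrightarrow> (\<forall>v. (\<Sum>i\<in>{2..s}. c i *\<^sub>R b i (K (\<Sum>j\<in>{2..<i}. a i j (J (\<psi> 3 j v))))) = 0)) \<and>
     (n = 29 \<longrightarrow> (\<forall>v. (\<Sum>i\<in>{2..s}. c i *\<^sub>R b i (K (\<Sum>j\<in>{2..<i}. a i j (J
        (\<Sum>k\<in>{2..<j}. a j k (J (\<psi> 2 k v))))))) = 0)) \<and>
     (n = 30 \<longrightarrow> (\<forall>v. (\<Sum>i\<in>{2..s}. c i *\<^sub>R b i (K (\<Sum>j\<in>{2..<i}. c j *\<^sub>R a i j (K (\<psi> 2 j v))))) = 0)) \<and>
     (n = 31 \<longrightarrow> (\<forall>v w. (\<Sum>i\<in>{2..s}. b i (B (\<psi> 2 i v) (\<psi> 3 i w))) = 0)) \<and>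
     (n = 32 \<longrightarrow> (\<forall>v w. (\<Sum>i\<in>{2..s}. b i (B (\<psi> 2 i v) (\<Sum>j\<in>{2..<i}. a i j (J (\<psi> 2 j w))))) = 0)) \<and>
     (n = 33 \<longrightarrow> (\<forall>v. (\<Sum>i\<in>{2..s}. (c i ^ 2) *\<^sub>R b i (L (\<psi> 3 i v))) = 0)) \<and>
     (n = 34 \<longrightarrow> (\<forall>v. (\<Sum>i\<in>{2..s}. (c i ^ 2) *\<^sub>R b i (L (\<Sum>j\<in>{2..<i}. a i j (J (\<psi> 2 j v))))) = 0)) \<and>
     (n = 35 \<longrightarrow> (\<forall>v w. (\<Sum>i\<in>{2..s}. c i *\<^sub>R b i (B (\<psi> 2 i v) (\<psi> 2 i w))) = 0)) \<and>
     (n = 36 \<longrightarrow> (\<forall>v. (\<Sum>i\<in>{2..s}. (c i ^ 3) *\<^sub>R b i (L (\<psi> 2 i v))) = 0)))"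

section \<open>The family ExpRK6s15\<close>

text \<open>The coefficients are linear combinations of values \<open>\<phi>\<^sub>k(rz)\<close>. They are written over an
  arbitrary real vector space, with \<open>\<phi> k r\<close> standing for \<open>\<phi>\<^sub>k(rz)\<close>, so that the same formulas serve
  as scalar functions and as operators: for the latter, \<open>\<phi> k r\<close> is \<open>\<phi>\<^sub>k(rZ) v\<close> at a vector \<open>v\<close>.\<close>

definition a_two ::
  "(nat \<Rightarrow> real) \<Rightarrow> (nat \<Rightarrow> real \<Rightarrow> 'v::real_vector) \<Rightarrow> nat \<Rightarrow> nat \<Rightarrow> nat \<Rightarrow> 'v" where
  "a_two c \<phi> i j k =
     (- (c i ^ 2 * c k) *\<^sub>R \<phi> 2 (c i) + (2 * c i ^ 3) *\<^sub>R \<phi> 3 (c i)) /\<^sub>R (c j * (c j - c k))"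

definition a_three ::
  "(nat \<Rightarrow> real) \<Rightarrow> (nat \<Rightarrow> real \<Rightarrow> 'v::real_vector) \<Rightarrow> nat \<Rightarrow> nat \<Rightarrow> nat \<Rightarrow> nat \<Rightarrow> 'v" where
  "a_three c \<phi> i j k l =
     ((c i ^ 2 * c k * c l) *\<^sub>R \<phi> 2 (c i) - (2 * c i ^ 3 * (c k + c l)) *\<^sub>R \<phi> 3 (c i)
        + (6 * c i ^ 4) *\<^sub>R \<phi> 4 (c i))
     /\<^sub>R (c j * (c j - c k) * (c j - c l))"

definition a_four ::
  "(nat \<Rightarrow> real) \<Rightarrow> (nat \<Rightarrow> real \<Rightarrow> 'v::real_vector) \<Rightarrow> nat \<Rightarrow> nat \<Rightarrow> nat \<Rightarrow> nat \<Rightarrow> nat \<Rightarrow> 'v" where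
  "a_four c \<phi> i j d k l =
     (- (c i ^ 2 * c d * c k * c l) *\<^sub>R \<phi> 2 (c i)
        + (2 * c i ^ 3 * (c d * c k + c d * c l + c k * c l)) *\<^sub>R \<phi> 3 (c i)
        - (6 * c i ^ 4 * (c d + c k + c l)) *\<^sub>R \<phi> 4 (c i)
        + (24 * c i ^ 5) *\<^sub>R \<phi> 5 (c i))
     /\<^sub>R (c j * (c j - c d) * (c j - c k) * (c j - c l))"

definition b_four ::
  "(nat \<Rightarrow> real) \<Rightarrow> (nat \<Rightarrow> real \<Rightarrow> 'v::real_vector) \<Rightarrow> nat \<Rightarrow> nat \<Rightarrow> nat \<Rightarrow> nat \<Rightarrow> 'v" where
  "b_four c \<phi> i d k l =
     (- (c d * c k * c l) *\<^sub>R \<phi> 2 1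
        + (2 * (c d * c k + c d * c l + c k * c l)) *\<^sub>R \<phi> 3 1
        - (6 * (c d + c k + c l)) *\<^sub>R \<phi> 4 1
        + 24 *\<^sub>R \<phi> 5 1)
     /\<^sub>R (c i * (c i - c d) * (c i - c k) * (c i - c l))"

definition ExpRK6s15_a ::
  "(nat \<Rightarrow> real) \<Rightarrow> (nat \<Rightarrow> real \<Rightarrow> 'v::real_vector) \<Rightarrow> nat \<Rightarrow> nat \<Rightarrow> 'v" where
  "ExpRK6s15_a c \<phi> i j =
    (if i \<in> {3,4} \<and> j = 2 then (c i ^ 2 / c 2) *\<^sub>R \<phi> 2 (c i)
     else if i \<in> {5..7} \<and> j = 3 then a_two c \<phi> i 3 4
     else if i \<in> {5..7} \<and> j = 4 then a_two c \<phi> i 4 3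
     else if i \<in> {8..11} \<and> j = 5 then a_three c \<phi> i 5 6 7
     else if i \<in> {8..11} \<and> j = 6 then a_three c \<phi> i 6 5 7
     else if i \<in> {8..11} \<and> j = 7 then a_three c \<phi> i 7 5 6
     else if i \<in> {12..15} \<and> j = 8 then a_four c \<phi> i 8 9 10 11
     else if i \<in> {12..15} \<and> j = 9 then a_four c \<phi> i 9 8 10 11
     else if i \<in> {12..15} \<and> j = 10 then a_four c \<phi> i 10 8 9 11
     else if i \<in> {12..15} \<and> j = 11 then a_four c \<phi> i 11 8 9 10
     else 0)"

definition ExpRK6s15_b ::
  "(nat \<Rightarrow> real) \<Rightarrow> (nat \<Rightarrow> real \<Rightarrow> 'v::real_vector) \<Rightarrow> nat \<Rightarrow> 'v" where
  "ExpRK6s15_b c \<phi> i =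
    (if i = 12 then b_four c \<phi> 12 13 14 15
     else if i = 13 then b_four c \<phi> 13 12 14 15
     else if i = 14 then b_four c \<phi> 14 12 13 15
     else if i = 15 then b_four c \<phi> 15 12 13 14
     else 0)"

definition ExpRK6s15_a_fun :: "(nat \<Rightarrow> real) \<Rightarrow> nat \<Rightarrow> nat \<Rightarrow> complex \<Rightarrow> complex" where
  "ExpRK6s15_a_fun c i j z = ExpRK6s15_a c (\<lambda>k r. phi_fun k (complex_of_real r * z)) i j"

definition ExpRK6s15_b_fun :: "(nat \<Rightarrow> real) \<Rightarrow> nat \<Rightarrow> complex \<Rightarrow> complex" where
  "ExpRK6s15_b_fun c i z = ExpRK6s15_b c (\<lambda>k r. phi_fun k (complex_of_real r * z)) i"

definition ExpRK6s15_a_op ::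
  "(nat \<Rightarrow> real) \<Rightarrow> (real \<Rightarrow> 'a::banach \<Rightarrow> 'a) \<Rightarrow> nat \<Rightarrow> nat \<Rightarrow> 'a \<Rightarrow> 'a" where
  "ExpRK6s15_a_op c E i j v = ExpRK6s15_a c (\<lambda>k r. phi_op E k r v) i j"

definition ExpRK6s15_b_op ::
  "(nat \<Rightarrow> real) \<Rightarrow> (real \<Rightarrow> 'a::banach \<Rightarrow> 'a) \<Rightarrow> nat \<Rightarrow> 'a \<Rightarrow> 'a" where
  "ExpRK6s15_b_op c E i v = ExpRK6s15_b c (\<lambda>k r. phi_op E k r v) i"

definition ExpRK6s15_condition ::
  "(nat \<Rightarrow> real) \<Rightarrow> (real \<Rightarrow> 'a::banach \<Rightarrow> 'a) \<Rightarrow> ('a \<Rightarrow> 'a) \<Rightarrow> ('a \<Rightarrow> 'a) \<Rightarrow> ('a \<Rightarrow> 'a) \<Rightarrow>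
   ('a \<Rightarrow> 'a \<Rightarrow> 'a) \<Rightarrow> nat \<Rightarrow> bool" where
  "ExpRK6s15_condition c E J K L B n \<longleftrightarrow>
     stiff_order_condition 15 c (ExpRK6s15_a_op c E) (ExpRK6s15_b_op c E) (phi_op E) J K L B n"

definition ExpRK6s15_solution ::
  "(nat \<Rightarrow> real) \<Rightarrow> ('a::banach \<Rightarrow> 'a) \<Rightarrow> (real \<Rightarrow> 'a \<Rightarrow>\<^sub>L 'a) \<Rightarrow> ('a \<Rightarrow> 'a) \<Rightarrow> real \<Rightarrow> 'a \<Rightarrow>
   nat \<Rightarrow> 'a" where
  "ExpRK6s15_solution c A T g h u0 n =
     (let E = exp_scaled T h in
       exp_rk_step 15 h c (ExpRK6s15_a_op c E) (ExpRK6s15_b_op c E) (phi_op E)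
         (\<lambda>u. A u + g u) g ^^ n) u0"

section \<open>Regularity of the data\<close>

text \<open>\<open>G k x\<close> is the \<open>k\<close>-th Frechet derivative of \<open>g\<close> at \<open>x\<close>, a \<open>k\<close>-linear map taking its arguments
  as a list. The last clause is differentiability with respect to the norm of multilinear maps.\<close>

definition bounded_Frechet_derivatives :: "nat \<Rightarrow> ('a::real_normed_vector \<Rightarrow> 'a) \<Rightarrow> 'a set \<Rightarrow> bool" where
  "bounded_Frechet_derivatives m g S \<longleftrightarrow>
     (\<exists>G :: nat \<Rightarrow> 'a \<Rightarrow> 'a list \<Rightarrow> 'a.
        (\<forall>x\<in>S. G 0 x [] = g x) \<and>
        (\<forall>k\<in>{1..m}. \<exists>M. \<forall>x\<in>S. \<forall>vs. length vs = k \<longrightarrow>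
           (\<forall>i<k. linear (\<lambda>w. G k x (vs[i := w]))) \<and>
           norm (G k x vs) \<le> M * prod_list (map norm vs)) \<and>
        (\<forall>k<m. \<forall>x\<in>S. \<forall>\<epsilon>>0. \<exists>\<delta>>0. \<forall>y\<in>S. dist y x < \<delta> \<longrightarrow>
           (\<forall>vs. length vs = k \<longrightarrow>
              norm (G k y vs - G k x vs - G (Suc k) x ((y - x) # vs))
                \<le> \<epsilon> * norm (y - x) * prod_list (map norm vs))))"

definition bounded_time_derivatives :: "nat \<Rightarrow> (real \<Rightarrow> 'a::real_normed_vector) \<Rightarrow> real set \<Rightarrow> bool" where
  "bounded_time_derivatives m u I \<longleftrightarrow>
     (\<exists>U :: nat \<Rightarrow> real \<Rightarrow> 'a.
        (\<forall>t\<in>I. U 0 t = u t) \<and>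
        (\<forall>k<m. \<forall>t\<in>I. (U k has_vector_derivative U (Suc k) t) (at t within I)) \<and>
        (\<forall>k\<le>m. bounded (U k ` I)))"

definition strip :: "(real \<Rightarrow> 'a::metric_space) \<Rightarrow> real set \<Rightarrow> real \<Rightarrow> 'a set" where
  "strip u I \<rho> = (\<Union>t\<in>I. ball (u t) \<rho>)"

definition solves_ivp ::
  "('a::real_normed_vector \<Rightarrow> 'a) \<Rightarrow> 'a set \<Rightarrow> ('a \<Rightarrow> 'a) \<Rightarrow> real \<Rightarrow> real \<Rightarrow> 'a \<Rightarrow> (real \<Rightarrow> 'a) \<Rightarrow> bool" where
  "solves_ivp A D g t0 tend u0 u \<longleftrightarrow>
     u t0 = u0 \<and>
     (\<forall>t\<in>{t0..tend}. u t \<in> D \<and>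
        (u has_vector_derivative (A (u t) + g (u t))) (at t within {t0..tend}))"

end

theory Submission
  imports Defs
begin

text \<open>The coefficients of each group of stages are Lagrange interpolation weights at the nodes of the
  preceding group, integrated against the semigroup. Hence \<open>\<psi>\<^bsub>q,i\<^esub> = 0\<close> up to one order more in
  each successive group, and every stiff order condition vanishes term by term.

  For the convergence, the stages inherit the same pattern: a stage of the \<open>p\<close>-th group approximates
  the solution up to \<open>O(h\<^bsup>p+1\<^esup>)\<close>, since its error is \<open>h\<close> times the errors of the preceding group plus
  a quadrature error. Only the Lipschitz continuity of \<open>g\<close> enters here. The local error is
  therefore \<open>h\<^sup>6 X(hA) f\<^bsup>(5)\<^esup> + O(h\<^sup>7)\<close> with \<open>f = g \<circ> u\<close>, where \<open>X\<close> is a combination of \<open>\<phi>\<close>-functions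
  with \<open>X(0) = 0\<close>, which is the weakened condition No. 17. For an analytic semigroup the sums
  \<open>\<Sum>\<^sub>j e\<^bsup>jhA\<^esup> X(hA)\<close> are bounded uniformly in \<open>h\<close> and the number of terms, so summation by parts
  yields a contribution \<open>O(h\<^sup>6)\<close> to the global error, and Gronwall's lemma concludes.\<close>

section \<open>Strongly continuous semigroups\<close>

text \<open>The hypothesis on \<open>c 12\<close>, ..., \<open>c 15\<close> says that the integral
  of x (x - c 12) (x - c 13) (x - c 14) (x - c 15) over [0, 1] vanishes. At z = 0 the weights
  \<open>b i\<close> form the interpolatory quadrature with the additional node 0, where the
  difference D is zero, and this orthogonality raises its degree of exactness from 4 to 5. For the
  operators themselves exactness ends at 4. The remaining defect cannot be converted into a further
  power of h, since f^(5) need not lie in the domain of A, and adding n defects of size h^6 in norm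
  would lose an order; so their sum has to be estimated as a whole. The unbounded A is kept out of
  all estimates: the term A v of the scheme is absorbed in T s v - v, and relations between
  derivatives of the solution are differentiated in integrated form. Finally, g is controlled only
  in the strip, so every stage estimate also has to show that the stage stays there, and the
  smallness of the accumulated error is proved together with its bound.\<close>

lemma banach_steinhaus:
  fixes F :: "nat \<Rightarrow> 'a::banach \<Rightarrow>\<^sub>L 'b::real_normed_vector"
  assumes "\<And>x. bounded (range (\<lambda>n. F n x))"
  shows "bounded (range F)"
proof -
  define K where "K m = {x. \<forall>n. norm (F n x) \<le> real m}" for m
  have cl: "closed (K m)" for m
  proof -
    have "K m = (\<Inter>n. {x. norm (F n x) \<le> real m})"
      by (auto simp: K_def)
    moreover have "closed {x. norm (F n x) \<le> real m}" for n
      by (intro closed_Collect_le continuous_intros)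
    ultimately show ?thesis
      by auto
  qed
  have UN: "(\<Union>(range K)) = UNIV"
  proof -
    have "\<exists>m. x \<in> K m" for x
    proof -
      obtain B where "\<And>n. norm (F n x) \<le> B"
        using assms[of x] by (auto simp: bounded_iff)
      moreover obtain m where "B \<le> real m"
        using real_arch_simple by blast
      ultimately show ?thesis
        by (auto simp: K_def intro: order_trans)
    qed
    then show ?thesis by blast
  qed
  \<comment> \<open>Baire: the closed sets \<open>K m\<close> cover the space, so one of them
    contains a ball. Differences of points of this ball reach every direction, hence the factor 2 in
    the operator bound.\<close>
  have "\<exists>m. interior (K m) \<noteq> {}"
  proof (rule ccontr)
    assume *: "\<not> ?thesis"
    have "Met_TC.mtopology interior_of (\<Union>(range K)) = {}"
      by (rule Met_TC.metric_Baire_category_alt)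
        (use cl * in \<open>auto simp: complete_UNIV\<close>)
    then show False
      using UN by simp
  qed
  then obtain m x0 where "x0 \<in> interior (K m)"
    by blast
  then obtain e where e: "e > 0" "cball x0 e \<subseteq> K m"
    by (meson mem_interior_cball)
  have "norm (F n) \<le> 2 * real m / e" for n
  proof (rule norm_blinfun_bound)
    show "0 \<le> 2 * real m / e" using e by simp
    fix x :: 'a
    show "norm (F n x) \<le> 2 * real m / e * norm x"
    proof (cases "x = 0")
      case False
      define y where "y = (e / norm x) *\<^sub>R x"
      have "norm y = e" using False e by (simp add: y_def)
      then have "x0 + y \<in> K m" "x0 \<in> K m"
        using e by (auto simp: subset_iff dist_norm)
      then have "norm (F n (x0 + y)) \<le> real m" "norm (F n x0) \<le> real m"
        by (auto simp: K_def)
      then have "norm (F n y) \<le> 2 * real m"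
        using norm_triangle_ineq4[of "F n (x0 + y)" "F n x0"]
        by (simp add: blinfun.add_right)
      moreover have "norm (F n y) = e / norm x * norm (F n x)"
        using e by (simp add: y_def blinfun.scaleR_right)
      ultimately show ?thesis
        using False e by (simp add: field_simps)
    qed simp
  qed
  then show ?thesis
    by (auto simp: bounded_iff)
qed

text \<open>A failure would produce points z n tending to z0 with norm (S (z n)) > n. Strong
  convergence makes this sequence pointwise bounded, against uniform boundedness. The general index
  space serves both the real half-line and a complex sector.\<close>

lemma locally_bounded_of_strong_limit:
  fixes S :: "'c::metric_space \<Rightarrow> 'a::banach \<Rightarrow>\<^sub>L 'b::real_normed_vector"
  assumes lim: "\<And>p. ((\<lambda>z. S z p) \<longlongrightarrow> l p) (at z0 within A)"
  obtains r M where "r > 0" "\<And>z. z \<in> A \<Longrightarrow> z \<noteq> z0 \<Longrightarrow> dist z z0 < r \<Longrightarrow> norm (S z) \<le> M"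
proof -
  have "\<exists>r>0. \<exists>M. \<forall>z\<in>A. z \<noteq> z0 \<longrightarrow> dist z z0 < r \<longrightarrow> norm (S z) \<le> M"
  proof (rule ccontr)
    assume "\<not> ?thesis"
    then have "\<forall>r>0. \<forall>M. \<exists>z\<in>A. z \<noteq> z0 \<and> dist z z0 < r \<and> \<not> norm (S z) \<le> M"
      by blast
    then have "\<exists>z\<in>A. z \<noteq> z0 \<and> dist z z0 < 1 / real (Suc n) \<and> \<not> norm (S z) \<le> real n" for n
      by simp
    then obtain z where z: "\<And>n. z n \<in> A" "\<And>n. z n \<noteq> z0" "\<And>n. dist (z n) z0 < 1 / real (Suc n)"
      "\<And>n. norm (S (z n)) > real n"
      by (metis linorder_not_less)
    have "(\<lambda>n. dist (z n) z0) \<longlonglongrightarrow> 0"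
    proof (rule tendsto_sandwich[OF _ _ tendsto_const])
      show "(\<lambda>n. 1 / real (Suc n)) \<longlonglongrightarrow> 0"
        using LIMSEQ_inverse_real_of_nat by (simp add: inverse_eq_divide)
    qed (use z(3) in \<open>auto intro!: always_eventually less_imp_le\<close>)
    then have "z \<longlonglongrightarrow> z0"
      using tendsto_dist_iff by blast
    then have fl: "filterlim z (at z0 within A) sequentially"
      using z(1,2) by (auto simp: filterlim_at)
    have "bounded (range (\<lambda>n. S (z n) x))" for x
      using filterlim_compose[OF lim fl] by (rule convergent_imp_bounded)
    then have "bounded (range (\<lambda>n. S (z n)))"
      by (rule banach_steinhaus)
    then obtain B where "\<And>n. norm (S (z n)) \<le> B"
      by (auto simp: bounded_iff)
    moreover obtain n where "B < real n"
      using reals_Archimedean2 by blast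
    ultimately show False
      using z(4)[of n] by (meson less_le_not_le order_trans)
  qed
  then show ?thesis using that by blast
qed

locale c0_semigroup =
  fixes T :: "real \<Rightarrow> 'a::banach \<Rightarrow>\<^sub>L 'a"
  assumes C0: "C0_semigroup T"
begin

lemma T_0 [simp]: "T 0 x = x"
  using C0 by (simp add: C0_semigroup_def)

lemma T_add: "s \<ge> 0 \<Longrightarrow> t \<ge> 0 \<Longrightarrow> T (s + t) = T s o\<^sub>L T t"
  using C0 by (simp add: C0_semigroup_def)

lemma T_add_apply: "s \<ge> 0 \<Longrightarrow> t \<ge> 0 \<Longrightarrow> T (s + t) x = T s (T t x)"
  using T_add by simp

lemma T_at_right: "((\<lambda>t. T t x) \<longlongrightarrow> x) (at_right 0)"
  using C0 by (simp add: C0_semigroup_def)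

text \<open>Near 0 the norms are bounded by the strong limit. A long time is split into n + 1 equal
  pieces shorter than r, and the semigroup law bounds the norm by a power of the short-time
  bound.\<close>

lemma T_bounded:
  obtains M where "M \<ge> 1" "\<And>t. 0 \<le> t \<Longrightarrow> t \<le> R \<Longrightarrow> norm (T t) \<le> M"
proof -
  obtain r M where r: "r > 0" and M: "\<And>t. t > 0 \<Longrightarrow> t < r \<Longrightarrow> norm (T t) \<le> M"
    using locally_bounded_of_strong_limit[OF T_at_right]
    by (auto simp: dist_real_def)
  define N where "N = max 1 M"
  have N: "norm (T t) \<le> N" if "0 \<le> t" "t < r" for t
    using M[of t] that C0 norm_blinfun_id_le
    by (cases "t = 0") (auto simp: N_def C0_semigroup_def max_def intro: order_trans)
  have Nn: "norm (T (real n * s)) \<le> N ^ n" if "0 \<le> s" "s < r" for n s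
  proof (induction n)
    case 0
    then show ?case using C0 norm_blinfun_id_le by (simp add: C0_semigroup_def)
  next
    case (Suc n)
    have "T (real (Suc n) * s) = T s o\<^sub>L T (real n * s)"
      using that T_add[of s "real n * s"] by (simp add: algebra_simps)
    then have "norm (T (real (Suc n) * s)) \<le> norm (T s) * norm (T (real n * s))"
      using norm_blinfun_compose by metis
    also have "\<dots> \<le> N * N ^ n"
      using Suc N that by (intro mult_mono) (auto simp: N_def)
    finally show ?case by simp
  qed
  obtain n where n: "real n > R / r" using reals_Archimedean2 by blast
  have "norm (T t) \<le> N ^ Suc n" if "0 \<le> t" "t \<le> R" for t
  proof -
    have "R < real n * r" using n r by (simp add: field_simps)
    then have "t / real (Suc n) < r" using that r by (simp add: field_simps)
    then show ?thesis
      using Nn[of "t / real (Suc n)" "Suc n"] that by simp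
  qed
  moreover have "N ^ Suc n \<ge> 1" by (rule one_le_power) (simp add: N_def)
  ultimately show ?thesis using that by blast
qed

text \<open>Right continuity at 0 is transported by T b x - T a x = T a (T (b - a) x - x) for a < b.
  As s may be either of the two times, this gives continuity from both sides at once, given a norm
  bound up to s + 1.\<close>

lemma T_continuous: "continuous_on {0..} (\<lambda>t. T t x)"
proof (rule continuous_onI)
  fix s e :: real assume s: "s \<in> {0..}" and e: "0 < e"
  obtain M where M: "M \<ge> 1" "\<And>t. 0 \<le> t \<Longrightarrow> t \<le> s + 1 \<Longrightarrow> norm (T t) \<le> M"
    using T_bounded by blast
  have "\<forall>\<^sub>F t in at_right 0. dist (T t x) x < e / M"
    using T_at_right tendstoD M e by (metis divide_pos_pos less_le_trans zero_less_one)
  then obtain d where d: "d > 0" "\<And>t. 0 < t \<Longrightarrow> t < d \<Longrightarrow> dist (T t x) x < e / M"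
    by (auto simp: eventually_at_right_field)
  have key: "norm (T b x - T a x) \<le> e" if "0 \<le> a" "a < b" "b - a < d" "b \<le> s + 1" for a b
  proof -
    have "T b x - T a x = T a (T (b - a) x - x)"
      using that T_add_apply[of a "b - a" x] by (simp add: blinfun.diff_right)
    then have "norm (T b x - T a x) \<le> norm (T a) * norm (T (b - a) x - x)"
      by (simp add: norm_blinfun)
    also have "\<dots> \<le> M * (e / M)"
      using M d(2)[of "b - a"] that by (intro mult_mono) (auto simp: dist_norm)
    also have "\<dots> = e" using M by simp
    finally show ?thesis .
  qed
  show "\<exists>d>0. \<forall>t\<in>{0..}. dist t s < d \<longrightarrow> dist (T t x) (T s x) \<le> e"
  proof (intro exI[of _ "min d 1"] conjI ballI impI)
    fix t :: real assume t: "t \<in> {0..}" "dist t s < min d 1"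
    consider "t < s" | "t = s" | "t > s" by linarith
    then show "dist (T t x) (T s x) \<le> e"
    proof cases
      case 1
      then show ?thesis using key[of t s] t s by (simp add: dist_norm norm_minus_commute)
    next
      case 2
      then show ?thesis using e by simp
    next
      case 3
      then show ?thesis using key[of s t] t s by (simp add: dist_norm)
    qed
  qed (use d in auto)
qed

lemma T_continuous_compose [continuous_intros]:
  "continuous_on S f \<Longrightarrow> (\<And>t. t \<in> S \<Longrightarrow> 0 \<le> f t) \<Longrightarrow> continuous_on S (\<lambda>t. T (f t) x)"
  by (rule continuous_on_compose2[OF T_continuous]) auto

end

section \<open>Operator-valued holomorphic functions\<close>

interpretation blinfun_compose: bounded_bilinear "(o\<^sub>L)"
  by (rule bounded_bilinear_blinfun_compose)

lemma blinfun_compose_id [simp]: "id_blinfun o\<^sub>L F = F" "F o\<^sub>L id_blinfun = F"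
  by (auto intro: blinfun_eqI)

lemma blinfun_compose_assoc: "(F o\<^sub>L G) o\<^sub>L H = F o\<^sub>L (G o\<^sub>L H)"
  by (rule blinfun_eqI) simp

lemma cmul_apply: "cmul z p = (Re z *\<^sub>R fst p - Im z *\<^sub>R snd p, Re z *\<^sub>R snd p + Im z *\<^sub>R fst p)"
  by transfer simp

lemma cmul_of_real: "cmul (complex_of_real r) = r *\<^sub>R id_blinfun"
  by (rule blinfun_eqI) (auto simp: cmul_apply blinfun.scaleR_left)

lemma cmul_1 [simp]: "cmul 1 = id_blinfun"
  using cmul_of_real[of 1] by simp

lemma cmul_mult: "cmul (z * w) = cmul z o\<^sub>L cmul w"
  by (rule blinfun_eqI) (auto simp: cmul_apply algebra_simps)

lemma cmul_scaleR: "cmul (r *\<^sub>R z) = r *\<^sub>R cmul z"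
  by (rule blinfun_eqI) (auto simp: cmul_apply blinfun.scaleR_left algebra_simps)

lemma cmul_minus: "cmul (- z) = - cmul z"
  by (rule blinfun_eqI) (auto simp: cmul_apply blinfun.minus_left)

text \<open>Multiplication by \<i> is an isometry of the product norm, and |Re z| + |Im z| is at
  most 2 |z|. The factor 2 pays for a norm that is not homogeneous over the complex numbers, and it
  reappears in the Cauchy estimate.\<close>

lemma norm_cmul_le: "norm (cmul z) \<le> 2 * cmod z"
proof (rule norm_blinfun_bound)
  fix p :: "'a \<times> 'a"
  have "cmul z p = Re z *\<^sub>R p + Im z *\<^sub>R (- snd p, fst p)"
    by (auto simp: cmul_apply prod_eq_iff)
  then have "norm (cmul z p) \<le> \<bar>Re z\<bar> * norm p + \<bar>Im z\<bar> * norm (- snd p, fst p)"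
    using norm_triangle_ineq[of "Re z *\<^sub>R p" "Im z *\<^sub>R (- snd p, fst p)"]
    by (simp only: norm_scaleR)
  also have "norm (- snd p, fst p) = norm p"
    by (simp add: norm_prod_def add.commute)
  also have "\<bar>Re z\<bar> * norm p + \<bar>Im z\<bar> * norm p \<le> 2 * cmod z * norm p"
    using mult_right_mono[OF add_mono[OF abs_Re_le_cmod[of z] abs_Im_le_cmod[of z]] norm_ge_zero[of p]]
    by (simp add: algebra_simps)
  finally show "norm (cmul z p) \<le> 2 * cmod z * norm p" .
qed simp

lemma bounded_linear_cmul: "bounded_linear (cmul :: complex \<Rightarrow> ('a::real_normed_vector \<times> 'a) \<Rightarrow>\<^sub>L ('a \<times> 'a))"
proof (rule bounded_linear_intro[where K = 2])
  show "cmul (x + y) = cmul x + (cmul y :: ('a \<times> 'a) \<Rightarrow>\<^sub>L ('a \<times> 'a))" for x y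
    by (rule blinfun_eqI) (auto simp: cmul_apply blinfun.add_left algebra_simps)
  show "norm (cmul x :: ('a \<times> 'a) \<Rightarrow>\<^sub>L ('a \<times> 'a)) \<le> norm x * 2" for x
    using norm_cmul_le[of x, where 'a = 'a] by (simp add: mult.commute)
qed (rule cmul_scaleR)

text \<open>Complex differentiability is encoded as a real Frechet derivative acting by complex
  multiplication, so that the real calculus of curves and integrals applies to operators into the
  complexification.\<close>

definition has_cderiv :: "(complex \<Rightarrow> 'b::real_normed_vector \<Rightarrow>\<^sub>L ('a::real_normed_vector \<times> 'a)) \<Rightarrow>
    ('b \<Rightarrow>\<^sub>L ('a \<times> 'a)) \<Rightarrow> complex \<Rightarrow> bool" where
  "has_cderiv f F z \<longleftrightarrow> (f has_derivative (\<lambda>d. cmul d o\<^sub>L F)) (at z)"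

lemma has_cderiv_chain:
  assumes f: "has_cderiv f F (g t)" and g: "(g has_vector_derivative d) (at t within S)"
  shows "((\<lambda>t. f (g t)) has_vector_derivative (cmul d o\<^sub>L F)) (at t within S)"
proof -
  have "((\<lambda>t. f (g t)) has_derivative (\<lambda>x. cmul (x *\<^sub>R d) o\<^sub>L F)) (at t within S)"
    using has_derivative_compose[OF g[unfolded has_vector_derivative_def] f[unfolded has_cderiv_def]] .
  then show ?thesis
    by (simp add: has_vector_derivative_def cmul_scaleR blinfun_compose.scaleR_left)
qed

text \<open>The Frechet remainder is the error of the complex difference quotient multiplied by
  \<open>cmul (w - z)\<close>, which costs at most 2 |w - z|.\<close>

lemma has_cderivI:
  fixes f :: "complex \<Rightarrow> 'b::real_normed_vector \<Rightarrow>\<^sub>L ('a::real_normed_vector \<times> 'a)"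
  assumes "((\<lambda>w. cmul (inverse (w - z)) o\<^sub>L (f w - f z)) \<longlongrightarrow> F) (at z)"
  shows "has_cderiv f F z"
  unfolding has_cderiv_def has_derivative_at2
proof
  show "bounded_linear (\<lambda>d. cmul d o\<^sub>L F)"
    by (rule bounded_linear_compose[OF blinfun_compose.bounded_linear_left bounded_linear_cmul])
  let ?q = "\<lambda>w. (cmul (inverse (w - z)) o\<^sub>L (f w - f z)) - F"
  have lim: "((\<lambda>w. 2 * norm (?q w)) \<longlongrightarrow> 0) (at z)"
    using assms by (intro tendsto_mult_right_zero tendsto_norm_zero LIM_zero)
  have bnd: "norm ((1 / cmod (w - z)) *\<^sub>R (f w - (f z + (cmul (w - z) o\<^sub>L F)))) \<le> 2 * norm (?q w)"
    if "w \<noteq> z" for w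
  proof -
    have "cmul (w - z) o\<^sub>L (cmul (inverse (w - z)) o\<^sub>L (f w - f z)) = f w - f z"
      using that by (simp add: blinfun_compose_assoc[symmetric] cmul_mult[symmetric])
    then have "f w - (f z + (cmul (w - z) o\<^sub>L F)) = cmul (w - z) o\<^sub>L ?q w"
      by (simp add: blinfun_compose.diff_right)
    then have "norm (f w - (f z + (cmul (w - z) o\<^sub>L F))) \<le> norm (cmul (w - z) :: ('a \<times> 'a) \<Rightarrow>\<^sub>L ('a \<times> 'a)) * norm (?q w)"
      by (simp add: norm_blinfun_compose)
    also have "\<dots> \<le> (2 * cmod (w - z)) * norm (?q w)"
      by (rule mult_right_mono[OF norm_cmul_le]) simp
    finally show ?thesis
      unfolding norm_scaleR using that
      by (simp add: mult.assoc mult.left_commute[of 2] pos_divide_le_eq mult.commute[of _ "cmod _"])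
  qed
  have "\<forall>\<^sub>F w in at z. norm ((1 / cmod (w - z)) *\<^sub>R (f w - (f z + (cmul (w - z) o\<^sub>L F)))) \<le> 2 * norm (?q w)"
    unfolding eventually_at_filter by (rule always_eventually) (use bnd in blast)
  from this lim show "(\<lambda>w. (1 / cmod (w - z)) *\<^sub>R (f w - (f z + (cmul (w - z) o\<^sub>L F)))) \<midarrow>z\<rightarrow> 0"
    by (rule Lim_null_comparison)
qed

lemma has_cderiv_unique:
  assumes "has_cderiv f F z" "has_cderiv f G z"
  shows "F = G"
proof -
  have "(\<lambda>d. cmul d o\<^sub>L F) = (\<lambda>d. cmul d o\<^sub>L G)"
    using assms has_derivative_unique unfolding has_cderiv_def by blast
  from fun_cong[OF this, of 1] show ?thesis by simp
qed

lemma has_cderiv_continuous: "has_cderiv f F z \<Longrightarrow> isCont f z"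
  unfolding has_cderiv_def using has_derivative_continuous by blast

text \<open>With \<open>K \<lambda>\<close> the integral of \<open>e\<^bsup>-i\<theta>\<^esup> f (z0 + \<lambda> r e\<^bsup>i\<theta>\<^esup>)\<close> over \<open>\<theta>\<close>, integration by parts gives
  \<open>\<lambda> K' = K\<close>, so \<open>K\<close> is linear and \<open>K 1 = K' 0 = 2 \<pi> r f' z0\<close>.\<close>

lemma cauchy_estimate:
  fixes f :: "complex \<Rightarrow> 'b::real_normed_vector \<Rightarrow>\<^sub>L ('a::banach \<times> 'a)"
  assumes r: "r > 0"
    and der: "\<And>z. z \<in> cball z0 r \<Longrightarrow> has_cderiv f (f' z) z"
    and cont: "continuous_on (cball z0 r) f'"
    and M: "\<And>z. z \<in> cball z0 r \<Longrightarrow> norm (f z) \<le> M"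
  shows "norm (f' z0) \<le> 2 * M / r"
proof -
  define p where "p l \<theta> = z0 + complex_of_real (l * r) * cis \<theta>" for l \<theta>
  define k where "k l \<theta> = cmul (cis (- \<theta>)) o\<^sub>L f (p l \<theta>)" for l \<theta>
  define K where "K l = integral {0..2 * pi} (k l)" for l
  define m where "m l = integral {0..2 * pi} (\<lambda>\<theta>. r *\<^sub>R f' (p l \<theta>))" for l
  have p: "p l \<theta> \<in> cball z0 r" if "l \<in> {0..1}" for l \<theta>
    using that r by (auto simp: p_def dist_norm norm_mult abs_mult mult_le_cancel_right1)
  have contf: "continuous_on (cball z0 r) f"
    using has_cderiv_continuous[OF der] continuous_at_imp_continuous_on by blast
  have contp: "continuous_on A (p l)" for A l
    unfolding p_def by (intro continuous_intros)
  have contp2: "continuous_on A (\<lambda>x. p (fst x) (snd x))" for A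
    unfolding p_def by (intro continuous_intros)
  have contf': "continuous_on {0..2 * pi} (\<lambda>\<theta>. f' (p l \<theta>))" if "l \<in> {0..1}" for l
    by (rule continuous_on_compose2[OF cont contp]) (use p[OF that] in blast)
  have contk: "continuous_on {0..2 * pi} (k l)" if "l \<in> {0..1}" for l
    unfolding k_def
  proof (rule bounded_bilinear.continuous_on[OF bounded_bilinear_blinfun_compose])
    show "continuous_on {0..2 * pi} (\<lambda>\<theta>. cmul (cis (- \<theta>)))"
      by (intro bounded_linear.continuous_on[OF bounded_linear_cmul] continuous_intros)
    show "continuous_on {0..2 * pi} (\<lambda>\<theta>. f (p l \<theta>))"
      by (rule continuous_on_compose2[OF contf contp]) (use p[OF that] in blast)
  qed
  \<comment> \<open>Differentiation under the integral in the radial parameter l: the rotation by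
    cis (-\<theta>) cancels the direction cis \<theta> of the ray.\<close>
  have K': "(K has_vector_derivative m l) (at l within {0..1})" if "l \<in> {0..1}" for l
  proof -
    have "((\<lambda>l. integral (cbox 0 (2 * pi)) (k l)) has_vector_derivative
        integral (cbox 0 (2 * pi)) (\<lambda>\<theta>. r *\<^sub>R f' (p l \<theta>))) (at l within {0..1})"
    proof (rule leibniz_rule_vector_derivative)
      fix l \<theta> :: real assume l: "l \<in> {0..1}"
      have "((\<lambda>l. p l \<theta>) has_vector_derivative (complex_of_real r * cis \<theta>)) (at l within {0..1})"
        unfolding p_def by (auto intro!: derivative_eq_intros simp: has_vector_derivative_def scaleR_conv_of_real)
      from has_cderiv_chain[OF der this, OF p[OF l]]
      have "((\<lambda>l. k l \<theta>) has_vector_derivative cmul (cis (- \<theta>)) o\<^sub>L (cmul (complex_of_real r * cis \<theta>) o\<^sub>L f' (p l \<theta>))) (at l within {0..1})"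
        unfolding k_def
        by (rule bounded_linear.has_vector_derivative[OF blinfun_compose.bounded_linear_right])
      also have "cmul (cis (- \<theta>)) o\<^sub>L (cmul (complex_of_real r * cis \<theta>) o\<^sub>L f' (p l \<theta>)) =
          cmul (cis (- \<theta>) * cis \<theta> * complex_of_real r) o\<^sub>L f' (p l \<theta>)"
        by (simp add: blinfun_compose_assoc[symmetric] cmul_mult[symmetric] mult_ac)
      also have "\<dots> = r *\<^sub>R f' (p l \<theta>)"
        by (simp add: cis_mult cmul_of_real blinfun_compose.scaleR_left)
      finally show "((\<lambda>l. k l \<theta>) has_vector_derivative r *\<^sub>R f' (p l \<theta>)) (at l within {0..1})" .
    next
      show "k l integrable_on cbox 0 (2 * pi)" if "l \<in> {0..1}" for l
        using integrable_continuous_real[OF contk[OF that]] by simp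
      show "continuous_on ({0..1} \<times> cbox 0 (2 * pi)) (\<lambda>(l, \<theta>). r *\<^sub>R f' (p l \<theta>))"
        unfolding split_beta
        by (intro continuous_on_scaleR continuous_on_const continuous_on_compose2[OF cont contp2])
          (use p in \<open>auto simp del: mem_cball\<close>)
    qed (use that in auto)
    then show ?thesis by (simp add: K_def[abs_def] m_def)
  qed
  \<comment> \<open>The angular derivative of \<open>k l\<close> is \<i> (l r f' - k l), and
    \<open>k l\<close> takes the same value at 0 and at 2 pi. Hence this derivative integrates to
    zero, and multiplication by -\<i> removes the factor.\<close>
  have parts: "l *\<^sub>R m l = K l" if l: "l \<in> {0..1}" for l
  proof -
    have "((\<lambda>\<theta>. cmul \<i> o\<^sub>L (l *\<^sub>R (r *\<^sub>R f' (p l \<theta>)) - k l \<theta>)) has_integral (k l (2 * pi) - k l 0)) {0..2 * pi}"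
    proof (rule fundamental_theorem_of_calculus)
      fix \<theta> assume "\<theta> \<in> {0..2 * pi}"
      have 1: "((\<lambda>\<theta>. p l \<theta>) has_vector_derivative (complex_of_real (l * r) * (\<i> * cis \<theta>))) (at \<theta> within {0..2 * pi})"
        unfolding p_def
        by (auto intro!: derivative_eq_intros simp: has_vector_derivative_def scaleR_conv_of_real)
      have 2: "((\<lambda>\<theta>. cmul (cis (- \<theta>))) has_vector_derivative cmul (- (\<i> * cis (- \<theta>)))) (at \<theta> within {0..2 * pi})"
        by (rule bounded_linear.has_vector_derivative[OF bounded_linear_cmul])
          (auto intro!: derivative_eq_intros simp: has_vector_derivative_def scaleR_conv_of_real)
      have "((\<lambda>\<theta>. k l \<theta>) has_vector_derivative
        ((cmul (cis (- \<theta>)) o\<^sub>L (cmul (complex_of_real (l * r) * (\<i> * cis \<theta>)) o\<^sub>L f' (p l \<theta>))) +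
         (cmul (- (\<i> * cis (- \<theta>))) o\<^sub>L f (p l \<theta>)))) (at \<theta> within {0..2 * pi})"
        unfolding k_def
        by (rule bounded_bilinear.has_vector_derivative[OF bounded_bilinear_blinfun_compose 2
              has_cderiv_chain[OF der 1, OF p[OF l]]])
      also have "cmul (cis (- \<theta>)) o\<^sub>L (cmul (complex_of_real (l * r) * (\<i> * cis \<theta>)) o\<^sub>L f' (p l \<theta>)) =
          cmul (\<i> * (complex_of_real (l * r) * (cis (- \<theta>) * cis \<theta>))) o\<^sub>L f' (p l \<theta>)"
        by (simp add: blinfun_compose_assoc[symmetric] cmul_mult[symmetric] mult_ac)
      also have "\<dots> = cmul \<i> o\<^sub>L (l *\<^sub>R (r *\<^sub>R f' (p l \<theta>)))"
        by (simp only: cis_mult cmul_mult cmul_of_real blinfun_compose_assoc)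
          (simp add: blinfun_compose.scaleR_left blinfun_compose.scaleR_right flip: of_real_mult)
      also have "cmul (- (\<i> * cis (- \<theta>))) o\<^sub>L f (p l \<theta>) = cmul (- \<i>) o\<^sub>L k l \<theta>"
        unfolding k_def by (simp add: blinfun_compose_assoc[symmetric] cmul_mult[symmetric])
      also have "cmul (- \<i>) o\<^sub>L k l \<theta> = - (cmul \<i> o\<^sub>L k l \<theta>)"
        by (simp add: cmul_minus blinfun_compose.minus_left)
      finally show "(k l has_vector_derivative cmul \<i> o\<^sub>L (l *\<^sub>R (r *\<^sub>R f' (p l \<theta>)) - k l \<theta>)) (at \<theta> within {0..2 * pi})"
        by (simp add: blinfun_compose.diff_right)
    qed simp
    moreover have "cis (2 * pi) = 1" "cis (- (2 * pi)) = 1"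
      by (simp_all add: complex_eq_iff)
    then have "k l (2 * pi) = k l 0"
      unfolding k_def p_def by simp
    ultimately have 1: "((\<lambda>\<theta>. cmul \<i> o\<^sub>L (l *\<^sub>R (r *\<^sub>R f' (p l \<theta>)) - k l \<theta>)) has_integral 0) {0..2 * pi}"
      by simp
    have "((\<lambda>\<theta>. l *\<^sub>R (r *\<^sub>R f' (p l \<theta>)) - k l \<theta>) has_integral (l *\<^sub>R m l - K l)) {0..2 * pi}"
      unfolding m_def K_def
      by (intro has_integral_diff has_integral_cmul integrable_integral integrable_continuous_real
          continuous_on_scaleR continuous_on_const contk contf' l)
    from has_integral_linear[OF this blinfun_compose.bounded_linear_right[of "cmul \<i>"]]
    have "cmul \<i> o\<^sub>L (l *\<^sub>R m l - K l) = 0"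
      using 1 has_integral_unique by (auto simp: o_def)
    then have "cmul (- \<i>) o\<^sub>L (cmul \<i> o\<^sub>L (l *\<^sub>R m l - K l)) = 0"
      by simp
    then show ?thesis
      by (simp add: blinfun_compose_assoc[symmetric] cmul_mult[symmetric])
  qed
  \<comment> \<open>On (0, 1] the quotient K l / l has derivative (l K' l - K l) / l^2 = 0 and is
    therefore constant.\<close>
  have lin: "K l = l *\<^sub>R K 1" if l: "l \<in> {0..1}" for l
  proof (cases "l = 0")
    case True
    then show ?thesis using parts[of 0, symmetric] by simp
  next
    case False
    have "((\<lambda>l. inverse l *\<^sub>R K l) has_vector_derivative 0) (at x within {0<..1})" if x: "x \<in> {0<..1}" for x
    proof -
      have "(K has_vector_derivative m x) (at x within {0<..1})"
        using K'[of x] x by (auto intro: has_vector_derivative_within_subset)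
      moreover have "(inverse has_vector_derivative (- (inverse x * inverse x))) (at x within {0<..1})"
        using x DERIV_inverse'[OF DERIV_ident, of x "{0<..1}"]
        by (auto simp: has_real_derivative_iff_has_vector_derivative)
      ultimately have "((\<lambda>l. inverse l *\<^sub>R K l) has_vector_derivative
          (inverse x *\<^sub>R m x + (- (inverse x * inverse x)) *\<^sub>R K x)) (at x within {0<..1})"
        using bounded_bilinear.has_vector_derivative[OF bounded_bilinear_scaleR] by blast
      moreover have "(inverse x * inverse x) *\<^sub>R K x = inverse x *\<^sub>R m x"
        using parts[of x, symmetric] x by simp
      ultimately show ?thesis by simp
    qed
    then have "\<exists>c. \<forall>x\<in>{0<..1}. inverse x *\<^sub>R K x = c"
      by (intro has_derivative_zero_constant) (auto simp: has_vector_derivative_def)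
    then have "inverse l *\<^sub>R K l = inverse 1 *\<^sub>R K 1"
      using l False by (metis atLeastAtMost_iff greaterThanAtMost_iff le_less zero_less_one order_refl)
    then have "l *\<^sub>R (inverse l *\<^sub>R K l) = l *\<^sub>R K 1"
      by simp
    then show ?thesis using False by simp
  qed
  \<comment> \<open>The slope K 1 of the linear function K is also its derivative at 0, where every
    point \<open>p 0 \<theta>\<close> is z0 and the integral \<open>m 0\<close> is explicit.\<close>
  have "((\<lambda>l. l *\<^sub>R K 1) has_vector_derivative m 0) (at 0 within {0..1})"
  proof (rule has_vector_derivative_transform[of _ _ _ K])
    show "l *\<^sub>R K 1 = K l" if "l \<in> {0..1}" for l
      by (rule lin[OF that, symmetric])
  qed (use K'[of 0] in simp_all)
  moreover have "((\<lambda>l. l *\<^sub>R K 1) has_vector_derivative K 1) (at 0 within {0..1})"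
    by (auto intro!: derivative_eq_intros simp: has_vector_derivative_def)
  ultimately have "m 0 = K 1"
    by (rule vector_derivative_unique_within[rotated]) (simp add: at_within_Icc_at_right)
  moreover have "m 0 = (2 * pi * r) *\<^sub>R f' z0"
    unfolding m_def p_def by simp
  moreover have "norm (K 1) \<le> (2 * M) * (2 * pi - 0)"
    unfolding K_def
  proof (rule integral_bound)
    fix \<theta> assume "\<theta> \<in> {0..2 * pi}"
    have "norm (k 1 \<theta>) \<le> norm (cmul (cis (- \<theta>)) :: ('a \<times> 'a) \<Rightarrow>\<^sub>L ('a \<times> 'a)) * norm (f (p 1 \<theta>))"
      unfolding k_def by (rule norm_blinfun_compose)
    also have "\<dots> \<le> 2 * M"
      using norm_cmul_le[of "cis (- \<theta>)", where 'a = 'a] M[OF p[of 1]]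
      by (intro mult_mono) (auto simp del: cis_neq_zero)
    finally show "norm (k 1 \<theta>) \<le> 2 * M" .
  qed (use contk in auto)
  ultimately have "norm ((2 * pi * r) *\<^sub>R f' z0) \<le> (2 * pi) * (2 * M)"
    by (simp only: mult.commute[of "2 * M"] diff_0_right)
  then have "(2 * pi) * (r * norm (f' z0)) \<le> (2 * pi) * (2 * M)"
    using r by simp
  then have "r * norm (f' z0) \<le> 2 * M"
    by (subst (asm) mult_le_cancel_left_pos) auto
  then show ?thesis
    using r by (simp add: pos_le_divide_eq mult.commute)
qed

section \<open>Analytic semigroups\<close>

text \<open>1 / j^2 is at most 1 / (j - 1) - 1 / j for j > 1, which telescopes; the induction
  carries the correction term that this leaves.\<close>

lemma sum_inverse_squares_le: "(\<Sum>j=1..<k. 1 / real j ^ 2) \<le> 2"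
proof -
  have *: "(\<Sum>j=1..<Suc (Suc n). 1 / real j ^ 2) \<le> 2 - 1 / real (Suc n)" for n
  proof (induction n)
    case (Suc n)
    have "1 / real (Suc (Suc n)) ^ 2 \<le> 1 / (real (Suc n) * real (Suc (Suc n)))"
      unfolding power2_eq_square by (intro divide_left_mono mult_right_mono) auto
    also have "\<dots> = 1 / real (Suc n) - 1 / real (Suc (Suc n))"
      by (simp add: field_simps)
    finally show ?case using Suc by simp
  qed simp
  show ?thesis
  proof (cases "k \<le> 1")
    case False
    then obtain n where "k = Suc (Suc n)" by (metis One_nat_def not_less_eq_eq old.nat.exhaust zero_le)
    moreover have "2 - 1 / real (Suc n) \<le> 2" by simp
    ultimately show ?thesis using order_trans[OF *] by blast
  qed auto
qed

text \<open>A sector is invariant under positive scaling, so a ball around 1 suffices, and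
  continuity of \<open>Arg\<close> provides one. Halving its radius makes closed balls admissible,
  and a radius below 1 keeps the origin out.\<close>

lemma sector_contains_balls:
  assumes "\<delta> > 0"
  obtains \<kappa> where "0 < \<kappa>" "\<kappa> < 1" "\<And>t. t > 0 \<Longrightarrow> cball (complex_of_real t) (\<kappa> * t) \<subseteq> sector \<delta>"
proof -
  have "isCont Arg 1" by (rule continuous_at_Arg) simp
  then have "\<forall>\<^sub>F z in at 1. dist (Arg z) (Arg 1) < \<delta>"
    using assms tendstoD unfolding isCont_def by blast
  then obtain e where e: "e > 0" "\<And>z. z \<noteq> 1 \<Longrightarrow> dist z 1 < e \<Longrightarrow> \<bar>Arg z\<bar> < \<delta>"
    by (auto simp: eventually_at dist_real_def)
  define \<kappa> where "\<kappa> = min (e / 2) (1 / 2)"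
  have "cball (complex_of_real t) (\<kappa> * t) \<subseteq> sector \<delta>" if t: "t > 0" for t
  proof
    fix z assume "z \<in> cball (complex_of_real t) (\<kappa> * t)"
    then have z: "cmod (z - complex_of_real t) \<le> \<kappa> * t" by (simp add: dist_norm norm_minus_commute)
    have "\<kappa> < 1" "\<kappa> < e" using e by (auto simp: \<kappa>_def)
    have "z \<noteq> 0"
    proof
      assume "z = 0"
      then have "t \<le> \<kappa> * t" using z t by simp
      then show False using \<open>\<kappa> < 1\<close> t by simp
    qed
    have "z / complex_of_real t - 1 = (z - complex_of_real t) / complex_of_real t"
      using t by (simp add: field_simps)
    then have "dist (z / complex_of_real t) 1 = cmod (z - complex_of_real t) / t"
      using t by (simp add: dist_norm norm_divide)
    also have "\<dots> \<le> \<kappa>" using z t by (simp add: field_simps)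
    finally have "dist (z / complex_of_real t) 1 < e" using \<open>\<kappa> < e\<close> by simp
    then have "\<bar>Arg (z / complex_of_real t)\<bar> < \<delta>"
      using e(2) assms by (cases "z / complex_of_real t = 1") auto
    then show "z \<in> sector \<delta>" using \<open>z \<noteq> 0\<close> t by (simp add: sector_def)
  qed
  moreover have "0 < \<kappa>" "\<kappa> < 1" using e by (auto simp: \<kappa>_def)
  ultimately show ?thesis using that by blast
qed

lemma vector_derivative_shift:
  assumes "(f has_vector_derivative d) (at (s + t :: real))"
  shows "((\<lambda>x. f (x + t)) has_vector_derivative d) (at s)"
proof -
  have "((\<lambda>x. x + t) has_vector_derivative 1) (at s)"
    by (auto intro!: derivative_eq_intros simp: has_vector_derivative_def)
  from vector_diff_chain_at[OF this assms] show ?thesis by (simp add: o_def)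
qed

lemma vector_derivative_bound:
  fixes f :: "real \<Rightarrow> 'a::real_normed_vector"
  assumes "convex S" "\<And>x. x \<in> S \<Longrightarrow> (f has_vector_derivative f' x) (at x within S)"
    and "\<And>x. x \<in> S \<Longrightarrow> norm (f' x) \<le> B" and "x \<in> S" "y \<in> S"
  shows "norm (f x - f y) \<le> B * norm (x - y)"
  by (rule differentiable_bound[OF assms(1) assms(2)[unfolded has_vector_derivative_def] _ assms(4,5)])
    (use assms(3) in \<open>auto intro!: onorm_le simp: mult.commute[of B] mult_left_mono\<close>)

lemma analytic_semigroup_imp_C0: "analytic_semigroup T \<Longrightarrow> C0_semigroup T"
  unfolding analytic_semigroup_def by (rule conjunct1)

locale analytic_c0_semigroup =
  fixes T :: "real \<Rightarrow> 'a::banach \<Rightarrow>\<^sub>L 'a"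
  assumes analytic: "analytic_semigroup T"

sublocale analytic_c0_semigroup \<subseteq> c0_semigroup T
  by unfold_locales (rule analytic_semigroup_imp_C0[OF analytic])

context analytic_c0_semigroup
begin

text \<open>The holomorphic extension is bounded on a ball around t whose radius is proportional to
  t, so Cauchy's estimate bounds its derivative by a multiple of 1 / t.\<close>

lemma T_derivative_near_0:
  obtains D r C where "r > 0" "C \<ge> 0"
    "\<And>t. t > 0 \<Longrightarrow> (T has_vector_derivative D t) (at t)"
    "\<And>t. 0 < t \<Longrightarrow> t < r \<Longrightarrow> norm (D t) \<le> C / t"
proof -
  obtain \<delta> and S :: "complex \<Rightarrow> ('a \<times> 'a) \<Rightarrow>\<^sub>L ('a \<times> 'a)" where \<delta>: "\<delta> > 0"
    and S_deriv: "\<forall>z\<in>sector \<delta>. \<exists>S'. ((\<lambda>w. cmul (inverse (w - z)) o\<^sub>L (S w - S z)) \<longlongrightarrow> S') (at z)"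
    and ST: "\<And>t x y. t > 0 \<Longrightarrow> S (complex_of_real t) (x, y) = (T t x, T t y)"
    and S_add: "\<And>z w. z \<in> sector \<delta> \<Longrightarrow> w \<in> sector \<delta> \<Longrightarrow> S (z + w) = S z o\<^sub>L S w"
    and S_0: "\<And>p. ((\<lambda>z. blinfun_apply (S z) p) \<longlongrightarrow> p) (at 0 within sector \<delta>)"
    using analytic unfolding analytic_semigroup_def
    by (elim conjE exE) (rule that, assumption, assumption, blast+)
  have "\<forall>z\<in>sector \<delta>. \<exists>F. has_cderiv S F z"
    using S_deriv by (blast intro: has_cderivI)
  from bchoice[OF this] obtain S' where S': "\<And>z. z \<in> sector \<delta> \<Longrightarrow> has_cderiv S (S' z) z"
    by blast
  obtain \<kappa> where \<kappa>: "0 < \<kappa>" "\<kappa> < 1" "\<And>t. t > 0 \<Longrightarrow> cball (complex_of_real t) (\<kappa> * t) \<subseteq> sector \<delta>"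
    using sector_contains_balls[OF \<delta>] by blast
  \<comment> \<open>Differentiating the semigroup law in its first argument expresses S' through
    values of S. This supplies the continuity of S' that the Cauchy estimate asks for.\<close>
  have S'_add: "S' (complex_of_real a + w) = S' (complex_of_real a) o\<^sub>L S w" if a: "a > 0" and w: "w \<in> sector \<delta>"
    and aw: "complex_of_real a + w \<in> sector \<delta>" for a w
  proof -
    let ?a = "complex_of_real a"
    have "(S has_derivative (\<lambda>d. cmul d o\<^sub>L S' (?a + w))) (at (?a + w))"
      using S'[OF aw] by (simp add: has_cderiv_def)
    then have 1: "((\<lambda>z. S (z + w)) has_derivative (\<lambda>d. cmul d o\<^sub>L S' (?a + w))) (at ?a)"
      by (rule has_derivative_compose[rotated]) (auto intro!: derivative_eq_intros)
    have "?a \<in> sector \<delta>" using \<kappa>(3)[OF a] \<kappa>(1) a by (auto simp: subset_iff)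
    from bounded_linear.has_derivative[OF blinfun_compose.bounded_linear_left S'[OF this, unfolded has_cderiv_def]]
    have 2: "((\<lambda>z. S z o\<^sub>L S w) has_derivative (\<lambda>d. cmul d o\<^sub>L (S' ?a o\<^sub>L S w))) (at ?a)"
      by (simp add: blinfun_compose_assoc)
    have "((\<lambda>z. S (z + w)) has_derivative (\<lambda>d. cmul d o\<^sub>L (S' ?a o\<^sub>L S w))) (at ?a)"
    proof (rule has_derivative_transform_within_open[OF 2, of "ball ?a (\<kappa> * a)"])
      show "S z o\<^sub>L S w = S (z + w)" if "z \<in> ball ?a (\<kappa> * a)" for z
        using S_add[of z w] w \<kappa>(3)[OF a] that by (auto simp: subset_iff)
    qed (use \<kappa> a in auto)
    with 1 show ?thesis
      using has_cderiv_unique[of "\<lambda>z. S (z + w)"] unfolding has_cderiv_def by blast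
  qed
  obtain r0 M where r0: "r0 > 0" and M: "\<And>z. z \<in> sector \<delta> \<Longrightarrow> z \<noteq> 0 \<Longrightarrow> dist z 0 < r0 \<Longrightarrow> norm (S z) \<le> M"
    using locally_bounded_of_strong_limit[OF S_0] by blast
  \<comment> \<open>Half of the admissible radius is used: translated by -t/2, the ball of radius
    \<kappa> t/2 around t becomes the one of radius \<kappa> (t/2) around t/2, which lies in the
    sector as well. The restriction t < r0/2 keeps the ball where M is a bound.\<close>
  have est: "norm (S' (complex_of_real t)) \<le> 2 * M / (\<kappa> * t / 2)" if t: "0 < t" "t < r0 / 2" for t
  proof (rule cauchy_estimate)
    let ?t = "complex_of_real t"
    have sub: "cball ?t (\<kappa> * t / 2) \<subseteq> cball ?t (\<kappa> * t)"
      using t \<kappa> by (intro subset_cball) simp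
    then have sec: "z \<in> sector \<delta>" if "z \<in> cball ?t (\<kappa> * t / 2)" for z
      using \<kappa>(3)[OF t(1)] that by blast
    show "0 < \<kappa> * t / 2" using t \<kappa> by simp
    show "has_cderiv S (S' z) z" if "z \<in> cball ?t (\<kappa> * t / 2)" for z
      using S'[OF sec[OF that]] .
    show "norm (S z) \<le> M" if z: "z \<in> cball ?t (\<kappa> * t / 2)" for z
    proof (rule M[OF sec[OF z]])
      show "z \<noteq> 0" using sec[OF z] by (simp add: sector_def)
      have "cmod z \<le> cmod (z - ?t) + t"
        using norm_triangle_ineq[of "z - ?t" ?t] t by simp
      also have "cmod (z - ?t) \<le> \<kappa> * t / 2" using z by (simp add: dist_norm norm_minus_commute)
      also have "\<kappa> * t / 2 + t < r0" using mult_strict_right_mono[OF \<kappa>(2) t(1)] t by linarith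
      finally show "dist z 0 < r0" by simp
    qed
    let ?a = "complex_of_real (t / 2)"
    have shift: "z - ?a \<in> sector \<delta>" if "z \<in> cball ?t (\<kappa> * t / 2)" for z
    proof -
      have "dist ?a (z - ?a) = dist ?t z"
        by (simp add: dist_norm)
      then have "z - ?a \<in> cball ?a (\<kappa> * (t / 2))"
        using that by simp
      then show ?thesis
        by (rule subsetD[OF \<kappa>(3), rotated]) (use t in simp)
    qed
    have "continuous_on (cball ?t (\<kappa> * t / 2)) (\<lambda>z. S' ?a o\<^sub>L S (z - ?a))"
    proof (rule bounded_linear.continuous_on[OF blinfun_compose.bounded_linear_right])
      have "continuous_on (sector \<delta>) S"
        using has_cderiv_continuous[OF S'] continuous_at_imp_continuous_on by blast
      then show "continuous_on (cball ?t (\<kappa> * t / 2)) (\<lambda>z. S (z - ?a))"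
        by (rule continuous_on_compose2) (use shift in \<open>auto intro!: continuous_intros\<close>)
    qed
    then show "continuous_on (cball ?t (\<kappa> * t / 2)) S'"
    proof (rule continuous_on_eq)
      fix z assume z: "z \<in> cball ?t (\<kappa> * t / 2)"
      show "S' ?a o\<^sub>L S (z - ?a) = S' z"
        using S'_add[of "t / 2" "z - ?a"] shift[OF z] sec[OF z] t by simp
    qed
  qed
  \<comment> \<open>Projection to the real part and embedding as a real part compress operators on
    the complexification to the original space. On positive reals they turn S into T.\<close>
  define P where "P = Blinfun (fst :: 'a \<times> 'a \<Rightarrow> 'a)"
  define I where "I = Blinfun (\<lambda>x :: 'a. (x, 0 :: 'a))"
  have P: "P p = fst p" for p
    unfolding P_def by (simp add: bounded_linear_Blinfun_apply bounded_linear_fst)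
  have I: "I x = (x, 0)" for x
    unfolding I_def
    by (subst bounded_linear_Blinfun_apply) (auto intro!: bounded_linear_Pair bounded_linear_ident bounded_linear_zero)
  define D where "D t = P o\<^sub>L (S' (complex_of_real t) o\<^sub>L I)" for t
  define C where "C = norm P * (4 * \<bar>M\<bar> / \<kappa>) * norm I"
  have "(T has_vector_derivative D t) (at t)" if t: "t > 0" for t
  proof -
    have "complex_of_real t \<in> sector \<delta>" using \<kappa>(3)[OF t] \<kappa>(1) t by (auto simp: subset_iff)
    moreover have "(complex_of_real has_vector_derivative 1) (at t)"
      by (auto intro!: derivative_eq_intros simp: has_vector_derivative_def scaleR_conv_of_real)
    ultimately have "((\<lambda>t. S (complex_of_real t)) has_vector_derivative S' (complex_of_real t)) (at t)"
      using has_cderiv_chain[OF S'] by fastforce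
    then have "((\<lambda>t. P o\<^sub>L (S (complex_of_real t) o\<^sub>L I)) has_vector_derivative D t) (at t)"
      unfolding D_def
      by (intro bounded_linear.has_vector_derivative[OF blinfun_compose.bounded_linear_right]
          bounded_linear.has_vector_derivative[OF blinfun_compose.bounded_linear_left])
    then show ?thesis
      by (rule has_vector_derivative_transform_within_open[of _ _ _ "{0<..}"])
        (use t in \<open>auto intro!: blinfun_eqI simp: P I ST\<close>)
  qed
  moreover have "norm (D t) \<le> C / t" if t: "0 < t" "t < r0 / 2" for t
  proof -
    have "norm (S' (complex_of_real t)) \<le> 4 * \<bar>M\<bar> / \<kappa> / t"
      by (rule order_trans[OF est[OF t]]) (use t \<kappa> in \<open>simp add: field_simps\<close>)
    then have "norm P * (norm (S' (complex_of_real t)) * norm I) \<le> norm P * (4 * \<bar>M\<bar> / \<kappa> / t * norm I)"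
      by (intro mult_left_mono mult_right_mono) auto
    moreover have "norm (D t) \<le> norm P * (norm (S' (complex_of_real t)) * norm I)"
      unfolding D_def
      by (intro order_trans[OF norm_blinfun_compose] mult_left_mono norm_blinfun_compose) auto
    ultimately show ?thesis by (simp add: C_def field_simps)
  qed
  moreover have "C \<ge> 0" using \<kappa> by (simp add: C_def)
  ultimately show ?thesis using that[of "r0 / 2" C D] r0 by simp
qed

text \<open>The law D (s + t) = D s T t gives D x = D (t/2) T (x - t/2) near x = t, and the
  derivative of the right-hand side at t is D (t/2) D (t/2). The bound C / t on D thus yields one of
  order t^-2 on the second derivative. The same law carries the bound from a neighbourhood of 0 to
  (0, R].\<close>

lemma T_second_derivative:
  obtains D where
    "\<And>t. t > 0 \<Longrightarrow> (T has_vector_derivative D t) (at t)"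
    "\<And>t. t > 0 \<Longrightarrow> (D has_vector_derivative (D (t / 2) o\<^sub>L D (t / 2))) (at t)"
    "\<And>R. \<exists>C\<ge>0. \<forall>t. 0 < t \<longrightarrow> t \<le> R \<longrightarrow> norm (D t) \<le> C / t"
proof -
  obtain D r C where r: "r > 0" and "C \<ge> 0" and D: "\<And>t. t > 0 \<Longrightarrow> (T has_vector_derivative D t) (at t)"
    and C: "\<And>t. 0 < t \<Longrightarrow> t < r \<Longrightarrow> norm (D t) \<le> C / t"
    using T_derivative_near_0 by metis
  have add: "D (s + t) = D s o\<^sub>L T t" if "s > 0" "t \<ge> 0" for s t
  proof -
    have "((\<lambda>x. T (x + t)) has_vector_derivative D (s + t)) (at s)"
      using vector_derivative_shift[OF D[of "s + t"]] that by simp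
    moreover have "((\<lambda>x. T x o\<^sub>L T t) has_vector_derivative D s o\<^sub>L T t) (at s)"
      by (rule bounded_linear.has_vector_derivative[OF blinfun_compose.bounded_linear_left D[OF that(1)]])
    then have "((\<lambda>x. T (x + t)) has_vector_derivative D s o\<^sub>L T t) (at s)"
      by (rule has_vector_derivative_transform_within_open[of _ _ _ "{0<..}"]) (use that T_add in auto)
    ultimately show ?thesis by (rule vector_derivative_unique_at)
  qed
  have "(D has_vector_derivative (D (t / 2) o\<^sub>L D (t / 2))) (at t)" if "t > 0" for t
  proof -
    have "((\<lambda>x. T (x - t / 2)) has_vector_derivative D (t / 2)) (at t)"
      using vector_derivative_shift[of T _ t "- (t / 2)"] D[of "t / 2"] that by simp
    from bounded_linear.has_vector_derivative[OF blinfun_compose.bounded_linear_right this]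
    have "((\<lambda>x. D (t / 2) o\<^sub>L T (x - t / 2)) has_vector_derivative (D (t / 2) o\<^sub>L D (t / 2))) (at t)" .
    then show ?thesis
    proof (rule has_vector_derivative_transform_within_open[of _ _ _ "{t / 2<..}"])
      show "D (t / 2) o\<^sub>L T (x - t / 2) = D x" if "x \<in> {t / 2<..}" for x
        using that add[of "t / 2" "x - t / 2"] \<open>t > 0\<close> by simp
    qed (use that in auto)
  qed
  moreover have "\<exists>C\<ge>0. \<forall>t. 0 < t \<longrightarrow> t \<le> R \<longrightarrow> norm (D t) \<le> C / t" for R
  proof -
    obtain M where M: "M \<ge> 1" "\<And>t. 0 \<le> t \<Longrightarrow> t \<le> R \<Longrightarrow> norm (T t) \<le> M"
      using T_bounded by blast
    \<comment> \<open>Away from 0 the derivative is merely bounded; as t \<le> R, the factor |R|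
      turns that constant into a multiple of 1 / t.\<close>
    define C' where "C' = C + norm (D (r / 2)) * M * \<bar>R\<bar>"
    have "norm (D t) \<le> C' / t" if "0 < t" "t \<le> R" for t
    proof (cases "t < r")
      case True
      have "C / t \<le> C' / t"
        using that M by (intro divide_right_mono) (auto simp: C'_def)
      then show ?thesis using C[OF that(1) True] by simp
    next
      case False
      have "norm (D t) \<le> norm (D (r / 2)) * norm (T (t - r / 2))"
        using add[of "r / 2" "t - r / 2"] False r norm_blinfun_compose[of "D (r / 2)" "T (t - r / 2)"] by simp
      also have "\<dots> \<le> norm (D (r / 2)) * M"
        using False r that by (intro mult_left_mono M) auto
      also have "\<dots> = norm (D (r / 2)) * M * t / t"
        using that by simp
      also have "\<dots> \<le> C' / t"
        unfolding C'_def
        using that M \<open>C \<ge> 0\<close> by (intro divide_right_mono add_increasing mult_left_mono) auto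
      finally show ?thesis .
    qed
    moreover have "C' \<ge> 0" using M \<open>C \<ge> 0\<close> by (simp add: C'_def)
    ultimately show ?thesis by blast
  qed
  ultimately show ?thesis using that D by blast
qed

text \<open>Analyticity enters the convergence proof only here. The linear interpolants of \<open>T\<close> on the
  intervals of the grid telescope, and the interpolation errors are \<open>O(j\<^sup>-\<^sup>2)\<close> because \<open>T'' t\<close> is \<open>O(t\<^sup>-\<^sup>2)\<close>.\<close>

lemma shifted_sums_bounded:
  obtains C where "C \<ge> 0" "\<And>h k \<theta>. 0 < h \<Longrightarrow> real k * h \<le> R \<Longrightarrow> 0 \<le> \<theta> \<Longrightarrow> \<theta> \<le> 1 \<Longrightarrow>
    norm (\<Sum>j<k. T ((real j + \<theta>) * h) - T (real j * h)) \<le> C"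
proof -
  obtain D where D: "\<And>t. t > 0 \<Longrightarrow> (T has_vector_derivative D t) (at t)"
    and D2: "\<And>t. t > 0 \<Longrightarrow> (D has_vector_derivative (D (t / 2) o\<^sub>L D (t / 2))) (at t)"
    and "\<And>R. \<exists>C\<ge>0. \<forall>t. 0 < t \<longrightarrow> t \<le> R \<longrightarrow> norm (D t) \<le> C / t"
    using T_second_derivative by blast
  then obtain C where "C \<ge> 0" and C: "\<And>t. 0 < t \<Longrightarrow> t \<le> R \<Longrightarrow> norm (D t) \<le> C / t"
    by meson
  obtain M where M: "M \<ge> 1" "\<And>t. 0 \<le> t \<Longrightarrow> t \<le> R \<Longrightarrow> norm (T t) \<le> M"
    using T_bounded by blast
  have D_lip: "norm (D x - D t) \<le> (2 * C / t) ^ 2 * h" if "0 < t" "t \<le> x" "x \<le> t + h" "t + h \<le> R" for x t h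
  proof -
    have "norm (D x - D t) \<le> (2 * C / t) ^ 2 * norm (x - t)"
    proof (rule vector_derivative_bound[OF convex_real_interval(5)])
      fix y assume y: "y \<in> {t..t + h}"
      show "(D has_vector_derivative (D (y / 2) o\<^sub>L D (y / 2))) (at y within {t..t + h})"
        using D2[of y] y that has_vector_derivative_at_within by fastforce
      have "norm (D (y / 2)) \<le> C / (y / 2)" using y that by (intro C) auto
      also have "\<dots> \<le> 2 * C / t" using y that \<open>C \<ge> 0\<close> by (simp add: field_simps mult_left_mono)
      finally have "norm (D (y / 2)) \<le> 2 * C / t" .
      then have "norm (D (y / 2)) * norm (D (y / 2)) \<le> (2 * C / t) ^ 2"
        unfolding power2_eq_square using that \<open>C \<ge> 0\<close> by (intro mult_mono) auto
      then show "norm (D (y / 2) o\<^sub>L D (y / 2)) \<le> (2 * C / t) ^ 2"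
        using norm_blinfun_compose order_trans by blast
    qed (use that in auto)
    also have "\<dots> \<le> (2 * C / t) ^ 2 * h"
      using that by (intro mult_left_mono) auto
    finally show ?thesis .
  qed
  define \<Delta> where "\<Delta> t h \<theta> = T (t + \<theta> * h) - T t - \<theta> *\<^sub>R (T (t + h) - T t)" for t h \<theta>
  have \<Delta>: "norm (\<Delta> t h \<theta>) \<le> 2 * (h * ((2 * C / t) ^ 2 * h))"
    if t: "0 < t" "0 < h" "t + h \<le> R" and \<theta>: "0 \<le> \<theta>" "\<theta> \<le> 1" for t h \<theta>
  proof -
    have lin: "norm (T (t + \<theta> * h) - T t - (\<theta> * h) *\<^sub>R D t) \<le> h * ((2 * C / t) ^ 2 * h)"
      if \<theta>: "0 \<le> \<theta>" "\<theta> \<le> 1" for \<theta>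
    proof -
      have le: "\<theta> * h \<le> h" using \<theta> t by (simp add: mult_le_cancel_right1)
      have "norm (T (t + \<theta> * h) - T t - (t + \<theta> * h - t) *\<^sub>R D t) \<le> norm (t + \<theta> * h - t) * ((2 * C / t) ^ 2 * h)"
      proof (rule vector_differentiable_bound_linearization[where S = "{t..t + h}"])
        show "(T has_vector_derivative D x) (at x within {t..t + h})" if "x \<in> {t..t + h}" for x
          using D[of x] that t has_vector_derivative_at_within by fastforce
        show "closed_segment t (t + \<theta> * h) \<subseteq> {t..t + h}"
          using le t \<theta> by (auto simp: closed_segment_eq_real_ivl)
        show "norm (D x - D t) \<le> (2 * C / t)\<^sup>2 * h" if "x \<in> {t..t + h}" for x
          using D_lip[of t x h] that t by auto
      qed (use t in auto)
      also have "\<dots> \<le> h * ((2 * C / t) ^ 2 * h)"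
        using le t \<theta> by (intro mult_right_mono) auto
      finally show ?thesis by simp
    qed
    \<comment> \<open>Linearising at t, both at the inner point and at the end point t + h, makes
      the first order terms \<theta> h D t cancel.\<close>
    have "\<Delta> t h \<theta> = (T (t + \<theta> * h) - T t - (\<theta> * h) *\<^sub>R D t) - \<theta> *\<^sub>R (T (t + 1 * h) - T t - (1 * h) *\<^sub>R D t)"
      by (simp add: \<Delta>_def algebra_simps)
    then have "norm (\<Delta> t h \<theta>) \<le> norm (T (t + \<theta> * h) - T t - (\<theta> * h) *\<^sub>R D t)
        + \<theta> * norm (T (t + 1 * h) - T t - (1 * h) *\<^sub>R D t)"
      using norm_triangle_ineq4 \<theta> by (metis abs_of_nonneg norm_scaleR)
    also have "\<dots> \<le> h * ((2 * C / t) ^ 2 * h) + 1 * (h * ((2 * C / t) ^ 2 * h))"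
      using lin[OF \<theta>] lin[of 1] \<theta> by (intro add_mono mult_mono) auto
    finally show ?thesis by (simp only: mult_1 mult_2)
  qed
  \<comment> \<open>4 M covers the first interval, where D is singular and only boundedness of T is
    available; 2 M covers the telescoped chords; the rest is 2 (2 C)^2 times the sum of 1 / j^2,
    which is at most 2.\<close>
  define B where "B = 6 * M + 8 * C ^ 2 * 2"
  have "norm (\<Sum>j<k. T ((real j + \<theta>) * h) - T (real j * h)) \<le> B"
    if h: "0 < h" "real k * h \<le> R" and \<theta>: "0 \<le> \<theta>" "\<theta> \<le> 1" for h k \<theta>
  proof (cases "k = 0")
    case True
    then show ?thesis using M by (simp add: B_def)
  next
    case False
    have hR: "h \<le> R" using h False by (metis One_nat_def Suc_leI mult_right_mono mult_1 neq0_conv of_nat_1 of_nat_mono order_trans less_imp_le)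
    have "(\<Sum>j<k. T (real (Suc j) * h) - T (real j * h)) = T (real k * h) - T 0"
      using sum_lessThan_telescope[of "\<lambda>j. T (real j * h)" k] by simp
    moreover have "(\<Sum>j<k. T ((real j + \<theta>) * h) - T (real j * h)) =
        (\<Sum>j<k. \<Delta> (real j * h) h \<theta>) + \<theta> *\<^sub>R (\<Sum>j<k. T (real (Suc j) * h) - T (real j * h))"
      by (simp add: scaleR_sum_right sum.distrib[symmetric] \<Delta>_def algebra_simps)
    moreover have "{..<k} = insert 0 {1..<k}" using False by auto
    ultimately have eq: "(\<Sum>j<k. T ((real j + \<theta>) * h) - T (real j * h)) =
        \<Delta> 0 h \<theta> + (\<Sum>j=1..<k. \<Delta> (real j * h) h \<theta>) + \<theta> *\<^sub>R (T (real k * h) - T 0)"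
      by simp
    have thh: "\<theta> * h \<le> h" using \<theta> h by (simp add: mult_le_cancel_right1)
    have n2: "norm (\<theta> *\<^sub>R (T a - T b)) \<le> 2 * M" if "0 \<le> a" "a \<le> R" "0 \<le> b" "b \<le> R" for a b
    proof -
      have "norm (\<theta> *\<^sub>R (T a - T b)) \<le> 1 * norm (T a - T b)"
        using \<theta> by (simp add: mult_left_le_one_le)
      also have "\<dots> \<le> 2 * M"
        using norm_triangle_ineq4[of "T a" "T b"] M(2)[of a] M(2)[of b] that by simp
      finally show ?thesis .
    qed
    have "norm (\<Delta> 0 h \<theta>) \<le> norm (T (\<theta> * h)) + norm (T 0) + norm (\<theta> *\<^sub>R (T h - T 0))"
      unfolding \<Delta>_def by (simp add: order_trans[OF norm_triangle_ineq4 add_mono[OF norm_triangle_ineq4]])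
    also have "\<dots> \<le> M + M + 2 * M"
      using M(2)[of "\<theta> * h"] M(2)[of 0] n2[of h 0] \<theta> h hR thh by (intro add_mono) auto
    finally have e1: "norm (\<Delta> 0 h \<theta>) \<le> 4 * M" by simp
    have "norm (\<Sum>j=1..<k. \<Delta> (real j * h) h \<theta>) \<le> (\<Sum>j=1..<k. 8 * C ^ 2 * (1 / real j ^ 2))"
    proof (rule sum_norm_le)
      fix j assume j: "j \<in> {1..<k}"
      have "real j * h + h = real (Suc j) * h" by (simp add: algebra_simps)
      also have "\<dots> \<le> real k * h" using j h by (intro mult_right_mono) auto
      finally have "norm (\<Delta> (real j * h) h \<theta>) \<le> 2 * (h * ((2 * C / (real j * h)) ^ 2 * h))"
        using j h \<theta> by (intro \<Delta>) auto
      also have "\<dots> = 8 * C ^ 2 * (1 / real j ^ 2)"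
        using j h by (simp add: field_simps power2_eq_square)
      finally show "norm (\<Delta> (real j * h) h \<theta>) \<le> 8 * C ^ 2 * (1 / real j ^ 2)" .
    qed
    also have "\<dots> \<le> 8 * C ^ 2 * 2"
      unfolding sum_distrib_left[symmetric] by (intro mult_left_mono sum_inverse_squares_le) simp
    finally have e2: "norm (\<Sum>j=1..<k. \<Delta> (real j * h) h \<theta>) \<le> 8 * C ^ 2 * 2" .
    have e3: "norm (\<theta> *\<^sub>R (T (real k * h) - T 0)) \<le> 2 * M"
      using h hR by (intro n2) auto
    show ?thesis
      unfolding eq B_def
      using norm_triangle_ineq[of "\<Delta> 0 h \<theta> + (\<Sum>j=1..<k. \<Delta> (real j * h) h \<theta>)" "\<theta> *\<^sub>R (T (real k * h) - T 0)"]
        norm_triangle_ineq[of "\<Delta> 0 h \<theta>" "\<Sum>j=1..<k. \<Delta> (real j * h) h \<theta>"] e1 e2 e3 by linarith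
  qed
  moreover have "B \<ge> 0" using M by (simp add: B_def)
  ultimately show ?thesis using that by blast
qed

end

section \<open>The operators \<open>\<phi>\<^sub>k(sA)\<close> and the generator\<close>

lemma has_vector_derivative_right_limit:
  assumes "(f has_vector_derivative d) (at (0::real) within {0..})"
  shows "((\<lambda>t. (f t - f 0) /\<^sub>R t) \<longlongrightarrow> d) (at_right 0)"
proof -
  have "((\<lambda>y. (1 / norm (y - 0)) *\<^sub>R (f y - (f 0 + (y - 0) *\<^sub>R d))) \<longlongrightarrow> 0) (at 0 within {0..})"
    using assms unfolding has_vector_derivative_def has_derivative_within by blast
  then have "((\<lambda>y. (1 / norm (y - 0)) *\<^sub>R (f y - (f 0 + (y - 0) *\<^sub>R d))) \<longlongrightarrow> 0) (at_right 0)"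
    by (rule tendsto_within_subset) auto
  then have "((\<lambda>t. (f t - f 0) /\<^sub>R t - d) \<longlongrightarrow> 0) (at_right 0)"
  proof (rule Lim_transform_eventually)
    show "\<forall>\<^sub>F t in at_right 0. (1 / norm (t - 0)) *\<^sub>R (f t - (f 0 + (t - 0) *\<^sub>R d)) = (f t - f 0) /\<^sub>R t - d"
      unfolding eventually_at_right_field
      by (intro exI[of _ 1]) (auto simp: algebra_simps divide_inverse)
  qed
  then show ?thesis by (simp add: LIM_zero_iff)
qed

text \<open>This is the recurrence phi_k(w) = 1/k! + w phi_{k+1}(w), with the action of w replaced
  by the derivative of a curve. It yields the moments of the weights, the recurrence for
  \<open>P\<close>, and the generator applied to \<open>P\<close>.\<close>

lemma weighted_integral_by_parts:
  fixes y :: "real \<Rightarrow> 'a::banach"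
  assumes s: "s \<ge> 0" and k: "k \<ge> 1"
    and y: "\<And>r. r \<ge> 0 \<Longrightarrow> (y has_vector_derivative z r) (at r within {0..})"
    and z: "continuous_on {0..} z"
  shows "integral {0..1} (\<lambda>\<theta>. (\<theta> ^ (k - 1) / fact (k - 1)) *\<^sub>R y ((1 - \<theta>) * s)) =
    (1 / fact k) *\<^sub>R y 0 + s *\<^sub>R integral {0..1} (\<lambda>\<theta>. (\<theta> ^ k / fact k) *\<^sub>R z ((1 - \<theta>) * s))"
proof -
  let ?y = "\<lambda>\<theta>. (\<theta> ^ (k - 1) / fact (k - 1)) *\<^sub>R y ((1 - \<theta>) * s)"
  let ?z = "\<lambda>\<theta>. (\<theta> ^ k / fact k) *\<^sub>R z ((1 - \<theta>) * s)"
  have ycont: "continuous_on {0..} y"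
    using y by (auto simp: continuous_on_eq_continuous_within intro: has_vector_derivative_continuous)
  have iz: "?z integrable_on {0..1}"
    by (intro integrable_continuous_real continuous_intros continuous_on_compose2[OF z]) (use s in auto)
  have iy: "?y integrable_on {0..1}"
    by (intro integrable_continuous_real continuous_intros continuous_on_compose2[OF ycont]) (use s in auto)
  have "((\<lambda>\<theta>. ?y \<theta> - s *\<^sub>R ?z \<theta>) has_integral
    ((1 ^ k / fact k) *\<^sub>R y ((1 - 1) * s) - (0 ^ k / fact k) *\<^sub>R y ((1 - 0) * s))) {0..1}"
  proof (rule fundamental_theorem_of_calculus)
    fix \<theta> :: real assume \<theta>: "\<theta> \<in> {0..1}"
    have 1: "((\<lambda>\<theta>. (1 - \<theta>) * s) has_vector_derivative - s) (at \<theta> within {0..1})"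
      by (auto intro!: derivative_eq_intros simp: has_vector_derivative_def)
    have "(y has_vector_derivative z ((1 - \<theta>) * s)) (at ((1 - \<theta>) * s) within (\<lambda>\<theta>. (1 - \<theta>) * s) ` {0..1})"
      by (rule has_vector_derivative_within_subset[OF y]) (use \<theta> s in auto)
    from vector_diff_chain_within[OF 1 this]
    have 2: "((\<lambda>\<theta>. y ((1 - \<theta>) * s)) has_vector_derivative (- s) *\<^sub>R z ((1 - \<theta>) * s)) (at \<theta> within {0..1})"
      by (simp add: o_def)
    have "((\<lambda>\<theta>. \<theta> ^ k / fact k) has_real_derivative (real k * \<theta> ^ (k - Suc 0)) / fact k) (at \<theta> within {0..1})"
      by (rule DERIV_cdivide[OF DERIV_pow[THEN has_field_derivative_at_within]])
    moreover have "(real k * \<theta> ^ (k - Suc 0)) / fact k = \<theta> ^ (k - 1) / fact (k - 1)"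
      using k by (cases k) (simp_all del: of_nat_Suc)
    ultimately have 3: "((\<lambda>\<theta>. \<theta> ^ k / fact k) has_real_derivative \<theta> ^ (k - 1) / fact (k - 1)) (at \<theta> within {0..1})"
      by simp
    show "((\<lambda>\<theta>. (\<theta> ^ k / fact k) *\<^sub>R y ((1 - \<theta>) * s)) has_vector_derivative ?y \<theta> - s *\<^sub>R ?z \<theta>) (at \<theta> within {0..1})"
      using has_vector_derivative_scaleR[OF 3 2] by (simp add: algebra_simps)
  qed simp
  then have "((\<lambda>\<theta>. ?y \<theta> - s *\<^sub>R ?z \<theta>) has_integral (1 / fact k) *\<^sub>R y 0) {0..1}"
    using k by (simp add: power_0_left)
  moreover have "((\<lambda>\<theta>. ?y \<theta> - s *\<^sub>R ?z \<theta>) has_integral (integral {0..1} ?y - s *\<^sub>R integral {0..1} ?z)) {0..1}"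
    by (intro has_integral_diff has_integral_cmul integrable_integral iy iz)
  ultimately have "(1 / fact k) *\<^sub>R y 0 = integral {0..1} ?y - s *\<^sub>R integral {0..1} ?z"
    by (rule has_integral_unique)
  then show ?thesis by (simp add: algebra_simps)
qed

text \<open>The recurrence at s = 0 for a constant curve; the value 1/k! is phi_k(0).\<close>

lemma weight_integral:
  assumes "k \<ge> 1"
  shows "((\<lambda>\<theta>::real. \<theta> ^ (k - 1) / fact (k - 1)) has_integral 1 / fact k) {0..1}"
proof -
  have "integral {0..1} (\<lambda>\<theta>. (\<theta> ^ (k - 1) / fact (k - 1)) *\<^sub>R (1::real)) = 1 / fact k"
    using weighted_integral_by_parts[of 0 k "\<lambda>_. 1 :: real" "\<lambda>_. 0"] assms by simp
  moreover have "(\<lambda>\<theta>::real. \<theta> ^ (k - 1) / fact (k - 1)) integrable_on {0..1}"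
    by (intro integrable_continuous_real continuous_intros) simp
  ultimately show ?thesis
    using integrable_integral by fastforce
qed

context c0_semigroup
begin

text \<open>This is phi_k(sA), with node and step size merged into one time s; a bound on T up to a
  fixed time then controls all nodes and steps together.\<close>

definition P :: "nat \<Rightarrow> real \<Rightarrow> 'a \<Rightarrow> 'a" where
  "P k s v = integral {0..1} (\<lambda>\<theta>. (\<theta> ^ (k - 1) / fact (k - 1)) *\<^sub>R T ((1 - \<theta>) * s) v)"

lemma phi_op_exp_scaled: "phi_op (exp_scaled T h) k r = P k (r * h)"
  by (rule ext) (simp add: phi_op_def exp_scaled_def P_def mult.assoc)

lemma P_integrand_integrable:
  assumes "s \<ge> 0"
  shows "(\<lambda>\<theta>. (\<theta> ^ (k - 1) / fact (k - 1)) *\<^sub>R T ((1 - \<theta>) * s) v) integrable_on {0..1}"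
  by (intro integrable_continuous_real continuous_intros) (use assms in auto)

lemma norm_P_le:
  assumes "0 \<le> s" "s \<le> R" and M: "\<And>t. 0 \<le> t \<Longrightarrow> t \<le> R \<Longrightarrow> norm (T t) \<le> M"
  shows "norm (P k s v) \<le> M * norm v"
proof -
  have "norm (integral {0..1} (\<lambda>\<theta>. (\<theta> ^ (k - 1) / fact (k - 1)) *\<^sub>R T ((1 - \<theta>) * s) v)) \<le> M * norm v * (1 - 0)"
  proof (rule integral_bound)
    fix \<theta> :: real assume \<theta>: "\<theta> \<in> {0..1}"
    have "(1 - \<theta>) * s \<le> s" using \<theta> assms by (simp add: mult_left_le_one_le)
    then have "norm (T ((1 - \<theta>) * s)) \<le> M" using \<theta> assms by (intro M) auto
    then have 1: "norm (T ((1 - \<theta>) * s) v) \<le> M * norm v"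
      by (meson norm_blinfun order_trans mult_right_mono norm_ge_zero)
    have "\<theta> ^ (k - 1) / fact (k - 1) \<le> 1 / 1"
      using \<theta> by (intro frac_le) (auto simp: power_le_one)
    then have "norm ((\<theta> ^ (k - 1) / fact (k - 1)) *\<^sub>R T ((1 - \<theta>) * s) v) \<le> 1 * norm (T ((1 - \<theta>) * s) v)"
      unfolding norm_scaleR using \<theta> by (intro mult_right_mono) auto
    then show "norm ((\<theta> ^ (k - 1) / fact (k - 1)) *\<^sub>R T ((1 - \<theta>) * s) v) \<le> M * norm v"
      using 1 by simp
  qed (use assms in \<open>auto intro!: continuous_intros\<close>)
  then show ?thesis by (simp add: P_def)
qed

lemma bounded_linear_P:
  assumes "s \<ge> 0"
  shows "bounded_linear (P k s)"
proof -
  obtain M where M: "M \<ge> 1" "\<And>t. 0 \<le> t \<Longrightarrow> t \<le> s \<Longrightarrow> norm (T t) \<le> M"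
    using T_bounded by blast
  show ?thesis
  proof (rule bounded_linear_intro[where K = M])
    show "P k s (x + y) = P k s x + P k s y" for x y
      unfolding P_def
      by (simp only: blinfun.add_right scaleR_add_right
          Henstock_Kurzweil_Integration.integral_add[OF P_integrand_integrable P_integrand_integrable, OF assms assms])
    show "P k s (r *\<^sub>R x) = r *\<^sub>R P k s x" for r x
      unfolding P_def by (simp only: blinfun.scaleR_right scaleR_left_commute[of _ r] integral_cmul)
    show "norm (P k s x) \<le> norm x * M" for x
      using norm_P_le[OF assms order_refl, of M k x] M by (simp add: mult.commute)
  qed
qed

lemma P_add: "s \<ge> 0 \<Longrightarrow> P k s (x + y) = P k s x + P k s y"
  using bounded_linear_P by (simp add: linear_simps)

lemma P_diff: "s \<ge> 0 \<Longrightarrow> P k s (x - y) = P k s x - P k s y"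
  using bounded_linear_P by (simp add: linear_simps)

lemma P_scaleR: "s \<ge> 0 \<Longrightarrow> P k s (r *\<^sub>R x) = r *\<^sub>R P k s x"
  using bounded_linear_P by (simp add: linear_simps)

lemma T_commute: "s \<ge> 0 \<Longrightarrow> t \<ge> 0 \<Longrightarrow> T s (T t x) = T t (T s x)"
  by (metis T_add_apply add.commute)

lemma T_P: "s \<ge> 0 \<Longrightarrow> t \<ge> 0 \<Longrightarrow> T t (P k s x) = P k s (T t x)"
proof -
  assume st: "s \<ge> 0" "t \<ge> 0"
  have "P k s (T t x) = integral {0..1} (\<lambda>\<theta>. T t ((\<theta> ^ (k - 1) / fact (k - 1)) *\<^sub>R T ((1 - \<theta>) * s) x))"
    unfolding P_def
    by (intro Henstock_Kurzweil_Integration.integral_cong) (use st T_commute in \<open>simp add: blinfun.scaleR_right\<close>)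
  also have "\<dots> = T t (P k s x)"
    using integral_linear[OF P_integrand_integrable[OF st(1)] blinfun.bounded_linear_right[of "T t"]]
    by (simp add: o_def P_def)
  finally show ?thesis by simp
qed

text \<open>The integrated orbit equals s phi_1(sA) x, but it depends on s only through a limit of
  integration, which makes it easy to differentiate.\<close>

definition J :: "real \<Rightarrow> 'a \<Rightarrow> 'a" where
  "J s x = integral {0..s} (\<lambda>r. T r x)"

lemma J_0 [simp]: "J 0 x = 0"
  by (simp add: J_def)

lemma J_deriv:
  assumes s: "s \<ge> 0"
  shows "((\<lambda>s. J s x) has_vector_derivative T s x) (at s within {0..})"
proof -
  have "((\<lambda>s. J s x) has_vector_derivative T s x) (at s within {0..s + 1})"
    unfolding J_def
    by (rule integral_has_vector_derivative) (use s in \<open>auto intro!: continuous_intros\<close>)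
  moreover have "at s within {0..s + 1} = at s within {0..}"
    by (rule at_within_nhd[of _ "{..<s + 1}"]) (use s in auto)
  ultimately show ?thesis by simp
qed

lemma J_eq_P:
  assumes s: "s \<ge> 0"
  shows "J s x = s *\<^sub>R P 1 s x"
proof -
  have "((\<lambda>\<theta>. s *\<^sub>R T ((1 - \<theta>) * s) x) has_integral (- J ((1 - 1) * s) x - (- J ((1 - 0) * s) x))) {0..1}"
  proof (rule fundamental_theorem_of_calculus)
    fix \<theta> :: real assume \<theta>: "\<theta> \<in> {0..1}"
    have 1: "((\<lambda>\<theta>. (1 - \<theta>) * s) has_vector_derivative - s) (at \<theta> within {0..1})"
      by (auto intro!: derivative_eq_intros simp: has_vector_derivative_def)
    have "((\<lambda>r. J r x) has_vector_derivative T ((1 - \<theta>) * s) x) (at ((1 - \<theta>) * s) within (\<lambda>\<theta>. (1 - \<theta>) * s) ` {0..1})"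
      by (rule has_vector_derivative_within_subset[OF J_deriv]) (use \<theta> s in auto)
    from has_vector_derivative_minus[OF vector_diff_chain_within[OF 1 this]]
    show "((\<lambda>\<theta>. - J ((1 - \<theta>) * s) x) has_vector_derivative s *\<^sub>R T ((1 - \<theta>) * s) x) (at \<theta> within {0..1})"
      by (simp add: o_def)
  qed simp
  then have "integral {0..1} (\<lambda>\<theta>. s *\<^sub>R T ((1 - \<theta>) * s) x) = J s x"
    by (intro integral_unique) simp
  then show ?thesis by (simp add: P_def)
qed

text \<open>\<open>orbit y z\<close> says that \<open>y\<close> is in the domain of the generator, which maps it to \<open>z\<close>. The integrated
  form can be differentiated with respect to parameters without appealing to closedness.\<close>

definition orbit :: "'a \<Rightarrow> 'a \<Rightarrow> bool" where
  "orbit y z \<longleftrightarrow> (\<forall>s\<ge>0. T s y = y + s *\<^sub>R P 1 s z)"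

lemma orbit_deriv:
  assumes "orbit y z" "s \<ge> 0"
  shows "((\<lambda>s. T s y) has_vector_derivative T s z) (at s within {0..})"
proof -
  have "((\<lambda>s. y + J s z) has_vector_derivative T s z) (at s within {0..})"
    using J_deriv[OF assms(2), of z] by (auto intro!: derivative_eq_intros simp: has_vector_derivative_def)
  then show ?thesis
    by (rule has_vector_derivative_transform[rotated 2])
      (use assms in \<open>auto simp: orbit_def J_eq_P\<close>)
qed

text \<open>The recurrence phi_k(w) = 1/k! + w phi_{k+1}(w) at w = sA, with z in the role of A
  y.\<close>

lemma orbit_P_rec:
  assumes "orbit y z" "s \<ge> 0" "k \<ge> 1"
  shows "P k s y = (1 / fact k) *\<^sub>R y + s *\<^sub>R P (Suc k) s z"
  using weighted_integral_by_parts[OF assms(2,3) orbit_deriv[OF assms(1)] T_continuous]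
  by (simp add: P_def)

lemma orbit_scaleR: "orbit y z \<Longrightarrow> orbit (r *\<^sub>R y) (r *\<^sub>R z)"
  by (simp add: orbit_def blinfun.scaleR_right P_scaleR algebra_simps)

lemma orbit_add: "orbit y z \<Longrightarrow> orbit y' z' \<Longrightarrow> orbit (y + y') (z + z')"
  by (simp add: orbit_def blinfun.add_right P_add algebra_simps)

lemma orbit_T: "orbit y z \<Longrightarrow> t \<ge> 0 \<Longrightarrow> orbit (T t y) (T t z)"
  unfolding orbit_def
proof (intro allI impI)
  fix s :: real assume *: "\<forall>s\<ge>0. T s y = y + s *\<^sub>R P 1 s z" "t \<ge> 0" "s \<ge> 0"
  then have "T s (T t y) = T t (T s y)" by (intro T_commute)
  also have "\<dots> = T t (y + s *\<^sub>R P 1 s z)" using * by simp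
  also have "\<dots> = T t y + s *\<^sub>R P 1 s (T t z)"
    using * by (simp only: T_P blinfun.add_right blinfun.scaleR_right)
  finally show "T s (T t y) = T t y + s *\<^sub>R P 1 s (T t z)" .
qed

lemma J_T: 
  assumes "r \<ge> 0" "t \<ge> 0"
  shows "J t (T r x) = J (t + r) x - J r x"
proof -
  have "((\<lambda>s. T s (T r x)) has_integral (J (t + r) x - J (0 + r) x)) {0..t}"
  proof (rule fundamental_theorem_of_calculus)
    fix s assume s: "s \<in> {0..t}"
    have 1: "((\<lambda>s. s + r) has_vector_derivative 1) (at s within {0..t})"
      by (auto intro!: derivative_eq_intros simp: has_vector_derivative_def)
    have "((\<lambda>s. J s x) has_vector_derivative T (s + r) x) (at (s + r) within (\<lambda>s. s + r) ` {0..t})"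
      by (rule has_vector_derivative_within_subset[OF J_deriv]) (use s assms in auto)
    from vector_diff_chain_within[OF 1 this]
    show "((\<lambda>s. J (s + r) x) has_vector_derivative T s (T r x)) (at s within {0..t})"
      using s assms by (simp add: o_def T_add_apply)
  qed (use assms in simp)
  then show ?thesis by (simp add: J_def integral_unique)
qed

text \<open>Integration in time smooths: J t (T r x) is differentiable in r for every x, although T
  r x need not be, because it is J (t + r) x - J r x.\<close>

lemma J_T_deriv:
  assumes "r \<ge> 0" "t \<ge> 0"
  shows "((\<lambda>r. J t (T r x)) has_vector_derivative T r (T t x - x)) (at r within {0..})"
proof -
  have 1: "((\<lambda>r. t + r) has_vector_derivative 1) (at r within {0..})"
    by (auto intro!: derivative_eq_intros simp: has_vector_derivative_def)
  have "((\<lambda>s. J s x) has_vector_derivative T (t + r) x) (at (t + r) within (\<lambda>r. t + r) ` {0..})"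
    by (rule has_vector_derivative_within_subset[OF J_deriv]) (use assms in auto)
  from vector_diff_chain_within[OF 1 this]
  have "((\<lambda>r. J (t + r) x) has_vector_derivative T (t + r) x) (at r within {0..})"
    by (simp add: o_def)
  from has_vector_derivative_diff[OF this J_deriv[OF assms(1)]]
  have "((\<lambda>r. J (t + r) x - J r x) has_vector_derivative T r (T t x - x)) (at r within {0..})"
    using assms by (simp add: blinfun.diff_right T_add_apply[symmetric] add.commute)
  then show ?thesis
    by (rule has_vector_derivative_transform[rotated 2]) (use assms in \<open>auto simp: J_T\<close>)
qed

text \<open>The range of phi_k(sA) lies in the domain of A, because sA phi_1(sA) = T s - 1 and sA
  phi_k(sA) = phi_{k-1}(sA) - 1/(k-1)! for k \<ge> 2. Hence the increments of the method lie in the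
  domain whatever the values of g.\<close>

lemma orbit_P_ex:
  assumes s: "s > 0" and k: "k \<ge> 1"
  shows "\<exists>z. orbit (P k s x) z"
proof -
  have "\<exists>z. orbit (s *\<^sub>R P k s x) z"
  proof (cases "k = 1")
    case True
    have "orbit (J s x) (T s x - x)"
      unfolding orbit_def
    proof (intro allI impI)
      fix t :: real assume t: "t \<ge> 0"
      have "T t (J s x) = J s (T t x)"
        using T_P[of s t 1 x] s t by (simp add: J_eq_P blinfun.scaleR_right)
      also have "\<dots> = J s x + (J t (T s x) - J t x)"
        using s t by (simp add: J_T add.commute)
      also have "J t (T s x) - J t x = t *\<^sub>R P 1 t (T s x - x)"
        using t by (simp add: J_eq_P P_diff algebra_simps)
      finally show "T t (J s x) = J s x + t *\<^sub>R P 1 t (T s x - x)" .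
    qed
    then show ?thesis using s True by (auto simp: J_eq_P)
  next
    case False
    then have k: "k - 1 \<ge> 1" "Suc (k - 1) = k" using k by auto
    define w where "w = P (k - 1) s x - (1 / fact (k - 1)) *\<^sub>R x"
    have "orbit (s *\<^sub>R P k s x) w"
      unfolding orbit_def
    proof (intro allI impI)
      fix t :: real assume t: "t \<ge> 0"
      have "bounded_linear (J t)"
        using bounded_linear_scaleR_right[of t, THEN bounded_linear_compose, OF bounded_linear_P[OF t, of 1]]
        by (simp add: J_eq_P[OF t, abs_def])
      from integral_linear[OF P_integrand_integrable[of s "k - 1" x] this]
      have "J t (P (k - 1) s x) = integral {0..1} (\<lambda>\<theta>. (\<theta> ^ (k - 1 - 1) / fact (k - 1 - 1)) *\<^sub>R J t (T ((1 - \<theta>) * s) x))"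
        using s linear_scale[OF bounded_linear.linear[OF \<open>bounded_linear (J t)\<close>]] by (simp add: o_def P_def)
      \<comment> \<open>With \<open>J t\<close> inside the integral, the curve to be integrated by
        parts is the smoothed one, J t (T r x).\<close>
      also have "\<dots> = (1 / fact (k - 1)) *\<^sub>R J t (T 0 x) +
          s *\<^sub>R integral {0..1} (\<lambda>\<theta>. (\<theta> ^ (k - 1) / fact (k - 1)) *\<^sub>R T ((1 - \<theta>) * s) (T t x - x))"
        by (rule weighted_integral_by_parts) (use s t k J_T_deriv T_continuous in auto)
      also have "\<dots> = (1 / fact (k - 1)) *\<^sub>R J t x + s *\<^sub>R (T t (P k s x) - P k s x)"
        using s t T_P[of s t k x] P_diff[of s k "T t x" x] by (simp add: P_def)
      finally have "T t (s *\<^sub>R P k s x) = s *\<^sub>R P k s x + (J t (P (k - 1) s x) - (1 / fact (k - 1)) *\<^sub>R J t x)"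
        by (simp add: blinfun.scaleR_right algebra_simps)
      also have "J t (P (k - 1) s x) - (1 / fact (k - 1)) *\<^sub>R J t x = t *\<^sub>R P 1 t w"
        using t by (simp add: w_def J_eq_P P_diff P_scaleR algebra_simps)
      finally show "T t (s *\<^sub>R P k s x) = s *\<^sub>R P k s x + t *\<^sub>R P 1 t w" .
    qed
    then show ?thesis by blast
  qed
  then obtain z where "orbit (s *\<^sub>R P k s x) z" by blast
  from orbit_scaleR[OF this, of "1 / s"] show ?thesis using s by auto
qed

lemma orbit_right_limit:
  assumes "orbit y z"
  shows "((\<lambda>t. (T t y - y) /\<^sub>R t) \<longlongrightarrow> z) (at_right 0)"
  using has_vector_derivative_right_limit[OF orbit_deriv[OF assms order_refl]] by simp

end

context analytic_c0_semigroup
begin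

text \<open>For s > 0 analyticity makes the orbit of y differentiable, so its derivative can be read
  off from the right difference quotient, which the semigroup law sends to T s z. Integrating over
  [0, s] needs only continuity at the end points.\<close>

lemma right_limit_imp_orbit:
  assumes y: "((\<lambda>t. (T t y - y) /\<^sub>R t) \<longlongrightarrow> z) (at_right 0)"
  shows "orbit y z"
proof -
  obtain D where D: "\<And>t. t > 0 \<Longrightarrow> (T has_vector_derivative D t) (at t)"
    using T_second_derivative by metis
  have der: "((\<lambda>s. T s y) has_vector_derivative T s z) (at s)" if s: "s > 0" for s
  proof -
    have 1: "((\<lambda>s. T s y) has_vector_derivative D s y) (at s)"
      by (rule bounded_linear.has_vector_derivative[OF blinfun.bounded_linear_left D[OF s]])
    then have "((\<lambda>t. T (t + s) y) has_vector_derivative D s y) (at 0)"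
      by (intro vector_derivative_shift) simp
    then have "((\<lambda>t. T (t + s) y) has_vector_derivative D s y) (at 0 within {0..})"
      by (rule has_vector_derivative_at_within)
    then have 2: "((\<lambda>t. (T (t + s) y - T s y) /\<^sub>R t) \<longlongrightarrow> D s y) (at_right 0)"
      using has_vector_derivative_right_limit by fastforce
    have "((\<lambda>t. T s ((T t y - y) /\<^sub>R t)) \<longlongrightarrow> T s z) (at_right 0)"
      by (intro tendsto_intros y)
    then have "((\<lambda>t. (T (t + s) y - T s y) /\<^sub>R t) \<longlongrightarrow> T s z) (at_right 0)"
    proof (rule Lim_transform_eventually)
      show "\<forall>\<^sub>F t in at_right 0. T s ((T t y - y) /\<^sub>R t) = (T (t + s) y - T s y) /\<^sub>R t"
        unfolding eventually_at_right_field
        using s by (intro exI[of _ 1]) (auto simp: blinfun.scaleR_right blinfun.diff_right add.commute[of _ s] T_add_apply)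
    qed
    with 2 have "D s y = T s z" using tendsto_unique[of "at_right (0::real)"] by fastforce
    with 1 show ?thesis by simp
  qed
  have "T s y = y + s *\<^sub>R P 1 s z" if s: "s \<ge> 0" for s
  proof -
    have "((\<lambda>s. T s z) has_integral (T s y - T 0 y)) {0..s}"
      by (rule fundamental_theorem_of_calculus_interior) (use s der in \<open>auto intro!: continuous_intros\<close>)
    then have "J s z = T s y - y" by (simp add: J_def integral_unique)
    then show ?thesis using J_eq_P[OF s, of z] by simp
  qed
  then show ?thesis by (simp add: orbit_def)
qed

lemma generates_iff_orbit:
  assumes "generates A D T"
  shows "y \<in> D \<longleftrightarrow> (\<exists>z. orbit y z)" and "y \<in> D \<Longrightarrow> orbit y (A y)"
proof -
  show *: "orbit y (A y)" if "y \<in> D"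
    using assms that right_limit_imp_orbit unfolding generates_def by blast
  show "y \<in> D \<longleftrightarrow> (\<exists>z. orbit y z)"
    using * assms orbit_right_limit unfolding generates_def by blast
qed

end

text \<open>In this form a difference quotient can be moved into one argument of a multilinear map,
  and product rules become statements about limits.\<close>

lemma has_vector_derivative_iff_quotient:
  "(f has_vector_derivative d) (at t within S) \<longleftrightarrow> ((\<lambda>s. (f s - f t) /\<^sub>R (s - t)) \<longlongrightarrow> d) (at t within S)"
proof -
  have "norm ((1 / norm (s - t)) *\<^sub>R (f s - (f t + (s - t) *\<^sub>R d))) = norm ((f s - f t) /\<^sub>R (s - t) - d)" if "s \<noteq> t" for s
  proof -
    have "(f s - f t) /\<^sub>R (s - t) - d = (1 / (s - t)) *\<^sub>R (f s - (f t + (s - t) *\<^sub>R d))"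
      using that by (simp add: scaleR_diff_right scaleR_add_right divide_inverse)
    then show ?thesis by simp
  qed
  then have *: "\<forall>\<^sub>F s in at t within S. norm ((1 / norm (s - t)) *\<^sub>R (f s - (f t + (s - t) *\<^sub>R d)))
      = norm ((f s - f t) /\<^sub>R (s - t) - d)"
    unfolding eventually_at_filter by (intro always_eventually) blast
  have "(f has_vector_derivative d) (at t within S) \<longleftrightarrow>
      ((\<lambda>s. norm ((1 / norm (s - t)) *\<^sub>R (f s - (f t + (s - t) *\<^sub>R d)))) \<longlongrightarrow> 0) (at t within S)"
    unfolding has_vector_derivative_def has_derivative_within tendsto_norm_zero_iff
    by (simp add: bounded_linear_scaleR_left)
  also have "\<dots> \<longleftrightarrow> ((\<lambda>s. norm ((f s - f t) /\<^sub>R (s - t) - d)) \<longlongrightarrow> 0) (at t within S)"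
    by (rule tendsto_cong[OF *])
  also have "\<dots> \<longleftrightarrow> ((\<lambda>s. (f s - f t) /\<^sub>R (s - t)) \<longlongrightarrow> d) (at t within S)"
    unfolding tendsto_norm_zero_iff LIM_zero_iff ..
  finally show ?thesis .
qed

section \<open>Multilinear maps on lists\<close>

text \<open>Lists keep the number of arguments at the level of terms: derivatives of all orders
  share one type, and induction on the arguments is possible.\<close>

definition multilin :: "nat \<Rightarrow> ('a::real_normed_vector list \<Rightarrow> 'b::real_normed_vector) \<Rightarrow> bool" where
  "multilin k M \<longleftrightarrow> (\<exists>C. \<forall>vs. length vs = k \<longrightarrow>
     (\<forall>i<k. linear (\<lambda>w. M (vs[i := w]))) \<and> norm (M vs) \<le> C * prod_list (map norm vs))"

lemma multilin_0: "multilin 0 M"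
  unfolding multilin_def by (intro exI[of _ "norm (M [])"]) auto

lemma multilin_fix_Cons:
  assumes "multilin (Suc k) M"
  shows "multilin k (\<lambda>vs. M (v # vs))"
proof -
  obtain C where C: "\<And>vs. length vs = Suc k \<Longrightarrow>
     (\<forall>i<Suc k. linear (\<lambda>w. M (vs[i := w]))) \<and> norm (M vs) \<le> C * prod_list (map norm vs)"
    using assms unfolding multilin_def by blast
  show ?thesis
    unfolding multilin_def
  proof (intro exI[of _ "C * norm v"] allI impI conjI)
    fix vs :: "'a list" and i assume "length vs = k" "i < k"
    then show "linear (\<lambda>w. M (v # vs[i := w]))"
      using C[of "v # vs"] by (auto dest: spec[of _ "Suc i"])
  next
    fix vs :: "'a list" assume "length vs = k"
    then show "norm (M (v # vs)) \<le> C * norm v * prod_list (map norm vs)"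
      using C[of "v # vs"] by (simp add: mult.assoc)
  qed
qed

lemma multilin_Cons_linear:
  assumes "multilin (Suc k) M" "length vs = k"
  shows "linear (\<lambda>w. M (w # vs))"
proof -
  have "linear (\<lambda>w. M ((undefined # vs)[0 := w]))"
    using assms unfolding multilin_def by (metis length_Cons zero_less_Suc)
  then show ?thesis by simp
qed

text \<open>Replacing the first argument by its limit costs a term with first argument c s - l,
  which tends to 0 by the norm bound. The other term has one argument frozen and falls under the
  induction hypothesis.\<close>

lemma multilin_tendsto:
  assumes "multilin k M" "length cs = k" "list_all2 (\<lambda>c l. (c \<longlongrightarrow> l) F) cs ls"
  shows "((\<lambda>s. M (map (\<lambda>c. c s) cs)) \<longlongrightarrow> M ls) F"
  using assms(3,1,2)
proof (induction arbitrary: M k rule: list_all2_induct)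
  case Nil
  then show ?case by simp
next
  case (Cons c cs l ls)
  then obtain n where k: "k = Suc n" "length cs = n" by auto
  obtain C where C: "\<And>vs. length vs = k \<Longrightarrow> norm (M vs) \<le> C * prod_list (map norm vs)"
    using Cons.prems unfolding multilin_def by blast
  let ?vs = "\<lambda>s. map (\<lambda>c. c s) cs"
  have prod: "((\<lambda>s. prod_list (map norm (?vs s))) \<longlongrightarrow> prod_list (map norm ls)) F"
    using Cons.hyps(2) by (induction rule: list_all2_induct) (auto intro!: tendsto_intros)
  have "((\<lambda>s. C * (norm (c s - l) * prod_list (map norm (?vs s)))) \<longlongrightarrow> C * (0 * prod_list (map norm ls))) F"
    by (intro tendsto_intros prod tendsto_norm_zero) (use Cons.hyps(1) LIM_zero in blast)
  then have lim: "((\<lambda>s. C * (norm (c s - l) * prod_list (map norm (?vs s)))) \<longlongrightarrow> 0) F"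
    by simp
  have "norm (M ((c s - l) # ?vs s)) \<le> C * (norm (c s - l) * prod_list (map norm (?vs s)))" for s
    using C[of "(c s - l) # ?vs s"] k by simp
  then have "\<forall>\<^sub>F s in F. norm (M ((c s - l) # ?vs s)) \<le> C * (norm (c s - l) * prod_list (map norm (?vs s)))"
    by (rule always_eventually[OF allI])
  from Lim_null_comparison[OF this lim] have "((\<lambda>s. M ((c s - l) # ?vs s)) \<longlongrightarrow> 0) F" .
  moreover have "((\<lambda>s. M (l # ?vs s)) \<longlongrightarrow> M (l # ls)) F"
    using Cons.IH[OF multilin_fix_Cons] Cons.prems(1) k by blast
  ultimately have "((\<lambda>s. M ((c s - l) # ?vs s) + M (l # ?vs s)) \<longlongrightarrow> 0 + M (l # ls)) F"
    by (rule tendsto_add)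
  moreover have "M ((c s - l) # ?vs s) + M (l # ?vs s) = M (c s # ?vs s)" for s
    using linear_diff[OF multilin_Cons_linear[of n M "?vs s"], of "c s" l] Cons.prems(1) k by simp
  ultimately show ?case by simp
qed

text \<open>The quotient splits into the increment of the first argument, with the others taken at
  s, and the quotient with the first argument frozen at t. The former converges by joint continuity,
  the latter by induction.\<close>

lemma multilin_has_vector_derivative:
  assumes "multilin k M" "length cs = k"
    and "list_all2 (\<lambda>c d. (c has_vector_derivative d) (at t within S)) cs ds"
  shows "((\<lambda>s. M (map (\<lambda>c. c s) cs)) has_vector_derivative (\<Sum>p<k. M ((map (\<lambda>c. c t) cs)[p := ds ! p]))) (at t within S)"
  using assms(3,1,2)
proof (induction arbitrary: M k rule: list_all2_induct)
  case Nil
  then show ?case by simp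
next
  case (Cons c cs d ds)
  then obtain n where k: "k = Suc n" "length cs = n" by auto
  let ?vs = "\<lambda>s. map (\<lambda>c. c s) cs"
  have lin: "linear (\<lambda>w. M (w # ?vs s))" for s
    using multilin_Cons_linear[of n M "?vs s"] Cons.prems(1) k by simp
  have 1: "((\<lambda>s. M (map (\<lambda>c. c s) ((\<lambda>s. (c s - c t) /\<^sub>R (s - t)) # cs))) \<longlongrightarrow> M (d # ?vs t)) (at t within S)"
  proof (rule multilin_tendsto[OF Cons.prems(1)])
    have "list_all2 (\<lambda>c l. (c \<longlongrightarrow> l) (at t within S)) cs (?vs t)"
      using Cons.hyps(2) by (induction rule: list_all2_induct)
        (auto dest: has_vector_derivative_continuous simp: continuous_within)
    then show "list_all2 (\<lambda>c l. (c \<longlongrightarrow> l) (at t within S)) ((\<lambda>s. (c s - c t) /\<^sub>R (s - t)) # cs) (d # ?vs t)"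
      using Cons.hyps(1)[unfolded has_vector_derivative_iff_quotient] by simp
  qed (use Cons.prems in simp)
  have 2: "((\<lambda>s. (M (c t # ?vs s) - M (c t # ?vs t)) /\<^sub>R (s - t)) \<longlongrightarrow> (\<Sum>p<n. M (c t # (?vs t)[p := ds ! p]))) (at t within S)"
    using Cons.IH[OF multilin_fix_Cons, of n M "c t"] Cons.prems(1) k
    unfolding has_vector_derivative_iff_quotient by simp
  have "(M (c s # ?vs s) - M (c t # ?vs t)) /\<^sub>R (s - t) =
      M ((c s - c t) /\<^sub>R (s - t) # ?vs s) + (M (c t # ?vs s) - M (c t # ?vs t)) /\<^sub>R (s - t)" for s
    by (simp add: linear_scale[OF lin] linear_diff[OF lin] scaleR_diff_right)
  then have "((\<lambda>s. M (c s # ?vs s)) has_vector_derivative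
      (M (d # ?vs t) + (\<Sum>p<n. M (c t # (?vs t)[p := ds ! p])))) (at t within S)"
    unfolding has_vector_derivative_iff_quotient using tendsto_add[OF 1 2] by simp
  moreover have "(\<Sum>p<k. M ((map (\<lambda>c. c t) (c # cs))[p := (d # ds) ! p])) =
      M (d # ?vs t) + (\<Sum>p<n. M (c t # (?vs t)[p := ds ! p]))"
    unfolding k(1) by (simp add: sum.lessThan_Suc_shift del: sum.lessThan_Suc)
  ultimately show ?case by simp
qed

section \<open>Derivatives of a composition\<close>

text \<open>An index list \<open>[i1, ..., ir]\<close> stands for the term \<open>G r (w t) [W i1 t, ..., W ir t]\<close> of the
  formula of Faa di Bruno, where \<open>W i\<close> is the \<open>i\<close>-th derivative of the curve \<open>w\<close>.\<close>

definition next_terms :: "nat list \<Rightarrow> nat list list" where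
  "next_terms is = (1 # is) # map (\<lambda>p. is[p := Suc (is ! p)]) [0..<length is]"

text \<open>Terms are neither reordered nor collected: multiplicities appear as repetitions, and no
  combinatorial coefficients arise.\<close>

primrec faa :: "nat \<Rightarrow> nat list list" where
  "faa 0 = [[]]"
| "faa (Suc k) = concat (map next_terms (faa k))"

text \<open>For k \<ge> 1 every term contains a derivative of g of order at least 1. This matters
  because those derivatives are bounded on the strip by hypothesis, whereas no bound on g itself is
  given.\<close>

lemma faa_bounds:
  assumes "is \<in> set (faa k)"
  shows "length is \<le> k" "k \<ge> 1 \<Longrightarrow> length is \<ge> 1" "\<forall>i\<in>set is. 1 \<le> i \<and> i \<le> k"
proof -
  have "length is \<le> k \<and> (k \<ge> 1 \<longrightarrow> length is \<ge> 1) \<and> (\<forall>i\<in>set is. 1 \<le> i \<and> i \<le> k)"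
    using assms
  proof (induction k arbitrary: "is")
    case (Suc k)
    then obtain js where js: "js \<in> set (faa k)" "is \<in> set (next_terms js)" by auto
    then have IH: "length js \<le> k" "\<forall>i\<in>set js. 1 \<le> i \<and> i \<le> k" using Suc.IH by auto
    from js(2) consider "is = 1 # js" | p where "p < length js" "is = js[p := Suc (js ! p)]"
      unfolding next_terms_def by auto
    then show ?case
    proof cases
      case 1
      then show ?thesis using IH by fastforce
    next
      case 2
      have "js ! p \<le> k" using IH 2 by auto
      moreover have "set is \<subseteq> insert (Suc (js ! p)) (set js)"
        unfolding 2(2) by (rule set_update_subset_insert)
      ultimately show ?thesis using IH 2 by fastforce
    qed
  qed simp
  then show "length is \<le> k" "k \<ge> 1 \<Longrightarrow> length is \<ge> 1" "\<forall>i\<in>set is. 1 \<le> i \<and> i \<le> k" by auto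
qed

lemma sum_list_map_concat:
  "(\<Sum>y\<leftarrow>concat (map h xs). f y) = (\<Sum>x\<leftarrow>xs. \<Sum>y\<leftarrow>h x. f y)"
  by (induction xs) auto

locale frechet_chain =
  fixes m :: nat and g :: "'a::real_normed_vector \<Rightarrow> 'a" and S :: "'a set"
    and G :: "nat \<Rightarrow> 'a \<Rightarrow> 'a list \<Rightarrow> 'a"
  assumes G_0: "x \<in> S \<Longrightarrow> G 0 x [] = g x"
    and G_bound: "k \<in> {1..m} \<Longrightarrow> \<exists>M. \<forall>x\<in>S. \<forall>vs. length vs = k \<longrightarrow>
           (\<forall>i<k. linear (\<lambda>w. G k x (vs[i := w]))) \<and>
           norm (G k x vs) \<le> M * prod_list (map norm vs)"
    and G_diff: "k < m \<Longrightarrow> x \<in> S \<Longrightarrow> \<epsilon> > 0 \<Longrightarrow> \<exists>\<delta>>0. \<forall>y\<in>S. dist y x < \<delta> \<longrightarrow>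
           (\<forall>vs. length vs = k \<longrightarrow>
              norm (G k y vs - G k x vs - G (Suc k) x ((y - x) # vs))
                \<le> \<epsilon> * norm (y - x) * prod_list (map norm vs))"
begin

lemma G_multilin: "k \<le> m \<Longrightarrow> x \<in> S \<Longrightarrow> multilin k (G k x)"
  using G_bound[of k] multilin_0 by (cases "k = 0") (auto simp: multilin_def Suc_le_eq)

text \<open>The increment has three parts: the Frechet remainder in the base point, its linear part,
  which becomes a new first argument, and the increments of the old arguments. The remainder
  estimate is uniform in the arguments, so it may be applied while they move with s.\<close>

lemma G_curve_deriv:
  assumes k: "k < m" and w: "\<And>s. s \<in> I \<Longrightarrow> w s \<in> S" and t: "t \<in> I"
    and w': "(w has_vector_derivative d) (at t within I)"
    and len: "length cs = k"
    and cs: "list_all2 (\<lambda>c d. (c has_vector_derivative d) (at t within I)) cs ds"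
  shows "((\<lambda>s. G k (w s) (map (\<lambda>c. c s) cs)) has_vector_derivative
    (G (Suc k) (w t) (d # map (\<lambda>c. c t) cs) + (\<Sum>p<k. G k (w t) ((map (\<lambda>c. c t) cs)[p := ds ! p])))) (at t within I)"
proof -
  let ?vs = "\<lambda>s. map (\<lambda>c. c s) cs"
  let ?q = "\<lambda>s. (w s - w t) /\<^sub>R (s - t)"
  let ?e = "\<lambda>s. G k (w s) (?vs s) - G k (w t) (?vs s) - G (Suc k) (w t) ((w s - w t) # ?vs s)"
  have wt: "w t \<in> S" using w t by blast
  have ml: "multilin (Suc k) (G (Suc k) (w t))" "multilin k (G k (w t))"
    using G_multilin k wt by auto
  have q: "(?q \<longlongrightarrow> d) (at t within I)"
    using w' unfolding has_vector_derivative_iff_quotient .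
  have cont: "list_all2 (\<lambda>c l. (c \<longlongrightarrow> l) (at t within I)) cs (?vs t)"
    using cs by (induction rule: list_all2_induct)
      (auto dest: has_vector_derivative_continuous simp: continuous_within)
  then have prod: "((\<lambda>s. prod_list (map norm (?vs s))) \<longlongrightarrow> prod_list (map norm (?vs t))) (at t within I)"
    by (induction cs) (auto intro!: tendsto_intros)
  have 1: "((\<lambda>s. G (Suc k) (w t) (map (\<lambda>c. c s) (?q # cs))) \<longlongrightarrow> G (Suc k) (w t) (d # ?vs t)) (at t within I)"
    using cont q len by (intro multilin_tendsto[OF ml(1)]) auto
  have 2: "((\<lambda>s. (G k (w t) (?vs s) - G k (w t) (?vs t)) /\<^sub>R (s - t)) \<longlongrightarrow> (\<Sum>p<k. G k (w t) ((?vs t)[p := ds ! p]))) (at t within I)"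
    using multilin_has_vector_derivative[OF ml(2) len cs] unfolding has_vector_derivative_iff_quotient .
  have 3: "((\<lambda>s. ?e s /\<^sub>R (s - t)) \<longlongrightarrow> 0) (at t within I)"
  proof (rule tendstoI)
    fix \<epsilon> :: real assume \<epsilon>: "\<epsilon> > 0"
    \<comment> \<open>One more than the limit of the product of norms, hence eventually an upper
      bound for it; together with \<epsilon> / (2 N) it leaves a strict inequality.\<close>
    define N where "N = norm d * prod_list (map norm (?vs t)) + 1"
    have N: "N > 0" unfolding N_def by (intro add_nonneg_pos mult_nonneg_nonneg prod_list_nonneg) auto
    have "((\<lambda>s. norm (?q s) * prod_list (map norm (?vs s))) \<longlongrightarrow> norm d * prod_list (map norm (?vs t))) (at t within I)"
      by (intro tendsto_intros q prod)
    then have e1: "\<forall>\<^sub>F s in at t within I. norm (?q s) * prod_list (map norm (?vs s)) < N"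
      by (rule order_tendstoD(2)) (simp add: N_def)
    obtain \<delta> where \<delta>: "\<delta> > 0" "\<And>y vs. y \<in> S \<Longrightarrow> dist y (w t) < \<delta> \<Longrightarrow> length vs = k \<Longrightarrow>
        norm (G k y vs - G k (w t) vs - G (Suc k) (w t) ((y - w t) # vs)) \<le> (\<epsilon> / (2 * N)) * norm (y - w t) * prod_list (map norm vs)"
      using G_diff[OF k wt, of "\<epsilon> / (2 * N)"] \<epsilon> N by auto
    have "(w \<longlongrightarrow> w t) (at t within I)"
      using has_vector_derivative_continuous[OF w'] by (simp add: continuous_within)
    then have e2: "\<forall>\<^sub>F s in at t within I. dist (w s) (w t) < \<delta>"
      using \<delta>(1) tendstoD by blast
    have e3: "\<forall>\<^sub>F s in at t within I. s \<in> I \<and> s \<noteq> t"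
      by (auto simp: eventually_at_filter)
    from e1 e2 e3 show "\<forall>\<^sub>F s in at t within I. dist (?e s /\<^sub>R (s - t)) 0 < \<epsilon>"
    proof eventually_elim
      case (elim s)
      have "norm (?e s /\<^sub>R (s - t)) = norm (?e s) / \<bar>s - t\<bar>"
        by (simp add: divide_inverse mult.commute)
      also have "\<dots> \<le> (\<epsilon> / (2 * N)) * norm (w s - w t) * prod_list (map norm (?vs s)) / \<bar>s - t\<bar>"
        using \<delta>(2)[of "w s" "?vs s"] elim w len by (intro divide_right_mono) auto
      also have "\<dots> = (\<epsilon> / (2 * N)) * (norm (?q s) * prod_list (map norm (?vs s)))"
      proof -
        have nq: "norm (?q s) = norm (w s - w t) / \<bar>s - t\<bar>"
          by (simp add: divide_inverse mult.commute)
        have "a * b * p / d = a * (b / d * p)" for a b p d :: real by simp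
        then show ?thesis unfolding nq by blast
      qed
      also have "\<dots> \<le> (\<epsilon> / (2 * N)) * N"
        using elim \<epsilon> N by (intro mult_left_mono) auto
      also have "\<dots> < \<epsilon>" using \<epsilon> N by simp
      finally show ?case by simp
    qed
  qed
  have lin: "linear (\<lambda>v. G (Suc k) (w t) (v # ?vs s))" for s
    using multilin_Cons_linear[OF ml(1)] len by simp
  have "(G k (w s) (?vs s) - G k (w t) (?vs t)) /\<^sub>R (s - t) =
      ?e s /\<^sub>R (s - t) + (G (Suc k) (w t) (?q s # ?vs s) + (G k (w t) (?vs s) - G k (w t) (?vs t)) /\<^sub>R (s - t))" for s
    unfolding linear_scale[OF lin] scaleR_add_right[symmetric] by simp
  then show ?thesis
    unfolding has_vector_derivative_iff_quotient using tendsto_add[OF 3 tendsto_add[OF 1 2]] by simp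
qed

text \<open>The k-th derivative of the composition as a function of the jet X of the inner curve
  alone. Curves with equal jets therefore give equal derivatives, which is how the solution and its
  Taylor polynomial are compared later.\<close>

definition F :: "nat \<Rightarrow> (nat \<Rightarrow> 'a) \<Rightarrow> 'a" where
  "F k X = (\<Sum>is\<leftarrow>faa k. G (length is) (X 0) (map X is))"

lemma F_0: "X 0 \<in> S \<Longrightarrow> F 0 X = g (X 0)"
  by (simp add: F_def G_0)

lemma F_cong: "(\<And>i. i \<le> k \<Longrightarrow> X i = Y i) \<Longrightarrow> F k X = F k Y"
  unfolding F_def using faa_bounds(3)
  by (intro arg_cong[of _ _ sum_list] map_cong) (auto intro!: arg_cong2[of _ _ _ _ "G _"])

lemma F_deriv:
  assumes k: "k < m" and W: "\<And>i s. i < m \<Longrightarrow> s \<in> I \<Longrightarrow> (W i has_vector_derivative W (Suc i) s) (at s within I)"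
    and W0: "\<And>s. s \<in> I \<Longrightarrow> W 0 s \<in> S" and t: "t \<in> I"
  shows "((\<lambda>t. F k (\<lambda>i. W i t)) has_vector_derivative F (Suc k) (\<lambda>i. W i t)) (at t within I)"
proof -
  let ?X = "\<lambda>t i. W i t"
  let ?term = "\<lambda>is t. G (length is) (W 0 t) (map (?X t) is)"
  have *: "(?term is has_vector_derivative (\<Sum>js\<leftarrow>next_terms is. ?term js t)) (at t within I)"
    if "is \<in> set (faa k)" for "is"
  proof -
    have b: "length is < m" "\<And>i. i \<in> set is \<Longrightarrow> i < m"
      using faa_bounds[OF that] k by auto
    have "list_all2 (\<lambda>c d. (c has_vector_derivative d) (at t within I)) (map W is) (map (\<lambda>i. W (Suc i) t) is)"
      using b(2) W t by (auto simp: list_all2_conv_all_nth)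
    from G_curve_deriv[OF b(1) W0 t W[OF _ t, of 0] _ this]
    have "((\<lambda>s. G (length is) (W 0 s) (map (\<lambda>c. c s) (map W is))) has_vector_derivative
      G (Suc (length is)) (W 0 t) (W (Suc 0) t # map (\<lambda>c. c t) (map W is)) +
      (\<Sum>p<length is. G (length is) (W 0 t) ((map (\<lambda>c. c t) (map W is))[p := map (\<lambda>i. W (Suc i) t) is ! p]))) (at t within I)"
      using b(1) by simp
    moreover have "(\<Sum>js\<leftarrow>next_terms is. ?term js t) = G (Suc (length is)) (W 0 t) (W (Suc 0) t # map (?X t) is) +
      (\<Sum>p<length is. G (length is) (W 0 t) ((map (?X t) is)[p := W (Suc (is ! p)) t]))"
      unfolding next_terms_def
      by (simp add: o_def interv_sum_list_conv_sum_set_nat map_update atLeast0LessThan)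
    ultimately show ?thesis by (simp add: o_def)
  qed
  have "((\<lambda>t. \<Sum>is\<leftarrow>L. ?term is t) has_vector_derivative (\<Sum>is\<leftarrow>L. \<Sum>js\<leftarrow>next_terms is. ?term js t)) (at t within I)"
    if "set L \<subseteq> set (faa k)" for L
    using that by (induction L) (auto intro!: has_vector_derivative_add *)
  from this[OF order_refl] show ?thesis
    by (simp add: F_def sum_list_map_concat)
qed

text \<open>Membership of X 0 in the set suffices in place of a norm bound, because X 0 enters only
  as the base point of derivatives of g that are uniformly bounded there.\<close>

lemma F_bound:
  assumes k: "1 \<le> k" "k \<le> m"
  obtains B where "\<And>X. X 0 \<in> S \<Longrightarrow> (\<And>i. 1 \<le> i \<Longrightarrow> i \<le> k \<Longrightarrow> norm (X i) \<le> K) \<Longrightarrow> norm (F k X) \<le> B"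
proof -
  have "\<exists>M. \<forall>r\<in>{1..m}. \<forall>x\<in>S. \<forall>vs. length vs = r \<longrightarrow> norm (G r x vs) \<le> M r * prod_list (map norm vs)"
    using G_bound by (intro bchoice) blast
  then obtain M where M: "\<And>r x vs. r \<in> {1..m} \<Longrightarrow> x \<in> S \<Longrightarrow> length vs = r \<Longrightarrow> norm (G r x vs) \<le> M r * prod_list (map norm vs)"
    by blast
  have "norm (F k X) \<le> (\<Sum>is\<leftarrow>faa k. \<bar>M (length is)\<bar> * K ^ length is)"
    if X: "X 0 \<in> S" "\<And>i. 1 \<le> i \<Longrightarrow> i \<le> k \<Longrightarrow> norm (X i) \<le> K" for X
  proof -
    have "norm (G (length is) (X 0) (map X is)) \<le> \<bar>M (length is)\<bar> * K ^ length is" if "is \<in> set (faa k)" for "is"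
    proof -
      have "prod_list (map norm (map X is)) \<le> K ^ length is \<and> 0 \<le> prod_list (map norm (map X is))"
        using faa_bounds(3)[OF that] X(2)
      proof (induction "is")
        case (Cons i js)
        then have "norm (X i) \<le> K" by auto
        then show ?case using Cons by (auto intro!: mult_mono order_trans[OF norm_ge_zero])
      qed simp
      moreover have "norm (G (length is) (X 0) (map X is)) \<le> M (length is) * prod_list (map norm (map X is))"
        using faa_bounds(1,2)[OF that] k X(1) by (intro M) auto
      ultimately show ?thesis
        by (smt (verit, ccfv_threshold) mult_mono abs_ge_self abs_ge_zero)
    qed
    then have "norm (\<Sum>is\<leftarrow>L. G (length is) (X 0) (map X is)) \<le> (\<Sum>is\<leftarrow>L. \<bar>M (length is)\<bar> * K ^ length is)"
      if "set L \<subseteq> set (faa k)" for L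
      using that by (induction L) (auto intro: order_trans[OF norm_triangle_ineq add_mono])
    then show ?thesis by (simp add: F_def)
  qed
  then show ?thesis using that by blast
qed

text \<open>The chain rule along a segment and the mean value inequality. A strip around a curve
  need not be convex, so one constant is given for all its convex subsets, balls in
  particular.\<close>

lemma g_lipschitz:
  assumes m: "m \<ge> 1"
  obtains L where "L \<ge> 0" "\<And>C x y. convex C \<Longrightarrow> C \<subseteq> S \<Longrightarrow> x \<in> C \<Longrightarrow> y \<in> C \<Longrightarrow> norm (g x - g y) \<le> L * norm (x - y)"
proof -
  obtain M where M0: "\<forall>x\<in>S. \<forall>vs. length vs = 1 \<longrightarrow>
      (\<forall>i<1. linear (\<lambda>w. G 1 x (vs[i := w]))) \<and> norm (G 1 x vs) \<le> M * prod_list (map norm vs)"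
    using G_bound[of 1] m by auto
  have M: "norm (G 1 x [v]) \<le> M * norm v" if "x \<in> S" for x v
    using M0[rule_format, OF that, of "[v]"] by simp
  have "norm (g y - g x) \<le> \<bar>M\<bar> * norm (y - x)" if C: "convex C" "C \<subseteq> S" "x \<in> C" "y \<in> C" for C x y
  proof -
    define W where "W i s = (if i = 0 then x + s *\<^sub>R (y - x) else if i = 1 then y - x else 0)" for i :: nat and s :: real
    have W0: "W 0 s \<in> S" if "s \<in> {0..1}" for s
    proof -
      have "W 0 s = (1 - s) *\<^sub>R x + s *\<^sub>R y" by (simp add: W_def algebra_simps)
      then show ?thesis using convexD[OF C(1) C(3,4), of "1 - s" s] that C(2) by auto
    qed
    have W: "(W i has_vector_derivative W (Suc i) s) (at s within {0..1})" for i s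
      unfolding W_def by (cases i) (auto intro!: derivative_eq_intros simp: has_vector_derivative_def)
    have "norm (F 0 (\<lambda>i. W i 1) - F 0 (\<lambda>i. W i 0)) \<le> (\<bar>M\<bar> * norm (y - x)) * norm (1 - 0 :: real)"
    proof (rule vector_derivative_bound[where S = "{0..1}"])
      fix s :: real assume s: "s \<in> {0..1}"
      show "((\<lambda>s. F 0 (\<lambda>i. W i s)) has_vector_derivative F (Suc 0) (\<lambda>i. W i s)) (at s within {0..1})"
        by (rule F_deriv) (use m W W0 s in auto)
      have "F (Suc 0) (\<lambda>i. W i s) = G 1 (W 0 s) [y - x]"
        by (simp add: F_def next_terms_def) (simp add: W_def)
      then show "norm (F (Suc 0) (\<lambda>i. W i s)) \<le> \<bar>M\<bar> * norm (y - x)"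
        using M[OF W0[OF s], of "y - x"] by (smt (verit) mult_right_mono norm_ge_zero)
    qed auto
    moreover have "F 0 (\<lambda>i. W i 1) = g (W 0 1)" "F 0 (\<lambda>i. W i 0) = g (W 0 0)"
      by (rule F_0, simp add: W0)+
    moreover have "W 0 1 = y" "W 0 0 = x"
      by (simp_all add: W_def)
    ultimately show ?thesis by simp
  qed
  then show ?thesis using that[of "\<bar>M\<bar>"] by simp
qed

end

section \<open>Lagrange interpolation identities\<close>

text \<open>Interpolation at two nodes reproduces the monomials x^p with p \<le> 1. Here x^p is
  replaced by an abstract vector \<open>X (p + 2)\<close>, and \<open>N b\<close> is the image of
  the Lagrange numerator x - b.\<close>

lemma lagrange_two:
  fixes a b :: real and X :: "nat \<Rightarrow> 'v::real_vector"
  assumes "a \<noteq> b"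
  defines "N \<equiv> \<lambda>b. - b *\<^sub>R X 2 + X 3"
  shows "p \<le> 1 \<Longrightarrow> (a ^ p / (a - b)) *\<^sub>R N b + (b ^ p / (b - a)) *\<^sub>R N a = X (Suc (Suc p))"
proof -
  define A where "A = 1 / (a - b)"
  have A: "A * (a - b) = 1" using assms(1) by (simp add: A_def)
  have *: "1 / (a - b) = A" "a / (a - b) = a * A" "1 / (b - a) = - A" "b / (b - a) = - (b * A)"
    using assms(1) by (simp_all add: A_def divide_simps) (simp add: algebra_simps)
  have "A *\<^sub>R N b + (- A) *\<^sub>R N a = (A * (a - b)) *\<^sub>R X 2"
    unfolding N_def by (simp add: algebra_simps)
  then have 1: "(1 / (a - b)) *\<^sub>R N b + (1 / (b - a)) *\<^sub>R N a = X 2"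
    unfolding * A by simp
  have "(a * A) *\<^sub>R N b + (- (b * A)) *\<^sub>R N a = (A * (a - b)) *\<^sub>R X 3"
    unfolding N_def by (simp add: algebra_simps)
  then have 2: "(a / (a - b)) *\<^sub>R N b + (b / (b - a)) *\<^sub>R N a = X 3"
    unfolding * A by simp
  have nums: "Suc (Suc 0) = 2" "Suc (Suc 1) = 3" by auto
  assume "p \<le> 1"
  then consider "p = 0" | "p = 1" by linarith
  then show "(a ^ p / (a - b)) *\<^sub>R N b + (b ^ p / (b - a)) *\<^sub>R N a = X (Suc (Suc p))"
    by cases (simp_all only: power_0 power_one_right 1 2 nums)
qed

text \<open>These are the divided differences of 1, x and x^2 at three points. Over the common
  denominator D they become polynomial identities.\<close>

lemma lagrange_moments_three:
  fixes a b c :: real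
  assumes "a \<noteq> b" "a \<noteq> c" "b \<noteq> c"
  defines "A \<equiv> 1 / ((a - b) * (a - c))" and "B \<equiv> 1 / ((b - a) * (b - c))" and "C \<equiv> 1 / ((c - a) * (c - b))"
  shows "A + B + C = 0" "a * A + b * B + c * C = 0" "a\<^sup>2 * A + b\<^sup>2 * B + c\<^sup>2 * C = 1"
proof -
  define D where "D = 1 / ((a - b) * (a - c) * (b - c))"
  have *: "A = (b - c) * D" "B = (c - a) * D" "C = (a - b) * D"
    using assms(1-3) by (simp_all add: D_def A_def B_def C_def divide_simps) (simp_all add: algebra_simps)
  have D: "(a - b) * (a - c) * (b - c) * D = 1"
    using assms by (simp add: D_def)
  show "A + B + C = 0" unfolding * by algebra
  show "a * A + b * B + c * C = 0" unfolding * by algebra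
  show "a\<^sup>2 * A + b\<^sup>2 * B + c\<^sup>2 * C = 1" unfolding * using D by algebra
qed

lemma lagrange_moments_four:
  fixes a b c d :: real
  assumes "a \<noteq> b" "a \<noteq> c" "a \<noteq> d" "b \<noteq> c" "b \<noteq> d" "c \<noteq> d"
  defines "A \<equiv> 1 / ((a - b) * (a - c) * (a - d))" and "B \<equiv> 1 / ((b - a) * (b - c) * (b - d))"
    and "C \<equiv> 1 / ((c - a) * (c - b) * (c - d))" and "E \<equiv> 1 / ((d - a) * (d - b) * (d - c))"
  shows "A + B + C + E = 0" "a * A + b * B + c * C + d * E = 0"
    "a\<^sup>2 * A + b\<^sup>2 * B + c\<^sup>2 * C + d\<^sup>2 * E = 0" "a ^ 3 * A + b ^ 3 * B + c ^ 3 * C + d ^ 3 * E = 1"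
proof -
  define D where "D = 1 / ((a - b) * (a - c) * (a - d) * (b - c) * (b - d) * (c - d))"
  have *: "A = (b - c) * (b - d) * (c - d) * D" "B = - ((a - c) * (a - d) * (c - d) * D)"
    "C = (a - b) * (a - d) * (b - d) * D" "E = - ((a - b) * (a - c) * (b - c) * D)"
    using assms(1-6) by (simp_all add: D_def A_def B_def C_def E_def divide_simps) (simp_all add: algebra_simps)
  have D: "(a - b) * (a - c) * (a - d) * (b - c) * (b - d) * (c - d) * D = 1"
    using assms by (simp add: D_def)
  show "A + B + C + E = 0" unfolding * by algebra
  show "a * A + b * B + c * C + d * E = 0" unfolding * by algebra
  show "a\<^sup>2 * A + b\<^sup>2 * B + c\<^sup>2 * C + d\<^sup>2 * E = 0" unfolding * by algebra
  show "a ^ 3 * A + b ^ 3 * B + c ^ 3 * C + d ^ 3 * E = 1" unfolding * using D by algebra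
qed

lemma lagrange_three:
  fixes a b c :: real and X :: "nat \<Rightarrow> 'v::real_vector"
  assumes "a \<noteq> b" "a \<noteq> c" "b \<noteq> c"
  defines "N \<equiv> \<lambda>k l. (k * l) *\<^sub>R X 2 - (k + l) *\<^sub>R X 3 + X 4"
  defines "L \<equiv> \<lambda>p. (a ^ p / ((a - b) * (a - c))) *\<^sub>R N b c + (b ^ p / ((b - a) * (b - c))) *\<^sub>R N a c
      + (c ^ p / ((c - a) * (c - b))) *\<^sub>R N a b"
  shows "p \<le> 2 \<Longrightarrow> L p = X (Suc (Suc p))"
proof -
  define A where "A = 1 / ((a - b) * (a - c))"
  define B where "B = 1 / ((b - a) * (b - c))"
  define C where "C = 1 / ((c - a) * (c - b))"
  note M = lagrange_moments_three[OF assms(1-3), folded A_def B_def C_def]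
  have L: "L p = (a ^ p * A * (b * c) + b ^ p * B * (a * c) + c ^ p * C * (a * b)) *\<^sub>R X 2
     - (a ^ p * A * (b + c) + b ^ p * B * (a + c) + c ^ p * C * (a + b)) *\<^sub>R X 3
     + (a ^ p * A + b ^ p * B + c ^ p * C) *\<^sub>R X 4" for p
  proof -
    have "L p = (a ^ p * A) *\<^sub>R N b c + (b ^ p * B) *\<^sub>R N a c + (c ^ p * C) *\<^sub>R N a b"
      unfolding L_def A_def B_def C_def by simp
    then show ?thesis unfolding N_def by (simp add: algebra_simps)
  qed
  have "A * (b * c) + B * (a * c) + C * (a * b) = 1" "A * (b + c) + B * (a + c) + C * (a + b) = 0"
    using M by algebra+
  then have 0: "L 0 = X 2" unfolding L using M by simp
  have "a * A * (b * c) + b * B * (a * c) + c * C * (a * b) = 0"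
    "a * A * (b + c) + b * B * (a + c) + c * C * (a + b) = -1"
    using M by algebra+
  then have 1: "L 1 = X 3" unfolding L using M by simp
  have "a\<^sup>2 * A * (b * c) + b\<^sup>2 * B * (a * c) + c\<^sup>2 * C * (a * b) = 0"
    "a\<^sup>2 * A * (b + c) + b\<^sup>2 * B * (a + c) + c\<^sup>2 * C * (a + b) = 0"
    using M by algebra+
  then have 2: "L 2 = X 4" unfolding L using M by simp
  have nums: "Suc (Suc 0) = 2" "Suc (Suc 1) = 3" "Suc (Suc 2) = 4" by auto
  assume "p \<le> 2"
  then consider "p = 0" | "p = 1" | "p = 2" by linarith
  then show "L p = X (Suc (Suc p))"
    by cases (simp_all only: 0 1 2 nums)
qed

text \<open>The first part is exactness of interpolation for degree at most 3. The second is the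
  interpolant of x^4, namely its remainder modulo the node polynomial (x - a) (x - b) (x - c) (x -
  d).\<close>

lemma lagrange_four:
  fixes a b c d :: real and X :: "nat \<Rightarrow> 'v::real_vector"
  assumes "a \<noteq> b" "a \<noteq> c" "a \<noteq> d" "b \<noteq> c" "b \<noteq> d" "c \<noteq> d"
  defines "N \<equiv> \<lambda>d k l. - (d * k * l) *\<^sub>R X 2 + (d * k + d * l + k * l) *\<^sub>R X 3 - (d + k + l) *\<^sub>R X 4 + X 5"
  defines "L \<equiv> \<lambda>p. (a ^ p / ((a - b) * (a - c) * (a - d))) *\<^sub>R N b c d
      + (b ^ p / ((b - a) * (b - c) * (b - d))) *\<^sub>R N a c d
      + (c ^ p / ((c - a) * (c - b) * (c - d))) *\<^sub>R N a b d
      + (d ^ p / ((d - a) * (d - b) * (d - c))) *\<^sub>R N a b c"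
  shows "p \<le> 3 \<Longrightarrow> L p = X (Suc (Suc p))"
    "L 4 = - (a * b * c * d) *\<^sub>R X 2 + (a * b * c + a * b * d + a * c * d + b * c * d) *\<^sub>R X 3
      - (a * b + a * c + a * d + b * c + b * d + c * d) *\<^sub>R X 4 + (a + b + c + d) *\<^sub>R X 5"
proof -
  define A where "A = 1 / ((a - b) * (a - c) * (a - d))"
  define B where "B = 1 / ((b - a) * (b - c) * (b - d))"
  define C where "C = 1 / ((c - a) * (c - b) * (c - d))"
  define E where "E = 1 / ((d - a) * (d - b) * (d - c))"
  note M = lagrange_moments_four[OF assms(1-6), folded A_def B_def C_def E_def]
  define M2 where "M2 p = a ^ p * A * (b * c * d) + b ^ p * B * (a * c * d) + c ^ p * C * (a * b * d) + d ^ p * E * (a * b * c)" for p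
  define M3 where "M3 p = a ^ p * A * (b * c + b * d + c * d) + b ^ p * B * (a * c + a * d + c * d)
     + c ^ p * C * (a * b + a * d + b * d) + d ^ p * E * (a * b + a * c + b * c)" for p
  define M4 where "M4 p = a ^ p * A * (b + c + d) + b ^ p * B * (a + c + d) + c ^ p * C * (a + b + d) + d ^ p * E * (a + b + c)" for p
  define M5 where "M5 p = a ^ p * A + b ^ p * B + c ^ p * C + d ^ p * E" for p
  have L: "L p = - M2 p *\<^sub>R X 2 + M3 p *\<^sub>R X 3 - M4 p *\<^sub>R X 4 + M5 p *\<^sub>R X 5" for p
  proof -
    have "L p = (a ^ p * A) *\<^sub>R N b c d + (b ^ p * B) *\<^sub>R N a c d + (c ^ p * C) *\<^sub>R N a b d + (d ^ p * E) *\<^sub>R N a b c"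
      unfolding L_def A_def B_def C_def E_def by simp
    then show ?thesis unfolding N_def M2_def M3_def M4_def M5_def by (simp add: algebra_simps)
  qed
  let ?s1 = "a + b + c + d" and ?s2 = "a * b + a * c + a * d + b * c + b * d + c * d"
  let ?s3 = "a * b * c + a * b * d + a * c * d + b * c * d" and ?s4 = "a * b * c * d"
  have M5: "M5 0 = 0" "M5 1 = 0" "M5 2 = 0" "M5 3 = 1"
    using M by (simp_all add: M5_def)
  \<comment> \<open>Each node is a root of the node polynomial, whose coefficients are the
    elementary symmetric functions up to sign.\<close>
  have M5_4: "M5 4 = ?s1 * M5 3 - ?s2 * M5 2 + ?s3 * M5 1 - ?s4 * M5 0"
    unfolding M5_def power_0 power_one_right by algebra
  \<comment> \<open>For a node x, the symmetric functions of the other three arise by removing x: e1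
    = s1 - x, e2 = s2 - x e1, e3 = s3 - x e2 and x e3 = s4. In this way all coefficients reduce to
    the power moments \<open>M5\<close>.\<close>
  have M4: "M4 p = ?s1 * M5 p - M5 (Suc p)" for p
    unfolding M4_def M5_def power_Suc by algebra
  have M3: "M3 p = ?s2 * M5 p - M4 (Suc p)" for p
    unfolding M3_def M4_def M5_def power_Suc by algebra
  have M2: "M2 p = ?s3 * M5 p - M3 (Suc p)" for p
    unfolding M2_def M3_def M5_def power_Suc by algebra
  have M2': "M2 (Suc p) = ?s4 * M5 p" for p
    unfolding M2_def M5_def power_Suc by algebra
  have S: "Suc 0 = 1" "Suc 1 = 2" "Suc 2 = 3" "Suc 3 = 4" by auto
  have M4v: "M4 0 = 0" "M4 1 = 0" "M4 2 = -1" "M4 3 = 0"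
    using M5 M5_4 M4[of 0, unfolded S] M4[of 1, unfolded S] M4[of 2, unfolded S] M4[of 3, unfolded S] by simp_all
  have M2v: "M2 1 = 0" "M2 2 = 0" "M2 3 = 0" "M2 4 = ?s4"
    using M5 M2'[of 0, unfolded S] M2'[of 1, unfolded S] M2'[of 2, unfolded S] M2'[of 3, unfolded S] by simp_all
  have M3v: "M3 0 = 0" "M3 1 = 1" "M3 2 = 0" "M3 3 = 0" "M3 4 = ?s3"
    using M3[of 0, unfolded S] M3[of 1, unfolded S] M3[of 2, unfolded S] M2[of 2, unfolded S] M2[of 3, unfolded S] M4v M5 M2v by simp_all
  have M20: "M2 0 = -1"
    using M2[of 0, unfolded S] M3v M5 by simp
  have "M3 3 = ?s2 * M5 3 - M4 4" using M3[of 3] by simp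
  then have M44: "M4 4 = ?s2" using M3v M5 by simp
  have *: "L 0 = X 2" "L 1 = X 3" "L 2 = X 4" "L 3 = X 5"
    unfolding L using M20 M2v M3v M4v M5 by simp_all
  have nums: "Suc (Suc 0) = 2" "Suc (Suc 1) = 3" "Suc (Suc 2) = 4" "Suc (Suc 3) = 5" by auto
  show "L p = X (Suc (Suc p))" if le: "p \<le> 3"
  proof -
    consider "p = 0" | "p = 1" | "p = 2" | "p = 3" using le by linarith
    then show ?thesis by cases (simp_all only: * nums)
  qed
  show "L 4 = - ?s4 *\<^sub>R X 2 + ?s3 *\<^sub>R X 3 - ?s2 *\<^sub>R X 4 + ?s1 *\<^sub>R X 5"
    unfolding L M44 M2v(4) M3v(5) M5_4 M5 by simp
qed

text \<open>The factor x in the denominator comes from the interpolation node 0. Cancelling it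
  lowers the power by one and leaves Lagrange weights at the remaining nodes.\<close>

lemma scale_div: "x \<noteq> 0 \<Longrightarrow> x ^ Suc p *\<^sub>R (N /\<^sub>R (x * y)) = (x ^ p / y) *\<^sub>R (N :: 'v::real_vector)" for x y :: real
  by (simp add: field_simps)

section \<open>The coefficients\<close>

locale exprk_nodes =
  fixes c :: "nat \<Rightarrow> real"
  assumes c_pos: "i \<in> {2..15} \<Longrightarrow> 0 < c i"
    and c34: "c 3 \<noteq> c 4"
    and inj3: "inj_on c {5..7}"
    and inj4: "inj_on c {8..11}"
    and inj5: "inj_on c {12..15}"
begin

abbreviation "a \<equiv> ExpRK6s15_a c"
abbreviation "b \<equiv> ExpRK6s15_b c"

text \<open>Up to a change of variables this is the integral of e^{(r - x) z} x^{q-1} over [0, r].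
  In this normalisation the coefficients of the method are Lagrange weights free of factorials and
  powers of the node.\<close>

definition Y :: "(nat \<Rightarrow> real \<Rightarrow> 'v::real_vector) \<Rightarrow> real \<Rightarrow> nat \<Rightarrow> 'v" where
  "Y \<phi> r q = (fact (q - 1) * r ^ q) *\<^sub>R \<phi> q r"

lemma sum_restrict:
  fixes f :: "nat \<Rightarrow> 'v::real_vector"
  assumes "finite A" "G \<subseteq> A" "\<And>j. j \<in> A \<Longrightarrow> j \<notin> G \<Longrightarrow> f j = 0"
  shows "sum f A = sum f G"
  using assms by (intro sum.mono_neutral_right) auto

text \<open>Interpolation at \<open>c 8\<close>, ..., \<open>c 11\<close> and at 0 is exact up to
  degree 4, so \<psi> of order q + 1 vanishes at these stages. Stating it for arbitrary \<phi> lets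
  one identity serve for matrices and for semigroups.\<close>

lemma a_moments_5:
  assumes i: "i \<in> {12..15}" and q: "q \<in> {1..4}"
  shows "(\<Sum>j\<in>{2..<i}. (c j ^ q / fact q) *\<^sub>R a \<phi> i j) = (c i ^ Suc q) *\<^sub>R \<phi> (Suc q) (c i)"
proof -
  have nz: "c 8 \<noteq> 0" "c 9 \<noteq> 0" "c 10 \<noteq> 0" "c 11 \<noteq> 0"
    using c_pos[of 8] c_pos[of 9] c_pos[of 10] c_pos[of 11] by auto
  have ne: "c 8 \<noteq> c 9" "c 8 \<noteq> c 10" "c 8 \<noteq> c 11" "c 9 \<noteq> c 10" "c 9 \<noteq> c 11" "c 10 \<noteq> c 11"
    using inj4 by (auto dest: inj_onD)
  obtain p where p: "q = Suc p" using q by (cases q) auto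
  have "(\<Sum>j\<in>{2..<i}. (c j ^ q / fact q) *\<^sub>R a \<phi> i j) = (\<Sum>j\<in>{8,9,10,11}. (c j ^ q / fact q) *\<^sub>R a \<phi> i j)"
    by (rule sum_restrict) (use i in \<open>auto simp: ExpRK6s15_a_def\<close>)
  also have "\<dots> = (1 / fact q) *\<^sub>R (c 8 ^ q *\<^sub>R a_four c \<phi> i 8 9 10 11 + c 9 ^ q *\<^sub>R a_four c \<phi> i 9 8 10 11
      + c 10 ^ q *\<^sub>R a_four c \<phi> i 10 8 9 11 + c 11 ^ q *\<^sub>R a_four c \<phi> i 11 8 9 10)"
    using i by (simp add: ExpRK6s15_a_def algebra_simps)
  also have "\<dots> = (1 / fact q) *\<^sub>R Y \<phi> (c i) (Suc q)"
  proof -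
    have a4: "a_four c \<phi> i j d k l = (- (c d * c k * c l) *\<^sub>R Y \<phi> (c i) 2 + (c d * c k + c d * c l + c k * c l) *\<^sub>R Y \<phi> (c i) 3
       - (c d + c k + c l) *\<^sub>R Y \<phi> (c i) 4 + Y \<phi> (c i) 5) /\<^sub>R (c j * ((c j - c d) * (c j - c k) * (c j - c l)))" for j d k l
      unfolding a_four_def Y_def by (simp add: fact_numeral algebra_simps)
    have le: "p \<le> 3" using q p by auto
    show ?thesis
      unfolding a4 p scale_div[OF nz(1)] scale_div[OF nz(2)] scale_div[OF nz(3)] scale_div[OF nz(4)]
      by (simp only: lagrange_four(1)[OF ne le])
  qed
  also have "\<dots> = (c i ^ Suc q) *\<^sub>R \<phi> (Suc q) (c i)"
    by (simp add: Y_def)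
  finally show ?thesis .
qed

lemma a_moments_4:
  assumes i: "i \<in> {8..11}" and q: "q \<in> {1..3}"
  shows "(\<Sum>j\<in>{2..<i}. (c j ^ q / fact q) *\<^sub>R a \<phi> i j) = (c i ^ Suc q) *\<^sub>R \<phi> (Suc q) (c i)"
proof -
  have nz: "c 5 \<noteq> 0" "c 6 \<noteq> 0" "c 7 \<noteq> 0"
    using c_pos[of 5] c_pos[of 6] c_pos[of 7] by auto
  have ne: "c 5 \<noteq> c 6" "c 5 \<noteq> c 7" "c 6 \<noteq> c 7"
    using inj3 by (auto dest: inj_onD)
  obtain p where p: "q = Suc p" using q by (cases q) auto
  have "(\<Sum>j\<in>{2..<i}. (c j ^ q / fact q) *\<^sub>R a \<phi> i j) = (\<Sum>j\<in>{5,6,7}. (c j ^ q / fact q) *\<^sub>R a \<phi> i j)"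
    by (rule sum_restrict) (use i in \<open>auto simp: ExpRK6s15_a_def\<close>)
  also have "\<dots> = (1 / fact q) *\<^sub>R (c 5 ^ q *\<^sub>R a_three c \<phi> i 5 6 7 + c 6 ^ q *\<^sub>R a_three c \<phi> i 6 5 7
      + c 7 ^ q *\<^sub>R a_three c \<phi> i 7 5 6)"
    using i by (simp add: ExpRK6s15_a_def algebra_simps)
  also have "\<dots> = (1 / fact q) *\<^sub>R Y \<phi> (c i) (Suc q)"
  proof -
    have a3: "a_three c \<phi> i j k l = ((c k * c l) *\<^sub>R Y \<phi> (c i) 2 - (c k + c l) *\<^sub>R Y \<phi> (c i) 3
       + Y \<phi> (c i) 4) /\<^sub>R (c j * ((c j - c k) * (c j - c l)))" for j k l
      unfolding a_three_def Y_def by (simp add: fact_numeral algebra_simps)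
    have le: "p \<le> 2" using q p by auto
    show ?thesis
      unfolding a3 p scale_div[OF nz(1)] scale_div[OF nz(2)] scale_div[OF nz(3)]
      by (simp only: lagrange_three[OF ne le])
  qed
  also have "\<dots> = (c i ^ Suc q) *\<^sub>R \<phi> (Suc q) (c i)"
    by (simp add: Y_def)
  finally show ?thesis .
qed

lemma a_moments_3:
  assumes i: "i \<in> {5..7}" and q: "q \<in> {1..2}"
  shows "(\<Sum>j\<in>{2..<i}. (c j ^ q / fact q) *\<^sub>R a \<phi> i j) = (c i ^ Suc q) *\<^sub>R \<phi> (Suc q) (c i)"
proof -
  have nz: "c 3 \<noteq> 0" "c 4 \<noteq> 0"
    using c_pos[of 3] c_pos[of 4] by auto
  obtain p where p: "q = Suc p" using q by (cases q) auto
  have "(\<Sum>j\<in>{2..<i}. (c j ^ q / fact q) *\<^sub>R a \<phi> i j) = (\<Sum>j\<in>{3,4}. (c j ^ q / fact q) *\<^sub>R a \<phi> i j)"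
    by (rule sum_restrict) (use i in \<open>auto simp: ExpRK6s15_a_def\<close>)
  also have "\<dots> = (1 / fact q) *\<^sub>R (c 3 ^ q *\<^sub>R a_two c \<phi> i 3 4 + c 4 ^ q *\<^sub>R a_two c \<phi> i 4 3)"
    using i by (simp add: ExpRK6s15_a_def algebra_simps)
  also have "\<dots> = (1 / fact q) *\<^sub>R Y \<phi> (c i) (Suc q)"
  proof -
    have a2: "a_two c \<phi> i j k = (- c k *\<^sub>R Y \<phi> (c i) 2 + Y \<phi> (c i) 3) /\<^sub>R (c j * (c j - c k))" for j k
      unfolding a_two_def Y_def by (simp add: fact_numeral algebra_simps)
    have le: "p \<le> 1" using q p by auto
    show ?thesis
      unfolding a2 p scale_div[OF nz(1)] scale_div[OF nz(2)]
      by (simp only: lagrange_two[OF c34 le])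
  qed
  also have "\<dots> = (c i ^ Suc q) *\<^sub>R \<phi> (Suc q) (c i)"
    by (simp add: Y_def)
  finally show ?thesis .
qed

lemma a_moments_2:
  assumes i: "i \<in> {3,4}"
  shows "(\<Sum>j\<in>{2..<i}. (c j ^ 1 / fact 1) *\<^sub>R a \<phi> i j) = (c i ^ Suc 1) *\<^sub>R \<phi> (Suc 1) (c i)"
proof -
  have "(\<Sum>j\<in>{2..<i}. (c j ^ 1 / fact 1) *\<^sub>R a \<phi> i j) = (\<Sum>j\<in>{2}. (c j ^ 1 / fact 1) *\<^sub>R a \<phi> i j)"
    by (rule sum_restrict) (use i in \<open>auto simp: ExpRK6s15_a_def\<close>)
  then show ?thesis
    using i c_pos[of 2] by (auto simp: ExpRK6s15_a_def numeral_2_eq_2)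
qed

text \<open>Stops short of evaluating the interpolant, since the fifth moment uses the remainder of
  x^4 and the lower ones use exactness.\<close>

lemma b_moments_aux:
  assumes "q = Suc p"
  shows "(\<Sum>i\<in>{2..15}. (c i ^ q / fact q) *\<^sub>R b \<phi> i) = (1 / fact q) *\<^sub>R
    ((c 12 ^ p / ((c 12 - c 13) * (c 12 - c 14) * (c 12 - c 15))) *\<^sub>R
       (- (c 13 * c 14 * c 15) *\<^sub>R Y \<phi> 1 2 + (c 13 * c 14 + c 13 * c 15 + c 14 * c 15) *\<^sub>R Y \<phi> 1 3
        - (c 13 + c 14 + c 15) *\<^sub>R Y \<phi> 1 4 + Y \<phi> 1 5) +
     (c 13 ^ p / ((c 13 - c 12) * (c 13 - c 14) * (c 13 - c 15))) *\<^sub>R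
       (- (c 12 * c 14 * c 15) *\<^sub>R Y \<phi> 1 2 + (c 12 * c 14 + c 12 * c 15 + c 14 * c 15) *\<^sub>R Y \<phi> 1 3
        - (c 12 + c 14 + c 15) *\<^sub>R Y \<phi> 1 4 + Y \<phi> 1 5) +
     (c 14 ^ p / ((c 14 - c 12) * (c 14 - c 13) * (c 14 - c 15))) *\<^sub>R
       (- (c 12 * c 13 * c 15) *\<^sub>R Y \<phi> 1 2 + (c 12 * c 13 + c 12 * c 15 + c 13 * c 15) *\<^sub>R Y \<phi> 1 3
        - (c 12 + c 13 + c 15) *\<^sub>R Y \<phi> 1 4 + Y \<phi> 1 5) +
     (c 15 ^ p / ((c 15 - c 12) * (c 15 - c 13) * (c 15 - c 14))) *\<^sub>R
       (- (c 12 * c 13 * c 14) *\<^sub>R Y \<phi> 1 2 + (c 12 * c 13 + c 12 * c 14 + c 13 * c 14) *\<^sub>R Y \<phi> 1 3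
        - (c 12 + c 13 + c 14) *\<^sub>R Y \<phi> 1 4 + Y \<phi> 1 5))"
proof -
  have nz: "c 12 \<noteq> 0" "c 13 \<noteq> 0" "c 14 \<noteq> 0" "c 15 \<noteq> 0"
    using c_pos[of 12] c_pos[of 13] c_pos[of 14] c_pos[of 15] by auto
  have b4: "b_four c \<phi> j d k l = (- (c d * c k * c l) *\<^sub>R Y \<phi> 1 2 + (c d * c k + c d * c l + c k * c l) *\<^sub>R Y \<phi> 1 3
       - (c d + c k + c l) *\<^sub>R Y \<phi> 1 4 + Y \<phi> 1 5) /\<^sub>R (c j * ((c j - c d) * (c j - c k) * (c j - c l)))" for j d k l
    unfolding b_four_def Y_def by (simp add: fact_numeral algebra_simps)
  have "(\<Sum>i\<in>{2..15}. (c i ^ q / fact q) *\<^sub>R b \<phi> i) = (\<Sum>i\<in>{12,13,14,15}. (c i ^ q / fact q) *\<^sub>R b \<phi> i)"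
    by (rule sum_restrict) (auto simp: ExpRK6s15_b_def)
  also have "\<dots> = (1 / fact q) *\<^sub>R (c 12 ^ q *\<^sub>R b_four c \<phi> 12 13 14 15 + c 13 ^ q *\<^sub>R b_four c \<phi> 13 12 14 15
      + c 14 ^ q *\<^sub>R b_four c \<phi> 14 12 13 15 + c 15 ^ q *\<^sub>R b_four c \<phi> 15 12 13 14)"
    by (simp add: ExpRK6s15_b_def algebra_simps)
  finally show ?thesis
    unfolding b4 assms scale_div[OF nz(1)] scale_div[OF nz(2)] scale_div[OF nz(3)] scale_div[OF nz(4)] .
qed

lemma c_distinct_5:
  "c 12 \<noteq> c 13" "c 12 \<noteq> c 14" "c 12 \<noteq> c 15" "c 13 \<noteq> c 14" "c 13 \<noteq> c 15" "c 14 \<noteq> c 15"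
  using inj5 by (auto dest: inj_onD)

lemma b_moments:
  assumes q: "q \<in> {1..4}"
  shows "(\<Sum>i\<in>{2..15}. (c i ^ q / fact q) *\<^sub>R b \<phi> i) = \<phi> (Suc q) 1"
proof -
  obtain p where p: "q = Suc p" using q by (cases q) auto
  have le: "p \<le> 3" using q p by auto
  have "(\<Sum>i\<in>{2..15}. (c i ^ q / fact q) *\<^sub>R b \<phi> i) = (1 / fact q) *\<^sub>R Y \<phi> 1 (Suc q)"
    unfolding b_moments_aux[OF p] lagrange_four(1)[OF c_distinct_5 le] unfolding p ..
  then show ?thesis by (simp add: Y_def)
qed

text \<open>One degree beyond exactness: x^5 is replaced by x times the interpolant of x^4. At z = 0
  this turns into the polynomial condition on the last four nodes.\<close>

lemma b_moment_5:
  "(\<Sum>i\<in>{2..15}. (c i ^ 5 / fact 5) *\<^sub>R b \<phi> i) = (1 / 120) *\<^sub>R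
    (- (c 12 * c 13 * c 14 * c 15) *\<^sub>R \<phi> 2 1
     + (2 * (c 12 * c 13 * c 14 + c 12 * c 13 * c 15 + c 12 * c 14 * c 15 + c 13 * c 14 * c 15)) *\<^sub>R \<phi> 3 1
     - (6 * (c 12 * c 13 + c 12 * c 14 + c 12 * c 15 + c 13 * c 14 + c 13 * c 15 + c 14 * c 15)) *\<^sub>R \<phi> 4 1
     + (24 * (c 12 + c 13 + c 14 + c 15)) *\<^sub>R \<phi> 5 1)"
proof -
  have "(5::nat) = Suc 4" by simp
  then show ?thesis
    unfolding b_moments_aux[OF \<open>(5::nat) = Suc 4\<close>] lagrange_four(2)[OF c_distinct_5]
    by (simp add: Y_def fact_numeral algebra_simps)
qed


section \<open>The stiff order conditions\<close>

lemma a_eq_0: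
  "i \<in> {12..15} \<Longrightarrow> j \<notin> {8..11} \<Longrightarrow> a \<phi> i j = 0"
  "i \<in> {8..11} \<Longrightarrow> j \<notin> {5..7} \<Longrightarrow> a \<phi> i j = 0"
  "i \<in> {5..7} \<Longrightarrow> j \<notin> {3,4} \<Longrightarrow> a \<phi> i j = 0"
  by (auto simp: ExpRK6s15_a_def)

lemma b_eq_0: "i \<notin> {12..15} \<Longrightarrow> b \<phi> i = 0"
  by (auto simp: ExpRK6s15_b_def)

lemma a_zero [simp]: "a (\<lambda>k r. 0) i j = 0"
  by (simp add: ExpRK6s15_a_def a_two_def a_three_def a_four_def)

lemma b_zero [simp]: "b (\<lambda>k r. 0) i = 0"
  by (simp add: ExpRK6s15_b_def b_four_def)

text \<open>Apart from the pure quadrature conditions, each condition contains some \<psi> of order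
  q under m coefficients \<open>a\<close> with q + m \<le> 5. The block structure forces its stage
  into group 12..15, 8..11, 5..7 or 3,4 for m = 0, 1, 2, 3, and there \<psi> vanishes up to order 5
  - m. Only the values at 0 of the operators enter, which treats matrices and semigroups
  together.\<close>

lemma stiff_order_conditions:
  fixes E :: "real \<Rightarrow> 'a::banach \<Rightarrow> 'a"
  assumes E_0: "\<And>t. E t 0 = 0" and J_0: "J 0 = 0" and K_0: "K 0 = 0" and L_0: "L 0 = 0"
    and B_0: "\<And>w. B 0 w = 0"
    and n: "n \<in> {1..36} - {17}"
  shows "ExpRK6s15_condition c E J K L B n"
proof -
  let ?a = "ExpRK6s15_a_op c E" and ?b = "ExpRK6s15_b_op c E"
  let ?psi = "psi c ?a (phi_op E)"
  have phi_0: "phi_op E k r 0 = 0" for k r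
    by (simp add: phi_op_def E_0)
  have a_0: "?a i j 0 = 0" and b_0: "?b i 0 = 0" for i j
    by (simp_all add: ExpRK6s15_a_op_def ExpRK6s15_b_op_def phi_0)
  have psi5: "?psi q i v = 0" if "i \<in> {12..15}" "q \<in> {2..5}" for q i v
  proof -
    obtain p where p: "q = Suc p" using \<open>q \<in> {2..5}\<close> by (cases q) auto
    then have "p \<in> {1..4}" using that(2) by auto
    from a_moments_5[OF that(1) this, of "\<lambda>k r. phi_op E k r v"] show ?thesis
      by (simp add: psi_def ExpRK6s15_a_op_def p)
  qed
  have psi4: "?psi q i v = 0" if "i \<in> {8..11}" "q \<in> {2..4}" for q i v
  proof -
    obtain p where p: "q = Suc p" using \<open>q \<in> {2..4}\<close> by (cases q) auto
    then have "p \<in> {1..3}" using that(2) by auto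
    from a_moments_4[OF that(1) this, of "\<lambda>k r. phi_op E k r v"] show ?thesis
      by (simp add: psi_def ExpRK6s15_a_op_def p)
  qed
  have psi3: "?psi q i v = 0" if "i \<in> {5..7}" "q \<in> {2..3}" for q i v
  proof -
    obtain p where p: "q = Suc p" using \<open>q \<in> {2..3}\<close> by (cases q) auto
    then have "p \<in> {1..2}" using that(2) by auto
    from a_moments_3[OF that(1) this, of "\<lambda>k r. phi_op E k r v"] show ?thesis
      by (simp add: psi_def ExpRK6s15_a_op_def p)
  qed
  have psi2: "?psi 2 i v = 0" if "i \<in> {3,4}" for i v
    using a_moments_2[OF that, of "\<lambda>k r. phi_op E k r v"]
    by (simp add: psi_def ExpRK6s15_a_op_def numeral_2_eq_2)
  have sum_b: "(\<Sum>i\<in>{2..15}. r i *\<^sub>R ?b i (w i)) = 0" if "\<And>i. i \<in> {12..15} \<Longrightarrow> w i = 0" for w r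
  proof (rule sum.neutral, rule ballI)
    fix i
    show "r i *\<^sub>R ?b i (w i) = 0"
      using that b_0 by (cases "i \<in> {12..15}") (simp_all add: ExpRK6s15_b_op_def b_eq_0)
  qed
  have sum_a5: "(\<Sum>j\<in>{2..<i}. r j *\<^sub>R ?a i j (w j)) = 0"
    if "i \<in> {12..15}" "\<And>j. j \<in> {8..11} \<Longrightarrow> w j = 0" for i w r
  proof (rule sum.neutral, rule ballI)
    fix j
    show "r j *\<^sub>R ?a i j (w j) = 0"
      using that a_0 by (cases "j \<in> {8..11}") (simp_all add: ExpRK6s15_a_op_def a_eq_0(1)[OF that(1)])
  qed
  have sum_a4: "(\<Sum>j\<in>{2..<i}. r j *\<^sub>R ?a i j (w j)) = 0"
    if "i \<in> {8..11}" "\<And>j. j \<in> {5..7} \<Longrightarrow> w j = 0" for i w r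
  proof (rule sum.neutral, rule ballI)
    fix j
    show "r j *\<^sub>R ?a i j (w j) = 0"
      using that a_0 by (cases "j \<in> {5..7}") (simp_all add: ExpRK6s15_a_op_def a_eq_0(2)[OF that(1)])
  qed
  have sum_a3: "(\<Sum>j\<in>{2..<i}. r j *\<^sub>R ?a i j (w j)) = 0"
    if "i \<in> {5..7}" "\<And>j. j \<in> {3,4} \<Longrightarrow> w j = 0" for i w r
  proof (rule sum.neutral, rule ballI)
    fix j
    show "r j *\<^sub>R ?a i j (w j) = 0"
      using that a_0 by (cases "j \<in> {3,4}") (simp_all add: ExpRK6s15_a_op_def a_eq_0(3)[OF that(1)])
  qed
  have sum_b': "(\<Sum>i\<in>{2..15}. ?b i (w i)) = 0" if "\<And>i. i \<in> {12..15} \<Longrightarrow> w i = 0" for w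
    using sum_b[of w "\<lambda>_. 1"] that by simp
  have sum_a5': "(\<Sum>j\<in>{2..<i}. ?a i j (w j)) = 0" if "i \<in> {12..15}" "\<And>j. j \<in> {8..11} \<Longrightarrow> w j = 0" for i w
    using sum_a5[OF that(1), of w "\<lambda>_. 1"] that(2) by simp
  have sum_a4': "(\<Sum>j\<in>{2..<i}. ?a i j (w j)) = 0" if "i \<in> {8..11}" "\<And>j. j \<in> {5..7} \<Longrightarrow> w j = 0" for i w
    using sum_a4[OF that(1), of w "\<lambda>_. 1"] that(2) by simp
  have sum_a3': "(\<Sum>j\<in>{2..<i}. ?a i j (w j)) = 0" if "i \<in> {5..7}" "\<And>j. j \<in> {3,4} \<Longrightarrow> w j = 0" for i w
    using sum_a3[OF that(1), of w "\<lambda>_. 1"] that(2) by simp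
  have J0: "x = 0 \<Longrightarrow> J x = 0" and K0: "x = 0 \<Longrightarrow> K x = 0" and L0: "x = 0 \<Longrightarrow> L x = 0"
    and B0: "x = 0 \<Longrightarrow> B x y = 0" for x y
    using J_0 K_0 L_0 B_0 by simp_all
  have b: "(\<Sum>i\<in>{2..15}. (c i ^ q / fact q) *\<^sub>R ?b i v) = phi_op E (Suc q) 1 v" if "q \<in> {1..4}" for q v
    using b_moments[OF that, of "\<lambda>k r. phi_op E k r v"] by (simp add: ExpRK6s15_b_op_def)
  have b1: "(\<Sum>i\<in>{2..15}. c i *\<^sub>R ?b i v) = phi_op E 2 1 v" for v
    using b[of 1 v] by (simp add: numeral_2_eq_2)
  have b2: "(\<Sum>i\<in>{2..15}. (c i ^ 2 / fact 2) *\<^sub>R ?b i v) = phi_op E 3 1 v" for v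
    using b[of 2 v] by (simp add: eval_nat_numeral)
  have b3: "(\<Sum>i\<in>{2..15}. (c i ^ 3 / fact 3) *\<^sub>R ?b i v) = phi_op E 4 1 v" for v
    using b[of 3 v] by (simp add: eval_nat_numeral)
  have b4: "(\<Sum>i\<in>{2..15}. (c i ^ 4 / fact 4) *\<^sub>R ?b i v) = phi_op E 5 1 v" for v
    using b[of 4 v] by (simp add: eval_nat_numeral)
  have n17: "n \<noteq> 17" using n by simp
  \<comment> \<open>The quadrature conditions are \<open>b1\<close> to \<open>b4\<close>. In the
    others the proof descends through the nested sums, each descent passing to the preceding group,
    until a vanishing \<psi> is met.\<close>
  show ?thesis
    unfolding ExpRK6s15_condition_def stiff_order_condition_def Let_def
    by (intro conjI impI allI; (erule notE[OF n17] | (simp only: b1 b2 b3 b4; fail)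
      | (rule J0 K0 L0 B0 sum_b sum_b' | (rule sum_a5 sum_a5' sum_a4 sum_a4' sum_a3 sum_a3' psi2, assumption)
        | (rule psi5 psi4 psi3, assumption, simp; fail))+))
qed

end

section \<open>The method as a perturbation of the exact flow\<close>

text \<open>The coefficients are chosen before \<phi>, hence do not depend on the step size or on
  the vector; boundedness and domain properties of phi_k(sA) then pass to all coefficients of the
  method uniformly.\<close>

definition phi_comb :: "real \<Rightarrow> ((nat \<Rightarrow> real \<Rightarrow> 'v::real_vector) \<Rightarrow> 'v) \<Rightarrow> bool" where
  "phi_comb r f \<longleftrightarrow> (\<exists>\<alpha>. \<forall>\<phi>. f \<phi> = (\<Sum>k\<in>{2..5}. \<alpha> k *\<^sub>R \<phi> k r))"

lemma phi_combI: "(\<And>\<phi>. f \<phi> = (\<Sum>k\<in>{2..5}. \<alpha> k *\<^sub>R \<phi> k r)) \<Longrightarrow> phi_comb r f"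
  unfolding phi_comb_def by blast

lemma phi_comb_intros:
  fixes f g :: "(nat \<Rightarrow> real \<Rightarrow> 'v::real_vector) \<Rightarrow> 'v"
  shows "phi_comb r (\<lambda>\<phi>. 0 :: 'v)"
  "k \<in> {2..5} \<Longrightarrow> phi_comb r (\<lambda>\<phi> :: nat \<Rightarrow> real \<Rightarrow> 'v. \<phi> k r)"
  "phi_comb r f \<Longrightarrow> phi_comb r g \<Longrightarrow> phi_comb r (\<lambda>\<phi>. f \<phi> + g \<phi>)"
  "phi_comb r f \<Longrightarrow> phi_comb r g \<Longrightarrow> phi_comb r (\<lambda>\<phi>. f \<phi> - g \<phi>)"
  "phi_comb r f \<Longrightarrow> phi_comb r (\<lambda>\<phi>. x *\<^sub>R f \<phi>)"
proof -
  show "phi_comb r (\<lambda>\<phi>. 0 :: 'v)"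
    by (rule phi_combI[of _ "\<lambda>_. 0"]) simp
  show "phi_comb r (\<lambda>\<phi> :: nat \<Rightarrow> real \<Rightarrow> 'v. \<phi> k r)" if "k \<in> {2..5}"
  proof (rule phi_combI)
    fix \<phi> :: "nat \<Rightarrow> real \<Rightarrow> 'v"
    have "(\<Sum>l\<in>{2..5}. (if l = k then 1 else (0::real)) *\<^sub>R \<phi> l r) = (\<Sum>l\<in>{2..5}. if l = k then \<phi> l r else 0)"
      by (intro sum.cong) auto
    then show "\<phi> k r = (\<Sum>l\<in>{2..5}. (if l = k then 1 else (0::real)) *\<^sub>R \<phi> l r)"
      using that by (simp add: sum.delta)
  qed
  show "phi_comb r (\<lambda>\<phi>. f \<phi> + g \<phi>)" "phi_comb r (\<lambda>\<phi>. f \<phi> - g \<phi>)" if fg: "phi_comb r f" "phi_comb r g"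
  proof -
    obtain \<alpha> \<beta> where "\<And>\<phi>. f \<phi> = (\<Sum>k\<in>{2..5}. \<alpha> k *\<^sub>R \<phi> k r)" "\<And>\<phi>. g \<phi> = (\<Sum>k\<in>{2..5}. \<beta> k *\<^sub>R \<phi> k r)"
      using fg unfolding phi_comb_def by blast
    then have *: "f \<phi> + g \<phi> = (\<Sum>k\<in>{2..5}. (\<alpha> k + \<beta> k) *\<^sub>R \<phi> k r)"
      "f \<phi> - g \<phi> = (\<Sum>k\<in>{2..5}. (\<alpha> k - \<beta> k) *\<^sub>R \<phi> k r)" for \<phi>
      by (simp_all add: scaleR_add_left scaleR_diff_left sum.distrib sum_subtractf)
    show "phi_comb r (\<lambda>\<phi>. f \<phi> + g \<phi>)" "phi_comb r (\<lambda>\<phi>. f \<phi> - g \<phi>)"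
      by (rule phi_combI[OF *(1)], rule phi_combI[OF *(2)])
  qed
  show "phi_comb r (\<lambda>\<phi>. x *\<^sub>R f \<phi>)" if f: "phi_comb r f"
  proof -
    obtain \<alpha> where "\<And>\<phi>. f \<phi> = (\<Sum>k\<in>{2..5}. \<alpha> k *\<^sub>R \<phi> k r)"
      using f unfolding phi_comb_def by blast
    then have "x *\<^sub>R f \<phi> = (\<Sum>k\<in>{2..5}. (x * \<alpha> k) *\<^sub>R \<phi> k r)" for \<phi>
      by (simp add: scaleR_sum_right)
    then show ?thesis by (rule phi_combI)
  qed
qed

lemma phi_comb_if:
  "(Q \<Longrightarrow> phi_comb r f) \<Longrightarrow> (\<not> Q \<Longrightarrow> phi_comb r g) \<Longrightarrow> phi_comb r (\<lambda>\<phi>. if Q then f \<phi> else g \<phi>)"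
  by (cases Q) simp_all

lemma phi_comb_a: "phi_comb (c i) (\<lambda>\<phi>. ExpRK6s15_a c \<phi> i j)"
proof -
  note defs = a_two_def a_three_def a_four_def
  have "phi_comb (c i) (\<lambda>\<phi>. (c i ^ 2 / c 2) *\<^sub>R \<phi> 2 (c i))" "\<And>j k. phi_comb (c i) (\<lambda>\<phi>. a_two c \<phi> i j k)"
    "\<And>j k l. phi_comb (c i) (\<lambda>\<phi>. a_three c \<phi> i j k l)" "\<And>j d k l. phi_comb (c i) (\<lambda>\<phi>. a_four c \<phi> i j d k l)"
    unfolding defs by (intro phi_comb_intros; simp)+
  then show ?thesis
    unfolding ExpRK6s15_a_def by (intro phi_comb_if phi_comb_intros(1))
qed

lemma phi_comb_b: "phi_comb 1 (\<lambda>\<phi>. ExpRK6s15_b c \<phi> i)"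
proof -
  have "\<And>i d k l. phi_comb 1 (\<lambda>\<phi>. b_four c \<phi> i d k l)"
    unfolding b_four_def by (intro phi_comb_intros; simp)
  then show ?thesis
    unfolding ExpRK6s15_b_def by (intro phi_comb_if phi_comb_intros(1))
qed

context c0_semigroup
begin

lemma phi_comb_bounded_linear:
  fixes f :: "(nat \<Rightarrow> real \<Rightarrow> 'a) \<Rightarrow> 'a"
  assumes "phi_comb r f" "r \<ge> 0"
  shows "h \<ge> 0 \<Longrightarrow> bounded_linear (\<lambda>v. f (\<lambda>k r. P k (r * h) v))"
    and "\<exists>K\<ge>0. \<forall>h v. 0 \<le> h \<longrightarrow> h \<le> H \<longrightarrow> norm (f (\<lambda>k r. P k (r * h) v)) \<le> K * norm v"
proof -
  obtain \<alpha> where f: "\<And>\<phi>. f \<phi> = (\<Sum>k\<in>{2..5}. \<alpha> k *\<^sub>R \<phi> k r)"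
    using assms unfolding phi_comb_def by blast
  show "bounded_linear (\<lambda>v. f (\<lambda>k r. P k (r * h) v))" if "h \<ge> 0"
    unfolding f using assms that
    by (intro bounded_linear_sum bounded_linear_compose[OF bounded_linear_scaleR_right bounded_linear_P]) simp
  obtain M where M: "M \<ge> 1" "\<And>t. 0 \<le> t \<Longrightarrow> t \<le> r * H \<Longrightarrow> norm (T t) \<le> M"
    using T_bounded by blast
  have "norm (f (\<lambda>k r. P k (r * h) v)) \<le> (\<Sum>k\<in>{2..5}. \<bar>\<alpha> k\<bar> * M) * norm v" if "0 \<le> h" "h \<le> H" for h v
  proof -
    have "r * h \<le> r * H" using that assms by (intro mult_left_mono) auto
    then have "norm (\<alpha> k *\<^sub>R P k (r * h) v) \<le> \<bar>\<alpha> k\<bar> * M * norm v" for k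
      using norm_P_le[of "r * h" "r * H" M k v] M that assms
      by (simp add: mult.assoc mult_left_mono)
    then show ?thesis
      unfolding f sum_distrib_right by (intro sum_norm_le) auto
  qed
  moreover have "(\<Sum>k\<in>{2..5}. \<bar>\<alpha> k\<bar> * M) \<ge> 0" using M by (intro sum_nonneg) auto
  ultimately show "\<exists>K\<ge>0. \<forall>h v. 0 \<le> h \<longrightarrow> h \<le> H \<longrightarrow> norm (f (\<lambda>k r. P k (r * h) v)) \<le> K * norm v"
    by blast
qed

end

lemma finite_uniform_bound:
  assumes "finite A" "\<And>x. x \<in> A \<Longrightarrow> \<exists>K\<ge>0::real. \<forall>y. Q y \<longrightarrow> f x y \<le> K * g y" and "\<And>y. 0 \<le> g y"
  shows "\<exists>K\<ge>0. \<forall>x\<in>A. \<forall>y. Q y \<longrightarrow> f x y \<le> K * g y"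
proof -
  have "\<forall>x\<in>A. \<exists>K\<ge>0. \<forall>y. Q y \<longrightarrow> f x y \<le> K * g y" using assms(2) by blast
  from bchoice[OF this] obtain K where K: "\<And>x. x \<in> A \<Longrightarrow> K x \<ge> 0" "\<And>x y. x \<in> A \<Longrightarrow> Q y \<Longrightarrow> f x y \<le> K x * g y"
    by blast
  have "f x y \<le> (\<Sum>x\<in>A. K x) * g y" if "x \<in> A" "Q y" for x y
  proof -
    have "K x \<le> (\<Sum>x\<in>A. K x)" using that assms(1) K by (intro member_le_sum) auto
    then show ?thesis using K(2)[OF that] mult_right_mono[OF _ assms(3)] order_trans by blast
  qed
  moreover have "(\<Sum>x\<in>A. K x) \<ge> 0" using K by (intro sum_nonneg) auto
  ultimately show ?thesis by blast
qed

locale exprk_semigroup = exprk_nodes c + analytic_c0_semigroup T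
  for c :: "nat \<Rightarrow> real" and T :: "real \<Rightarrow> 'a::banach \<Rightarrow>\<^sub>L 'a" +
  assumes weak_17: "1/5 * (c 12 + c 13 + c 14 + c 15)
     - 1/4 * (c 12 * c 13 + c 12 * c 14 + c 12 * c 15 + c 13 * c 14 + c 13 * c 15 + c 14 * c 15)
     + 1/3 * (c 12 * c 13 * c 14 + c 12 * c 13 * c 15 + c 12 * c 14 * c 15 + c 13 * c 14 * c 15)
     - 1/2 * (c 12 * c 13 * c 14 * c 15) = 1/6"
begin

definition aop :: "real \<Rightarrow> nat \<Rightarrow> nat \<Rightarrow> 'a \<Rightarrow> 'a" where
  "aop h i j v = a (\<lambda>k r. P k (r * h) v) i j"

definition bop :: "real \<Rightarrow> nat \<Rightarrow> 'a \<Rightarrow> 'a" where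
  "bop h i v = b (\<lambda>k r. P k (r * h) v) i"

lemma ExpRK6s15_a_op_eq: "ExpRK6s15_a_op c (exp_scaled T h) = aop h"
  by (intro ext) (simp add: ExpRK6s15_a_op_def aop_def phi_op_exp_scaled)

lemma ExpRK6s15_b_op_eq: "ExpRK6s15_b_op c (exp_scaled T h) = bop h"
  by (intro ext) (simp add: ExpRK6s15_b_op_def bop_def phi_op_exp_scaled)

lemma aop_bounded_linear: "h \<ge> 0 \<Longrightarrow> i \<in> {2..15} \<Longrightarrow> bounded_linear (aop h i j)"
  unfolding aop_def[abs_def] using phi_comb_bounded_linear(1)[OF phi_comb_a] c_pos[of i] by simp

lemma bop_bounded_linear: "h \<ge> 0 \<Longrightarrow> bounded_linear (bop h i)"
  unfolding bop_def[abs_def] using phi_comb_bounded_linear(1)[OF phi_comb_b] by simp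

lemma ab_bound:
  obtains K where "K \<ge> 0" "\<And>h i j v. 0 \<le> h \<Longrightarrow> h \<le> H \<Longrightarrow> i \<in> {2..15} \<Longrightarrow> j \<in> {2..15} \<Longrightarrow> norm (aop h i j v) \<le> K * norm v"
    "\<And>h i v. 0 \<le> h \<Longrightarrow> h \<le> H \<Longrightarrow> i \<in> {2..15} \<Longrightarrow> norm (bop h i v) \<le> K * norm v"
proof -
  \<comment> \<open>Step size and vector are paired, so that a single constant is obtained for all
    of them.\<close>
  have "\<exists>K\<ge>0. \<forall>x\<in>{2..15} \<times> {2..15}. \<forall>y. 0 \<le> fst y \<and> fst y \<le> H \<longrightarrow> norm (aop (fst y) (fst x) (snd x) (snd y)) \<le> K * norm (snd y)"
  proof (rule finite_uniform_bound)
    fix x :: "nat \<times> nat" assume "x \<in> {2..15} \<times> {2..15}"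
    then have "0 \<le> c (fst x)" using c_pos[of "fst x"] by (auto intro: less_imp_le)
    from phi_comb_bounded_linear(2)[OF phi_comb_a[of c "fst x" "snd x"] this, of H]
    show "\<exists>K\<ge>0. \<forall>y. 0 \<le> fst y \<and> fst y \<le> H \<longrightarrow> norm (aop (fst y) (fst x) (snd x) (snd y)) \<le> K * norm (snd y)"
      unfolding aop_def by auto
  qed auto
  then obtain K1 where K1: "K1 \<ge> 0" "\<And>x y. x \<in> {2..15} \<times> {2..15} \<Longrightarrow> 0 \<le> fst y \<and> fst y \<le> H \<Longrightarrow>
      norm (aop (fst y) (fst x) (snd x) (snd y)) \<le> K1 * norm (snd y)"
    by blast
  have "\<exists>K\<ge>0. \<forall>i\<in>{2..15}. \<forall>y. 0 \<le> fst y \<and> fst y \<le> H \<longrightarrow> norm (bop (fst y) i (snd y)) \<le> K * norm (snd y)"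
  proof (rule finite_uniform_bound)
    fix i :: nat
    from phi_comb_bounded_linear(2)[OF phi_comb_b[of c i], of H]
    show "\<exists>K\<ge>0. \<forall>y. 0 \<le> fst y \<and> fst y \<le> H \<longrightarrow> norm (bop (fst y) i (snd y)) \<le> K * norm (snd y)"
      unfolding bop_def by auto
  qed auto
  then obtain K2 where K2: "K2 \<ge> 0" "\<And>i y. i \<in> {2..15} \<Longrightarrow> 0 \<le> fst y \<and> fst y \<le> H \<Longrightarrow>
      norm (bop (fst y) i (snd y)) \<le> K2 * norm (snd y)"
    by blast
  show ?thesis
  proof (rule that[of "max K1 K2"])
    show "norm (aop h i j v) \<le> max K1 K2 * norm v" if "0 \<le> h" "h \<le> H" "i \<in> {2..15}" "j \<in> {2..15}" for h i j v
      using K1(2)[of "(i, j)" "(h, v)"] mult_right_mono[OF max.cobounded1[of K1 K2] norm_ge_zero[of v]] that by simp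
    show "norm (bop h i v) \<le> max K1 K2 * norm v" if "0 \<le> h" "h \<le> H" "i \<in> {2..15}" for h i v
      using K2(2)[of i "(h, v)"] mult_right_mono[OF max.cobounded2[of K2 K1] norm_ge_zero[of v]] that by simp
  qed (use K1 in auto)
qed

section \<open>Parabolic smoothing\<close>

text \<open>Each term is the integral over \<theta> of the weight times (T ((j + 1 - \<theta>) h) -
  T (j h)) x. With the sum moved under the integral, the bound on shifted sums applies uniformly in
  \<theta>.\<close>

lemma smoothed_sums_bounded:
  obtains C where "C \<ge> 0" "\<And>h n k x. 0 < h \<Longrightarrow> real n * h \<le> R \<Longrightarrow> k \<ge> 1 \<Longrightarrow>
    norm (\<Sum>j<n. T (real j * h) (P k h x - (1 / fact k) *\<^sub>R x)) \<le> C * norm x"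
proof -
  obtain C where C: "C \<ge> 0" "\<And>h n \<theta>. 0 < h \<Longrightarrow> real n * h \<le> R \<Longrightarrow> 0 \<le> \<theta> \<Longrightarrow> \<theta> \<le> 1 \<Longrightarrow>
      norm (\<Sum>j<n. T ((real j + \<theta>) * h) - T (real j * h)) \<le> C"
    using shifted_sums_bounded by blast
  have "norm (\<Sum>j<n. T (real j * h) (P k h x - (1 / fact k) *\<^sub>R x)) \<le> C * norm x"
    if h: "0 < h" "real n * h \<le> R" and k: "k \<ge> 1" for h n k x
  proof -
    let ?w = "\<lambda>\<theta>::real. \<theta> ^ (k - 1) / fact (k - 1)"
    have hi: "((\<lambda>\<theta>. ?w \<theta> *\<^sub>R T ((1 - \<theta>) * h) x - ?w \<theta> *\<^sub>R x) has_integral (P k h x - (1 / fact k) *\<^sub>R x)) {0..1}"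
      unfolding P_def
      by (intro has_integral_diff integrable_integral P_integrand_integrable has_integral_scaleR_left weight_integral[OF k]) (use h in simp)
    have hs: "((\<lambda>\<theta>. \<Sum>j<n. T (real j * h) (?w \<theta> *\<^sub>R T ((1 - \<theta>) * h) x - ?w \<theta> *\<^sub>R x)) has_integral
        (\<Sum>j<n. T (real j * h) (P k h x - (1 / fact k) *\<^sub>R x))) {0..1}"
      using has_integral_linear[OF hi blinfun.bounded_linear_right] by (intro has_integral_sum) (auto simp: o_def)
    have bd: "norm (\<Sum>j<n. T (real j * h) (?w \<theta> *\<^sub>R T ((1 - \<theta>) * h) x - ?w \<theta> *\<^sub>R x)) \<le> C * norm x"
      if \<theta>: "\<theta> \<in> cbox 0 1" for \<theta>
    proof -
      have "T (real j * h) (?w \<theta> *\<^sub>R T ((1 - \<theta>) * h) x - ?w \<theta> *\<^sub>R x) = ?w \<theta> *\<^sub>R ((T ((real j + (1 - \<theta>)) * h) - T (real j * h)) x)" for j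
        using \<theta> h T_add_apply[of "real j * h" "(1 - \<theta>) * h" x]
        by (simp add: blinfun.diff_right blinfun.diff_left blinfun.scaleR_right scaleR_diff_right distrib_right)
      then have eq: "(\<Sum>j<n. T (real j * h) (?w \<theta> *\<^sub>R T ((1 - \<theta>) * h) x - ?w \<theta> *\<^sub>R x)) =
          ?w \<theta> *\<^sub>R ((\<Sum>j<n. T ((real j + (1 - \<theta>)) * h) - T (real j * h)) x)"
        by (simp only: scaleR_sum_right blinfun.sum_left)
      have w: "0 \<le> ?w \<theta>" "?w \<theta> \<le> 1"
      proof -
        have "?w \<theta> \<le> 1 / 1" using \<theta> by (intro frac_le) (auto simp: power_le_one)
        then show "?w \<theta> \<le> 1" by simp
      qed (use \<theta> in auto)
      have "norm ((\<Sum>j<n. T ((real j + (1 - \<theta>)) * h) - T (real j * h)) x) \<le> C * norm x"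
        using C(2)[OF h, of "1 - \<theta>"] \<theta> by (intro order_trans[OF norm_blinfun mult_right_mono]) auto
      then have "?w \<theta> * norm ((\<Sum>j<n. T ((real j + (1 - \<theta>)) * h) - T (real j * h)) x) \<le> 1 * (C * norm x)"
        using w by (intro mult_mono) auto
      then show ?thesis unfolding eq norm_scaleR abs_of_nonneg[OF w(1)] mult_1 .
    qed
    have "norm (\<Sum>j<n. T (real j * h) (P k h x - (1 / fact k) *\<^sub>R x)) \<le> C * norm x * measure lborel (cbox 0 (1::real))"
      by (rule has_integral_bound[OF _ hs[folded cbox_interval] bd]) (use C(1) in simp_all)
    then show ?thesis by simp
  qed
  then show ?thesis using that C(1) by blast
qed

text \<open>The defect of the quintic quadrature condition at Z = hA.\<close>

definition X :: "real \<Rightarrow> 'a \<Rightarrow> 'a" where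
  "X h v = (\<Sum>i\<in>{2..15}. (c i ^ 5 / fact 5) *\<^sub>R bop h i v) - P 6 h v"

lemma X_diff: "h \<ge> 0 \<Longrightarrow> X h (v - w) = X h v - X h w"
  unfolding X_def
  by (simp add: linear_diff[OF bounded_linear.linear[OF bop_bounded_linear]] P_diff scaleR_diff_right sum_subtractf)

lemma X_sums_bounded:
  obtains C where "C \<ge> 0" "\<And>h n x. 0 < h \<Longrightarrow> real n * h \<le> R \<Longrightarrow> norm (\<Sum>j<n. T (real j * h) (X h x)) \<le> C * norm x"
proof -
  obtain C where C: "C \<ge> 0" "\<And>h n k x. 0 < h \<Longrightarrow> real n * h \<le> R \<Longrightarrow> k \<ge> 1 \<Longrightarrow>
    norm (\<Sum>j<n. T (real j * h) (P k h x - (1 / fact k) *\<^sub>R x)) \<le> C * norm x"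
    using smoothed_sums_bounded by blast
  define s1 where "s1 = c 12 + c 13 + c 14 + c 15"
  define s2 where "s2 = c 12 * c 13 + c 12 * c 14 + c 12 * c 15 + c 13 * c 14 + c 13 * c 15 + c 14 * c 15"
  define s3 where "s3 = c 12 * c 13 * c 14 + c 12 * c 13 * c 15 + c 12 * c 14 * c 15 + c 13 * c 14 * c 15"
  define s4 where "s4 = c 12 * c 13 * c 14 * c 15"
  \<comment> \<open>The coefficients of the fifth moment, where 120 = 5!, and -1 for phi_6.\<close>
  define \<beta> :: "nat \<Rightarrow> real" where "\<beta> k = (if k = 2 then - s4 / 120 else if k = 3 then 2 * s3 / 120 else if k = 4 then - 6 * s2 / 120
    else if k = 5 then 24 * s1 / 120 else -1)" for k
  have X1: "X h x = (\<Sum>k\<in>{2,3,4,5,6}. \<beta> k *\<^sub>R P k h x)" for h x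
    using b_moment_5[of "\<lambda>k r. P k (r * h) x", folded s1_def s2_def s3_def s4_def]
    unfolding X_def bop_def by (simp add: \<beta>_def algebra_simps)
  \<comment> \<open>As phi_k(0) = 1/k!, this is the vanishing of the defect at z = 0. It allows
    subtracting x / k! from every term, which brings the sums into the smoothed form.\<close>
  have "(\<Sum>k\<in>{2,3,4,5,6}. \<beta> k / fact k) = 0"
    using weak_17[folded s1_def s2_def s3_def s4_def] by (simp add: \<beta>_def fact_numeral)
  then have "(\<Sum>k\<in>{2,3,4,5,6}. (\<beta> k / fact k) *\<^sub>R x) = 0" for x :: 'a
    by (simp only: scaleR_sum_left[symmetric] scaleR_zero_left)
  then have X2: "X h x = (\<Sum>k\<in>{2,3,4,5,6}. \<beta> k *\<^sub>R (P k h x - (1 / fact k) *\<^sub>R x))" for h x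
    unfolding X1 by (simp only: scaleR_diff_right sum_subtractf scaleR_scaleR times_divide_eq_right mult_1_right diff_0_right)
  have "norm (\<Sum>j<n. T (real j * h) (X h x)) \<le> ((\<Sum>k\<in>{2,3,4,5,6}. \<bar>\<beta> k\<bar>) * C) * norm x" if h: "0 < h" "real n * h \<le> R" for h n x
  proof -
    have "(\<Sum>j<n. T (real j * h) (X h x)) = (\<Sum>k\<in>{2,3,4,5,6}. \<beta> k *\<^sub>R (\<Sum>j<n. T (real j * h) (P k h x - (1 / fact k) *\<^sub>R x)))"
      unfolding X2 blinfun.sum_right scaleR_sum_right blinfun.scaleR_right by (rule sum.swap)
    also have "norm \<dots> \<le> (\<Sum>k\<in>{2,3,4,5,6}. \<bar>\<beta> k\<bar> * (C * norm x))"
    proof (rule sum_norm_le)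
      fix k :: nat assume "k \<in> {2,3,4,5,6}"
      then have "norm (\<Sum>j<n. T (real j * h) (P k h x - (1 / fact k) *\<^sub>R x)) \<le> C * norm x"
        using h by (intro C(2)) auto
      then show "norm (\<beta> k *\<^sub>R (\<Sum>j<n. T (real j * h) (P k h x - (1 / fact k) *\<^sub>R x))) \<le> \<bar>\<beta> k\<bar> * (C * norm x)"
        unfolding norm_scaleR by (intro mult_left_mono) auto
    qed
    also have "\<dots> = ((\<Sum>k\<in>{2,3,4,5,6}. \<bar>\<beta> k\<bar>) * C) * norm x"
      by (simp only: sum_distrib_right mult.assoc)
    finally show ?thesis .
  qed
  moreover have "(\<Sum>k\<in>{2,3,4,5,6}. \<bar>\<beta> k\<bar>) * C \<ge> 0" using C by (intro mult_nonneg_nonneg sum_nonneg) auto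
  ultimately show ?thesis using that by blast
qed

end

text \<open>\<rho> is the radius of the strip and \<eta> a time for which Taylor polynomials of the
  solution stay in it; \<open>L\<close> is a Lipschitz constant of g, \<open>Cg\<close> bounds the
  Taylor remainder of g along such a polynomial, and \<open>Kd\<close> bounds the derivatives of u
  and of g along u.\<close>

locale exprk_problem = exprk_semigroup c T
  for c :: "nat \<Rightarrow> real" and T :: "real \<Rightarrow> 'a::banach \<Rightarrow>\<^sub>L 'a" +
  fixes g :: "'a \<Rightarrow> 'a" and A :: "'a \<Rightarrow> 'a" and \<rho> \<eta> L Cg Kd :: real
  assumes nonneg: "\<rho> > 0" "\<eta> > 0" "L \<ge> 0" "Cg \<ge> 0" "Kd \<ge> 0"
begin

text \<open>\<open>y\<close> and \<open>f\<close> are the jets of the solution \<open>u\<close> and of \<open>g \<circ> u\<close> at one point of time. The stages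
  are compared with the Taylor polynomial of \<open>u\<close> and not with \<open>u\<close> itself, as the nodes may exceed 1
  and stages in the last steps may then lie beyond the interval on which \<open>u\<close> is given.\<close>

definition local_data :: "(nat \<Rightarrow> 'a) \<Rightarrow> (nat \<Rightarrow> 'a) \<Rightarrow> bool" where
  "local_data y f \<longleftrightarrow>
    (\<forall>q\<le>6. orbit (y q) (y (Suc q) - f q)) \<and> (\<forall>q\<le>6. norm (f q) \<le> Kd) \<and> (\<forall>q\<le>7. norm (y q) \<le> Kd) \<and>
    (\<forall>x s. 0 \<le> s \<longrightarrow> s \<le> \<eta> \<longrightarrow> norm (x - y 0) < \<rho> \<longrightarrow>
       norm (g x - (\<Sum>q<6. (s ^ q / fact q) *\<^sub>R f q)) \<le> L * norm (x - (\<Sum>q<6. (s ^ q / fact q) *\<^sub>R y q)) + Cg * s ^ 6)"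

text \<open>Variation of constants with a polynomial source. Since y (q + 1) - f q is A y q, each
  use of the recurrence for phi extracts one more Taylor term and leaves a remainder in which only a
  bounded operator occurs.\<close>

lemma taylor_expansion:
  assumes "local_data y f" "s \<ge> 0" "n \<le> 6"
  shows "T s (y 0) + (\<Sum>q<Suc n. s ^ Suc q *\<^sub>R P (Suc q) s (f q)) =
    (\<Sum>q<Suc n. (s ^ q / fact q) *\<^sub>R y q) + s ^ Suc n *\<^sub>R P (Suc n) s (y (Suc n))"
  using assms(3)
proof (induction n)
  case 0
  have "orbit (y 0) (y (Suc 0) - f 0)" using assms(1) by (simp add: local_data_def)
  then have "T s (y 0) = y 0 + s *\<^sub>R P 1 s (y 1 - f 0)" using assms(2) by (simp add: orbit_def)
  then show ?case using assms(2) by (simp add: P_diff algebra_simps)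
next
  case (Suc n)
  have "orbit (y (Suc n)) (y (Suc (Suc n)) - f (Suc n))" using assms(1) Suc.prems by (simp add: local_data_def)
  from orbit_P_rec[OF this assms(2), of "Suc n"]
  have "P (Suc n) s (y (Suc n)) = (1 / fact (Suc n)) *\<^sub>R y (Suc n)
      + s *\<^sub>R (P (Suc (Suc n)) s (y (Suc (Suc n))) - P (Suc (Suc n)) s (f (Suc n)))"
    using assms(2) by (simp add: P_diff)
  then have "s ^ Suc n *\<^sub>R P (Suc n) s (y (Suc n)) = (s ^ Suc n / fact (Suc n)) *\<^sub>R y (Suc n)
      + s ^ Suc (Suc n) *\<^sub>R P (Suc (Suc n)) s (y (Suc (Suc n))) - s ^ Suc (Suc n) *\<^sub>R P (Suc (Suc n)) s (f (Suc n))"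
    by (simp add: scaleR_add_right scaleR_diff_right mult.commute del: fact_Suc)
  moreover have "T s (y 0) + (\<Sum>q<Suc n. s ^ Suc q *\<^sub>R P (Suc q) s (f q)) =
    (\<Sum>q<Suc n. (s ^ q / fact q) *\<^sub>R y q) + s ^ Suc n *\<^sub>R P (Suc n) s (y (Suc n))"
    using Suc by simp
  ultimately show ?case
    unfolding sum.lessThan_Suc[of _ "Suc n"] by (simp only: add.assoc[symmetric] diff_add_cancel add_diff_eq)
qed

text \<open>A stage (r = c i) and the full step (r = 1) have this common form. The right-hand side
  separates the flow with Taylor data, the propagated initial error, the residuals of g, and the
  quadrature defects; for a stage the latter are \<psi> of order q + 1 applied to f q.\<close>

lemma quadrature_identity:
  fixes f :: "nat \<Rightarrow> 'a"
  assumes lin: "\<And>j. j \<in> I \<Longrightarrow> linear (\<omega> j)" and s: "s = r * h" "s \<ge> 0"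
  defines "p \<equiv> \<lambda>s. \<Sum>q<6. (s ^ q / fact q) *\<^sub>R f q"
  shows "T s v + s *\<^sub>R P 1 s w + h *\<^sub>R (\<Sum>j\<in>I. \<omega> j (G j - w)) =
    (T s y0 + (\<Sum>q<6. s ^ Suc q *\<^sub>R P (Suc q) s (f q))) + T s (v - y0) + s *\<^sub>R P 1 s (w - f 0)
    + h *\<^sub>R (\<Sum>j\<in>I. \<omega> j ((G j - p (c j * h)) - (w - f 0)))
    + (\<Sum>q=1..5. h ^ Suc q *\<^sub>R ((\<Sum>j\<in>I. (c j ^ q / fact q) *\<^sub>R \<omega> j (f q)) - r ^ Suc q *\<^sub>R P (Suc q) s (f q)))"
proof -
  have split: "(\<Sum>q<6. F q) = F 0 + (\<Sum>q=1..5. F q)" for F :: "nat \<Rightarrow> 'a"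
  proof -
    have "{..<6::nat} = insert 0 {1..5}" by auto
    then show ?thesis by simp
  qed
  have \<omega>: "\<omega> j (G j - w) = \<omega> j ((G j - p (c j * h)) - (w - f 0)) + (\<Sum>q=1..5. ((c j * h) ^ q / fact q) *\<^sub>R \<omega> j (f q))"
    if "j \<in> I" for j
  proof -
    have "G j - w = ((G j - p (c j * h)) - (w - f 0)) + (\<Sum>q=1..5. ((c j * h) ^ q / fact q) *\<^sub>R f q)"
      unfolding p_def split[of "\<lambda>q. ((c j * h) ^ q / fact q) *\<^sub>R f q"] by simp
    then have "\<omega> j (G j - w) = \<omega> j (((G j - p (c j * h)) - (w - f 0)) + (\<Sum>q=1..5. ((c j * h) ^ q / fact q) *\<^sub>R f q))"
      by (rule arg_cong)
    also have "\<dots> = \<omega> j ((G j - p (c j * h)) - (w - f 0)) + (\<Sum>q=1..5. ((c j * h) ^ q / fact q) *\<^sub>R \<omega> j (f q))"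
      by (simp only: linear_add[OF lin[OF that]] linear_sum[OF lin[OF that]] linear_scale[OF lin[OF that]])
    finally show ?thesis .
  qed
  have "h *\<^sub>R (\<Sum>j\<in>I. \<omega> j (G j - w)) = h *\<^sub>R (\<Sum>j\<in>I. \<omega> j ((G j - p (c j * h)) - (w - f 0)))
      + h *\<^sub>R (\<Sum>j\<in>I. \<Sum>q=1..5. ((c j * h) ^ q / fact q) *\<^sub>R \<omega> j (f q))"
    using \<omega> by (simp add: sum.distrib scaleR_add_right)
  also have "h *\<^sub>R (\<Sum>j\<in>I. \<Sum>q=1..5. ((c j * h) ^ q / fact q) *\<^sub>R \<omega> j (f q)) =
      (\<Sum>q=1..5. h ^ Suc q *\<^sub>R (\<Sum>j\<in>I. (c j ^ q / fact q) *\<^sub>R \<omega> j (f q)))"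
    unfolding scaleR_sum_right
    by (subst sum.swap) (simp add: power_mult_distrib mult_ac)
  finally have 1: "h *\<^sub>R (\<Sum>j\<in>I. \<omega> j (G j - w)) = h *\<^sub>R (\<Sum>j\<in>I. \<omega> j ((G j - p (c j * h)) - (w - f 0)))
      + (\<Sum>q=1..5. h ^ Suc q *\<^sub>R (\<Sum>j\<in>I. (c j ^ q / fact q) *\<^sub>R \<omega> j (f q)))" .
  have 2: "(\<Sum>q<6. s ^ Suc q *\<^sub>R P (Suc q) s (f q)) = s *\<^sub>R P 1 s (f 0) + (\<Sum>q=1..5. h ^ Suc q *\<^sub>R (r ^ Suc q *\<^sub>R P (Suc q) s (f q)))"
  proof -
    have "h ^ Suc q *\<^sub>R (r ^ Suc q *\<^sub>R x) = s ^ Suc q *\<^sub>R x" for q and x :: 'a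
      by (simp add: s(1) power_mult_distrib mult_ac)
    then show ?thesis
      unfolding split[of "\<lambda>q. s ^ Suc q *\<^sub>R P (Suc q) s (f q)"] by (simp only: power_Suc0_right One_nat_def)
  qed
  show ?thesis
    unfolding 1 2 scaleR_diff_right sum_subtractf
    using s(2) by (simp add: P_diff blinfun.diff_right scaleR_diff_right)
qed

abbreviation \<gamma> :: "(nat \<Rightarrow> 'a) \<Rightarrow> real \<Rightarrow> 'a" where
  "\<gamma> y s \<equiv> \<Sum>q<6. (s ^ q / fact q) *\<^sub>R y q"

definition U :: "real \<Rightarrow> 'a \<Rightarrow> nat \<Rightarrow> 'a" where
  "U h v i = exp_rk_stage h c (aop h) (\<lambda>k r. P k (r * h)) (\<lambda>u. A u + g u) g v i"

definition step :: "real \<Rightarrow> 'a \<Rightarrow> 'a" where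
  "step h v = exp_rk_step 15 h c (aop h) (bop h) (\<lambda>k r. P k (r * h)) (\<lambda>u. A u + g u) g v"

text \<open>Since s phi_1(sA) A v = T s v - v, the scheme can be written without A. All later
  estimates start from that form.\<close>

lemma orbit_phi1:
  assumes "orbit v (A v)" "s \<ge> 0"
  shows "v + s *\<^sub>R P 1 s (A v + g v) = T s v + s *\<^sub>R P 1 s (g v)"
  using assms by (simp add: orbit_def P_add scaleR_add_right)

lemma U_eq:
  assumes "orbit v (A v)" "h \<ge> 0" "i \<in> {2..15}"
  shows "U h v i = T (c i * h) v + (c i * h) *\<^sub>R P 1 (c i * h) (g v) + h *\<^sub>R (\<Sum>j\<in>{2..<i}. aop h i j (g (U h v j) - g v))"
  unfolding U_def
  by (subst exp_rk_stage.simps) (use orbit_phi1[OF assms(1), of "c i * h"] c_pos[OF assms(3)] assms(2) in simp)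

lemma step_eq:
  assumes "orbit v (A v)" "h \<ge> 0"
  shows "step h v = T h v + h *\<^sub>R P 1 h (g v) + h *\<^sub>R (\<Sum>i\<in>{2..15}. bop h i (g (U h v i) - g v))"
  unfolding step_def exp_rk_step_def U_def using orbit_phi1[OF assms] by simp

text \<open>A common bound for the nodes; the summand 1 makes its powers increase with the
  exponent.\<close>

definition cm :: real where "cm = 1 + (\<Sum>i\<in>{2..15}. c i)"

lemma cm: "cm \<ge> 1" "i \<in> {2..15} \<Longrightarrow> c i \<le> cm"
proof -
  have nn: "\<And>i. i \<in> {2..15} \<Longrightarrow> 0 \<le> c i" using c_pos by (simp add: less_imp_le)
  then show "cm \<ge> 1" using sum_nonneg[of "{2..15}" c] by (simp add: cm_def)
  show "c i \<le> cm" if "i \<in> {2..15}"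
    using member_le_sum[OF that, of c] nn by (simp add: cm_def)
qed

text \<open>The constants are uniform over all jets, so they hold at every time step. The second
  clause keeps the stage in the region where g is controlled, which the estimate of the next group
  relies on.\<close>

definition stage_bound :: "real \<Rightarrow> real \<Rightarrow> real \<Rightarrow> nat \<Rightarrow> nat \<Rightarrow> bool" where
  "stage_bound C h0 \<epsilon> p i \<longleftrightarrow> (\<forall>y f v h. local_data y f \<longrightarrow> orbit v (A v) \<longrightarrow> 0 < h \<longrightarrow> h \<le> h0 \<longrightarrow>
     norm (v - y 0) \<le> \<epsilon> \<longrightarrow>
     norm (U h v i - \<gamma> y (c i * h)) \<le> C * (norm (v - y 0) + h ^ p) \<and> norm (U h v i - y 0) < \<rho>)"

lemma stage_bound_mono:
  assumes "stage_bound C h0 \<epsilon> p i" "C \<le> C'" "h0' \<le> h0" "\<epsilon>' \<le> \<epsilon>"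
  shows "stage_bound C' h0' \<epsilon>' p i"
  unfolding stage_bound_def
proof (intro allI impI)
  fix y f v h
  assume *: "local_data y f" "orbit v (A v)" "0 < h" "h \<le> h0'" "norm (v - y 0) \<le> \<epsilon>'"
  then have "norm (U h v i - \<gamma> y (c i * h)) \<le> C * (norm (v - y 0) + h ^ p) \<and> norm (U h v i - y 0) < \<rho>"
    using assms unfolding stage_bound_def by (meson order_trans)
  moreover have "C * (norm (v - y 0) + h ^ p) \<le> C' * (norm (v - y 0) + h ^ p)"
    using assms(2) * by (intro mult_right_mono) auto
  ultimately show "norm (U h v i - \<gamma> y (c i * h)) \<le> C' * (norm (v - y 0) + h ^ p) \<and> norm (U h v i - y 0) < \<rho>"
    by linarith
qed

definition stage_order :: "nat \<Rightarrow> nat \<Rightarrow> bool" where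
  "stage_order p i \<longleftrightarrow> (\<exists>C h0 \<epsilon>. C \<ge> 0 \<and> h0 > 0 \<and> \<epsilon> > 0 \<and> stage_bound C h0 \<epsilon> p i)"

lemma stage_order_uniform:
  assumes "finite I" "\<And>i. i \<in> I \<Longrightarrow> stage_order p i"
  shows "\<exists>C h0 \<epsilon>. C \<ge> 0 \<and> h0 > 0 \<and> \<epsilon> > 0 \<and> (\<forall>i\<in>I. stage_bound C h0 \<epsilon> p i)"
  using assms
proof (induction I)
  case empty
  then show ?case by (intro exI[of _ 1]) auto
next
  case (insert i I)
  obtain C1 h1 \<epsilon>1 where 1: "C1 \<ge> 0" "h1 > 0" "\<epsilon>1 > 0" "\<forall>j\<in>I. stage_bound C1 h1 \<epsilon>1 p j"
    using insert.IH[OF insert.prems[OF insertI2]] by blast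
  obtain C2 h2 \<epsilon>2 where 2: "C2 \<ge> 0" "h2 > 0" "\<epsilon>2 > 0" "stage_bound C2 h2 \<epsilon>2 p i"
    using insert.prems[OF insertI1] unfolding stage_order_def by blast
  have "\<forall>j\<in>insert i I. stage_bound (max C1 C2) (min h1 h2) (min \<epsilon>1 \<epsilon>2) p j"
    using 1(4) 2(4) by (auto intro: stage_bound_mono)
  then show ?case
    using 1 2 by (intro exI[of _ "max C1 C2"] exI[of _ "min h1 h2"] exI[of _ "min \<epsilon>1 \<epsilon>2"]) auto
qed

lemma residual_bound:
  assumes "local_data y f" "norm (x - y 0) < \<rho>" "0 \<le> s" "s \<le> \<eta>"
  shows "norm (g x - \<gamma> f s) \<le> L * norm (x - \<gamma> y s) + Cg * s ^ 6"
  using assms unfolding local_data_def by blast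

lemma residual_bound_0:
  assumes "local_data y f" "norm (x - y 0) < \<rho>"
  shows "norm (g x - f 0) \<le> L * norm (x - y 0)"
proof -
  have 0: "(\<Sum>q<6. ((0::real) ^ q / fact q) *\<^sub>R z q) = z 0" for z :: "nat \<Rightarrow> 'a"
  proof -
    have "(\<Sum>q<6. ((0::real) ^ q / fact q) *\<^sub>R z q) = (\<Sum>q\<in>{0}. ((0::real) ^ q / fact q) *\<^sub>R z q)"
      by (rule sum.mono_neutral_right) auto
    then show ?thesis by simp
  qed
  show ?thesis
    using residual_bound[OF assms, of 0] nonneg by (simp add: 0 del: power_0_left)
qed

lemma gamma_near:
  assumes "local_data y f" "0 \<le> r" "r \<le> cm" "0 < h" "h \<le> 1"
  shows "norm (\<gamma> y (r * h) - y 0) \<le> 5 * (cm ^ 6 * Kd) * h"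
proof -
  have "{..<6::nat} = insert 0 {1..5}" by auto
  then have "\<gamma> y (r * h) - y 0 = (\<Sum>q=1..5. ((r * h) ^ q / fact q) *\<^sub>R y q)" by simp
  also have "norm \<dots> \<le> (\<Sum>q=(1::nat)..5. (cm ^ 6 * Kd) * h)"
  proof (rule sum_norm_le)
    fix q :: nat assume q: "q \<in> {1..5}"
    have "(r * h) ^ q / fact q \<le> (r * h) ^ q / 1"
      using assms by (intro divide_left_mono) auto
    also have "\<dots> = r ^ q * h ^ q" by (simp add: power_mult_distrib)
    also have "\<dots> \<le> cm ^ 6 * h ^ 1"
    proof (intro mult_mono)
      show "r ^ q \<le> cm ^ 6"
        using power_mono[OF assms(3,2), of q] power_increasing[of q 6 cm] cm(1) q by auto
      show "h ^ q \<le> h ^ 1" using q assms by (intro power_decreasing) auto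
    qed (use assms cm(1) in auto)
    finally have "(r * h) ^ q / fact q \<le> cm ^ 6 * h" by simp
    moreover have "norm (y q) \<le> Kd" using assms(1) q by (simp add: local_data_def)
    ultimately have "((r * h) ^ q / fact q) * norm (y q) \<le> (cm ^ 6 * h) * Kd"
      using assms cm(1) by (intro mult_mono) auto
    then show "norm (((r * h) ^ q / fact q) *\<^sub>R y q) \<le> (cm ^ 6 * Kd) * h"
      using assms by (simp add: mult_ac abs_mult)
  qed
  finally show ?thesis by simp
qed

section \<open>Stage orders and the local error\<close>

lemma local_data_bounds:
  assumes "local_data y f"
  shows "q \<le> 6 \<Longrightarrow> norm (f q) \<le> Kd" "q \<le> 7 \<Longrightarrow> norm (y q) \<le> Kd"
  using assms by (auto simp: local_data_def)

lemma node_power_le: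
  assumes "j \<in> {2..15}" "q \<le> 6"
  shows "0 \<le> c j ^ q / fact q" "c j ^ q / fact q \<le> cm ^ 6"
proof -
  have cj: "0 \<le> c j" "c j \<le> cm" using c_pos[OF assms(1)] cm(2)[OF assms(1)] by auto
  then show "0 \<le> c j ^ q / fact q" by simp
  have "c j ^ q / fact q \<le> c j ^ q / 1" using cj by (intro divide_left_mono) auto
  also have "\<dots> \<le> cm ^ q" using cj by (simp add: power_mono)
  also have "\<dots> \<le> cm ^ 6" using cm(1) assms(2) by (intro power_increasing) auto
  finally show "c j ^ q / fact q \<le> cm ^ 6" .
qed

lemma stage_residual:
  assumes "local_data y f" "stage_bound C0 h1 \<epsilon>1 p j" "orbit v (A v)" "0 < h" "h \<le> h1" "h \<le> 1" "cm * h \<le> \<eta>"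
    "norm (v - y 0) \<le> \<epsilon>1" "j \<in> {2..15}" "p \<le> 6"
  shows "norm (g (U h v j) - \<gamma> f (c j * h)) \<le> (L * C0 + Cg * cm ^ 6) * (norm (v - y 0) + h ^ p)"
proof -
  let ?e = "norm (v - y 0)"
  have cj: "0 < c j" "c j \<le> cm" using c_pos[OF assms(9)] cm(2)[OF assms(9)] by auto
  have sb: "norm (U h v j - \<gamma> y (c j * h)) \<le> C0 * (?e + h ^ p)" "norm (U h v j - y 0) < \<rho>"
    using assms unfolding stage_bound_def by blast+
  have "c j * h \<le> cm * h" using cj assms by (intro mult_right_mono) auto
  then have "c j * h \<le> \<eta>" using assms(7) by linarith
  moreover have "0 \<le> c j * h" using cj assms(4) by simp
  ultimately have "norm (g (U h v j) - \<gamma> f (c j * h)) \<le> L * norm (U h v j - \<gamma> y (c j * h)) + Cg * (c j * h) ^ 6"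
    by (intro residual_bound[OF assms(1) sb(2)])
  also have "\<dots> \<le> L * (C0 * (?e + h ^ p)) + Cg * (cm ^ 6 * (?e + h ^ p))"
  proof (intro add_mono mult_left_mono sb(1))
    have "(c j * h) ^ 6 = c j ^ 6 * h ^ 6" by (simp add: power_mult_distrib)
    also have "\<dots> \<le> cm ^ 6 * (?e + h ^ p)"
    proof (intro mult_mono)
      show "c j ^ 6 \<le> cm ^ 6" using cj by (intro power_mono) auto
      have "h ^ 6 \<le> h ^ p" using assms by (intro power_decreasing) auto
      then show "h ^ 6 \<le> ?e + h ^ p" by (simp add: add_increasing)
    qed (use cm(1) assms in auto)
    finally show "(c j * h) ^ 6 \<le> cm ^ 6 * (?e + h ^ p)" .
  qed (use nonneg in auto)
  finally show ?thesis by (simp add: algebra_simps)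
qed

text \<open>One order is gained because the errors of the feeding stages carry the factor h of the
  increment, while the moment conditions remove every quadrature defect below h^(Q + 1).\<close>

lemma stage_order_Suc:
  assumes i: "i \<in> {2..15}" and I: "I \<subseteq> {2..<i}" and zero: "\<And>h j v. j \<in> {2..<i} - I \<Longrightarrow> aop h i j v = 0"
    and Q: "1 \<le> Q" "Q \<le> 5"
    and mom: "\<And>q (\<phi> :: nat \<Rightarrow> real \<Rightarrow> 'a). 1 \<le> q \<Longrightarrow> q < Q \<Longrightarrow>
      (\<Sum>j\<in>{2..<i}. (c j ^ q / fact q) *\<^sub>R a \<phi> i j) = c i ^ Suc q *\<^sub>R \<phi> (Suc q) (c i)"
    and prev: "\<And>j. j \<in> I \<Longrightarrow> stage_order Q j"
  shows "stage_order (Suc Q) i"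
proof -
  have "finite I" using I finite_subset by blast
  from stage_order_uniform[OF this prev]
  obtain C0 h1 \<epsilon>1 where C0: "C0 \<ge> 0" "h1 > 0" "\<epsilon>1 > 0" "\<forall>j\<in>I. stage_bound C0 h1 \<epsilon>1 Q j"
    by blast
  obtain M where M: "M \<ge> 1" "\<And>t. 0 \<le> t \<Longrightarrow> t \<le> cm \<Longrightarrow> norm (T t) \<le> M"
    using T_bounded by blast
  obtain K where K: "K \<ge> 0" "\<And>h i j v. 0 \<le> h \<Longrightarrow> h \<le> 1 \<Longrightarrow> i \<in> {2..15} \<Longrightarrow> j \<in> {2..15} \<Longrightarrow> norm (aop h i j v) \<le> K * norm v"
    using ab_bound[of 1] by metis
  \<comment> \<open>\<open>C1\<close> bounds residuals of g at the feeding stages, \<open>B0\<close>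
    one quadrature defect (15 bounds the number of stages), and \<open>C2\<close> adds up the five
    contributions to the error.\<close>
  define C1 where "C1 = L * C0 + Cg * cm ^ 6"
  define B0 where "B0 = 15 * (cm ^ 6 * (K * Kd)) + cm ^ 6 * (M * Kd)"
  define C2 where "C2 = M + cm * (M * L) + 15 * (K * (C1 + L)) + 5 * B0 + cm ^ 6 * (M * Kd)"
  note nn = nonneg K(1) C0(1) M(1) cm(1)
  have nn2: "0 \<le> C1" "0 \<le> B0" "0 \<le> C2" using nn by (simp_all add: C1_def B0_def C2_def)
  \<comment> \<open>\<rho>/2 puts v itself in the strip. The quotients by 4 (C2 + 1) and by 4 N
    limit the contributions of the initial error and of h to \<rho>/4 each, so the stage stays
    within distance \<rho>.\<close>
  define \<epsilon> where "\<epsilon> = min \<epsilon>1 (min (\<rho> / 2) (\<rho> / (4 * (C2 + 1))))"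
  define N where "N = C2 + 5 * (cm ^ 6 * Kd) + 1"
  define h0 where "h0 = min h1 (min 1 (min (\<eta> / cm) (\<rho> / (4 * N))))"
  have "N > 0" using nn nn2 by (simp add: N_def add_nonneg_pos)
  have "stage_bound C2 h0 \<epsilon> (Suc Q) i"
    unfolding stage_bound_def
  proof (intro allI impI)
    fix y f v h
    assume ld: "local_data y f" and orb: "orbit v (A v)" and h: "0 < h" "h \<le> h0" and e: "norm (v - y 0) \<le> \<epsilon>"
    have h': "h \<le> h1" "h \<le> 1" "h \<le> \<eta> / cm" "h \<le> \<rho> / (4 * N)" using h by (auto simp: h0_def)
    have e': "norm (v - y 0) \<le> \<epsilon>1" "norm (v - y 0) \<le> \<rho> / 2" "norm (v - y 0) \<le> \<rho> / (4 * (C2 + 1))"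
      using e by (auto simp: \<epsilon>_def)
    have cmh: "cm * h \<le> \<eta>" using h'(3) cm(1) by (simp add: pos_le_divide_eq mult.commute)
    have ci: "0 < c i" "c i \<le> cm" using c_pos[OF i] cm(2)[OF i] by auto
    define s where "s = c i * h"
    have s: "0 \<le> s" "s \<le> cm" "s \<le> cm * h"
    proof -
      show "0 \<le> s" using ci h by (simp add: s_def)
      show "s \<le> cm * h" using ci h unfolding s_def by (intro mult_right_mono) auto
      also have "\<dots> \<le> cm" using h' cm(1) by (simp add: mult_left_le)
      finally show "s \<le> cm" .
    qed
    let ?e = "norm (v - y 0)" and ?h = "h ^ Suc Q"
    let ?r = "\<lambda>j. g (U h v j) - \<gamma> f (c j * h)"
    let ?W = "\<lambda>q. (\<Sum>j\<in>{2..<i}. (c j ^ q / fact q) *\<^sub>R aop h i j (f q)) - c i ^ Suc q *\<^sub>R P (Suc q) s (f q)"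
    have PM: "norm (P k s x) \<le> M * norm x" for k x
      using norm_P_le[OF s(1,2) M(2)] .
    \<comment> \<open>Five sources of error: the propagated initial error, the perturbation of g at
      v, the residuals at earlier stages, the quadrature defects and the Taylor remainder.\<close>
    have eq: "U h v i - \<gamma> y s = T s (v - y 0) + s *\<^sub>R P 1 s (g v - f 0)
        + h *\<^sub>R (\<Sum>j\<in>{2..<i}. aop h i j (?r j - (g v - f 0))) + (\<Sum>q=1..5. h ^ Suc q *\<^sub>R ?W q) + s ^ 6 *\<^sub>R P 6 s (y 6)"
    proof -
      have lin: "linear (aop h i j)" for j
        using bounded_linear.linear[OF aop_bounded_linear[of h i j]] h i by simp
      have "U h v i = T s v + s *\<^sub>R P 1 s (g v) + h *\<^sub>R (\<Sum>j\<in>{2..<i}. aop h i j (g (U h v j) - g v))"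
        using U_eq[OF orb _ i, of h] h by (simp add: s_def)
      also have "\<dots> = (T s (y 0) + (\<Sum>q<6. s ^ Suc q *\<^sub>R P (Suc q) s (f q))) + T s (v - y 0) + s *\<^sub>R P 1 s (g v - f 0)
        + h *\<^sub>R (\<Sum>j\<in>{2..<i}. aop h i j (?r j - (g v - f 0))) + (\<Sum>q=1..5. h ^ Suc q *\<^sub>R ?W q)"
        by (rule quadrature_identity[OF lin s_def s(1)])
      also have "T s (y 0) + (\<Sum>q<6. s ^ Suc q *\<^sub>R P (Suc q) s (f q)) = \<gamma> y s + s ^ 6 *\<^sub>R P 6 s (y 6)"
        using taylor_expansion[OF ld s(1), of 5] by (simp del: sum.lessThan_Suc power_Suc)
      finally show ?thesis by simp
    qed
    have r0: "norm (g v - f 0) \<le> L * ?e"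
      by (rule residual_bound_0[OF ld]) (use e'(2) nonneg in linarith)
    have t1: "norm (T s (v - y 0)) \<le> M * ?e"
      using order_trans[OF norm_blinfun mult_right_mono[OF M(2)[OF s(1,2)]]] by simp
    have t2: "norm (s *\<^sub>R P 1 s (g v - f 0)) \<le> cm * (M * L) * ?e"
    proof -
      have "norm (s *\<^sub>R P 1 s (g v - f 0)) \<le> cm * (M * (L * ?e))"
        unfolding norm_scaleR using s r0 PM[of 1 "g v - f 0"] nn
        by (intro mult_mono order_trans[OF PM mult_left_mono[OF r0]]) auto
      then show ?thesis by (simp add: mult.assoc)
    qed
    have t3: "norm (h *\<^sub>R (\<Sum>j\<in>{2..<i}. aop h i j (?r j - (g v - f 0)))) \<le> 15 * (K * (C1 + L)) * (?e + ?h)"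
    proof -
      have "norm (aop h i j (?r j - (g v - f 0))) \<le> K * (C1 * (?e + h ^ Q) + L * ?e)" if j: "j \<in> {2..<i}" for j
      proof (cases "j \<in> I")
        case True
        have j15: "j \<in> {2..15}" using j i by auto
        have "norm (?r j) \<le> C1 * (?e + h ^ Q)"
          unfolding C1_def using C0(4) True Q by (intro stage_residual[OF ld _ orb h(1) h'(1,2) cmh e'(1) j15]) auto
        then have "norm (?r j - (g v - f 0)) \<le> C1 * (?e + h ^ Q) + L * ?e"
          using r0 norm_triangle_ineq4[of "?r j" "g v - f 0"] by linarith
        then show ?thesis
          using K(2)[of h i j "?r j - (g v - f 0)"] i j15 h h'(2) K(1)
          by (meson less_imp_le mult_left_mono order_trans)
      next
        case False
        then show ?thesis using zero[of j h] j nn nn2 h by simp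
      qed
      then have "norm (\<Sum>j\<in>{2..<i}. aop h i j (?r j - (g v - f 0))) \<le> real (card {2..<i}) * (K * (C1 * (?e + h ^ Q) + L * ?e))"
        by (rule sum_norm_bound)
      also have "\<dots> \<le> 15 * (K * (C1 * (?e + h ^ Q) + L * ?e))"
        using i nn nn2 h by (intro mult_right_mono) auto
      finally have "h * norm (\<Sum>j\<in>{2..<i}. aop h i j (?r j - (g v - f 0))) \<le> h * (15 * (K * (C1 * (?e + h ^ Q) + L * ?e)))"
        using h by (intro mult_left_mono) auto
      also have "\<dots> = 15 * (K * (C1 * (h * ?e + ?h) + L * (h * ?e)))"
        by (simp add: algebra_simps)
      also have "\<dots> \<le> 15 * (K * (C1 * (?e + ?h) + L * (?e + ?h)))"
      proof -
        have 1: "h * ?e \<le> ?e" using h'(2) h by (simp add: mult_left_le_one_le)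
        moreover have "0 \<le> ?h" using h by simp
        ultimately have 2: "h * ?e \<le> ?e + ?h" by linarith
        show ?thesis using nn nn2 by (intro mult_left_mono add_mono 1 2) auto
      qed
      also have "\<dots> = 15 * (K * (C1 + L)) * (?e + ?h)" by (simp add: algebra_simps)
      finally show ?thesis using h by simp
    qed
    have t4: "norm (\<Sum>q=1..5. h ^ Suc q *\<^sub>R ?W q) \<le> 5 * B0 * ?h"
    proof -
      have "norm (h ^ Suc q *\<^sub>R ?W q) \<le> B0 * ?h" if q: "q \<in> {1..5}" for q
      proof (cases "q < Q")
        case True
        have "?W q = 0"
          using mom[of q "\<lambda>k r. P k (r * h) (f q)"] True q by (simp add: aop_def s_def)
        then show ?thesis using nn2 h by simp
      next
        case False
        have fq: "norm (f q) \<le> Kd" using local_data_bounds(1)[OF ld] q by auto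
        have "norm (\<Sum>j\<in>{2..<i}. (c j ^ q / fact q) *\<^sub>R aop h i j (f q)) \<le> real (card {2..<i}) * (cm ^ 6 * (K * Kd))"
        proof (rule sum_norm_bound)
          fix j assume "j \<in> {2..<i}"
          then have j: "j \<in> {2..15}" using i by auto
          have "norm (aop h i j (f q)) \<le> K * Kd"
            using K(2)[OF _ h'(2) i j, of "f q"] h fq K(1) by (meson less_imp_le mult_left_mono order_trans)
          then show "norm ((c j ^ q / fact q) *\<^sub>R aop h i j (f q)) \<le> cm ^ 6 * (K * Kd)"
            unfolding norm_scaleR using node_power_le[OF j, of q] q nn
            by (intro mult_mono) auto
        qed
        also have "\<dots> \<le> 15 * (cm ^ 6 * (K * Kd))"
          using i nn by (intro mult_right_mono) auto
        finally have 1: "norm (\<Sum>j\<in>{2..<i}. (c j ^ q / fact q) *\<^sub>R aop h i j (f q)) \<le> 15 * (cm ^ 6 * (K * Kd))" .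
        have "c i ^ Suc q \<le> cm ^ Suc q" using ci by (intro power_mono) auto
        also have "\<dots> \<le> cm ^ 6" using q cm(1) by (intro power_increasing) auto
        finally have "c i ^ Suc q \<le> cm ^ 6" .
        moreover have "norm (P (Suc q) s (f q)) \<le> M * Kd"
          by (rule order_trans[OF PM mult_left_mono[OF fq]]) (use M(1) in simp)
        ultimately have 2: "norm (c i ^ Suc q *\<^sub>R P (Suc q) s (f q)) \<le> cm ^ 6 * (M * Kd)"
          unfolding norm_scaleR using ci nn by (intro mult_mono) (auto simp del: power_Suc)
        have "norm (?W q) \<le> B0"
          unfolding B0_def by (rule order_trans[OF norm_triangle_ineq4 add_mono[OF 1 2]])
        moreover have "h ^ Suc q \<le> ?h" using False h h'(2) by (intro power_decreasing) auto
        ultimately have "h ^ Suc q * norm (?W q) \<le> ?h * B0"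
          using h nn2 by (intro mult_mono) (auto simp del: power_Suc)
        then show ?thesis
          unfolding norm_scaleR using h by (simp add: mult.commute del: power_Suc)
      qed
      then have "norm (\<Sum>q=1..5. h ^ Suc q *\<^sub>R ?W q) \<le> real (card {1..5::nat}) * (B0 * ?h)"
        by (rule sum_norm_bound)
      then show ?thesis by (simp del: power_Suc)
    qed
    have t5: "norm (s ^ 6 *\<^sub>R P 6 s (y 6)) \<le> cm ^ 6 * (M * Kd) * ?h"
    proof -
      have "s ^ 6 \<le> (cm * h) ^ 6" using s by (intro power_mono) auto
      also have "\<dots> = cm ^ 6 * h ^ 6" by (simp add: power_mult_distrib)
      also have "\<dots> \<le> cm ^ 6 * ?h" using h h'(2) Q cm(1) by (intro mult_left_mono power_decreasing) auto
      finally have "s ^ 6 \<le> cm ^ 6 * ?h" .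
      moreover have "norm (P 6 s (y 6)) \<le> M * Kd"
        by (rule order_trans[OF PM mult_left_mono]) (use local_data_bounds(2)[OF ld, of 6] M(1) in auto)
      ultimately have "s ^ 6 * norm (P 6 s (y 6)) \<le> (cm ^ 6 * ?h) * (M * Kd)"
        using h cm(1) by (intro mult_mono) (auto simp del: power_Suc)
      then show ?thesis using s by (simp add: mult_ac del: power_Suc)
    qed
    have E: "?e \<le> ?e + ?h" "?h \<le> ?e + ?h" using h by auto
    have main: "norm (U h v i - \<gamma> y s) \<le> C2 * (?e + ?h)"
    proof -
      have "norm (U h v i - \<gamma> y s) \<le> M * ?e + cm * (M * L) * ?e + 15 * (K * (C1 + L)) * (?e + ?h) + 5 * B0 * ?h + cm ^ 6 * (M * Kd) * ?h"
        unfolding eq by (intro norm_triangle_mono t1 t2 t3 t4 t5)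
      also have "\<dots> \<le> M * (?e + ?h) + cm * (M * L) * (?e + ?h) + 15 * (K * (C1 + L)) * (?e + ?h) + 5 * B0 * (?e + ?h) + cm ^ 6 * (M * Kd) * (?e + ?h)"
        using nn nn2 by (intro add_mono mult_left_mono E order_refl) (auto simp del: power_Suc)
      also have "\<dots> = C2 * (?e + ?h)" unfolding C2_def by (simp only: distrib_right)
      finally show ?thesis .
    qed
    moreover have "norm (U h v i - y 0) < \<rho>"
    proof -
      have "C2 * ?e \<le> (C2 + 1) * (\<rho> / (4 * (C2 + 1)))"
        using nn2 e'(3) by (intro mult_mono) auto
      also have "\<dots> = \<rho> / 4" using nn2 by (simp add: field_simps)
      finally have 1: "C2 * ?e \<le> \<rho> / 4" .
      have "?h \<le> h ^ 1" using h h'(2) by (intro power_decreasing) auto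
      then have "C2 * ?h + 5 * (cm ^ 6 * Kd) * h \<le> C2 * h + 5 * (cm ^ 6 * Kd) * h"
        using nn2 by (intro add_right_mono mult_left_mono) auto
      also have "\<dots> \<le> N * h" using h unfolding N_def by (simp add: algebra_simps)
      also have "\<dots> \<le> N * (\<rho> / (4 * N))" using h'(4) \<open>N > 0\<close> by (intro mult_left_mono) auto
      also have "\<dots> = \<rho> / 4" using \<open>N > 0\<close> by simp
      finally have 2: "C2 * ?h + 5 * (cm ^ 6 * Kd) * h \<le> \<rho> / 4" .
      have "norm (U h v i - y 0) \<le> norm (U h v i - \<gamma> y s) + norm (\<gamma> y s - y 0)"
        using norm_triangle_ineq[of "U h v i - \<gamma> y s" "\<gamma> y s - y 0"] by simp
      also have "\<dots> \<le> C2 * (?e + ?h) + 5 * (cm ^ 6 * Kd) * h"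
        using main gamma_near[OF ld _ ci(2) h(1) h'(2)] ci(1) unfolding s_def by (intro add_mono) auto
      also have "\<dots> = C2 * ?e + (C2 * ?h + 5 * (cm ^ 6 * Kd) * h)" by (simp add: algebra_simps)
      also have "\<dots> < \<rho>" using 1 2 nonneg by linarith
      finally show ?thesis .
    qed
    ultimately show "norm (U h v i - \<gamma> y (c i * h)) \<le> C2 * (?e + ?h) \<and> norm (U h v i - y 0) < \<rho>"
      unfolding s_def by blast
  qed
  moreover have "h0 > 0" "\<epsilon> > 0"
    using C0 nn nn2 \<open>N > 0\<close> by (simp_all add: h0_def \<epsilon>_def)
  ultimately show ?thesis unfolding stage_order_def using nn2 by blast
qed

text \<open>Stage 2 has no predecessors and no moment conditions: it is an exponential Euler step of
  order 2. From there each group is fed only by the preceding one.\<close>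

lemma stage_orders:
  shows "stage_order 2 2" "i \<in> {3,4} \<Longrightarrow> stage_order 3 i" "i \<in> {5..7} \<Longrightarrow> stage_order 4 i"
    "i \<in> {8..11} \<Longrightarrow> stage_order 5 i" "i \<in> {12..15} \<Longrightarrow> stage_order 6 i"
proof -
  have "stage_order (Suc 1) 2"
    by (rule stage_order_Suc[of _ "{}"]) auto
  then show 2: "stage_order 2 2" by (simp add: numeral_2_eq_2)
  have "stage_order (Suc 2) i" if i: "i \<in> {3,4}" for i
  proof (rule stage_order_Suc[of _ "{2}"])
    show "aop h i j v = 0" if "j \<in> {2..<i} - {2}" for h j v
      using i that by (auto simp: aop_def ExpRK6s15_a_def)
    show "(\<Sum>j\<in>{2..<i}. (c j ^ q / fact q) *\<^sub>R a \<phi> i j) = c i ^ Suc q *\<^sub>R \<phi> (Suc q) (c i)" if "1 \<le> q" "q < 2"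
      for q and \<phi> :: "nat \<Rightarrow> real \<Rightarrow> 'a"
    proof -
      have "q = 1" using that by simp
      then show ?thesis using a_moments_2[OF i, of \<phi>] by simp
    qed
  qed (use i 2 in auto)
  then show 3: "i \<in> {3,4} \<Longrightarrow> stage_order 3 i" for i by (simp add: numeral_3_eq_3 numeral_2_eq_2)
  have "stage_order (Suc 3) i" if i: "i \<in> {5..7}" for i
  proof (rule stage_order_Suc[of _ "{3,4}"])
    show "aop h i j v = 0" if "j \<in> {2..<i} - {3,4}" for h j v
      using a_eq_0(3)[OF i, of j] that by (simp add: aop_def)
    show "(\<Sum>j\<in>{2..<i}. (c j ^ q / fact q) *\<^sub>R a \<phi> i j) = c i ^ Suc q *\<^sub>R \<phi> (Suc q) (c i)" if "1 \<le> q" "q < 3"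
      for q and \<phi> :: "nat \<Rightarrow> real \<Rightarrow> 'a"
      using a_moments_3[OF i, of q \<phi>] that by simp
  qed (use i 3 in auto)
  then show 4: "i \<in> {5..7} \<Longrightarrow> stage_order 4 i" for i by simp
  have "stage_order (Suc 4) i" if i: "i \<in> {8..11}" for i
  proof (rule stage_order_Suc[of _ "{5..7}"])
    show "aop h i j v = 0" if "j \<in> {2..<i} - {5..7}" for h j v
      using a_eq_0(2)[OF i, of j] that by (simp add: aop_def)
    show "(\<Sum>j\<in>{2..<i}. (c j ^ q / fact q) *\<^sub>R a \<phi> i j) = c i ^ Suc q *\<^sub>R \<phi> (Suc q) (c i)" if "1 \<le> q" "q < 4"
      for q and \<phi> :: "nat \<Rightarrow> real \<Rightarrow> 'a"
      using a_moments_4[OF i, of q \<phi>] that by simp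
  qed (use i 4 in auto)
  then show 5: "i \<in> {8..11} \<Longrightarrow> stage_order 5 i" for i by simp
  have "stage_order (Suc 5) i" if i: "i \<in> {12..15}" for i
  proof (rule stage_order_Suc[of _ "{8..11}"])
    show "aop h i j v = 0" if "j \<in> {2..<i} - {8..11}" for h j v
      using a_eq_0(1)[OF i, of j] that by (simp add: aop_def)
    show "(\<Sum>j\<in>{2..<i}. (c j ^ q / fact q) *\<^sub>R a \<phi> i j) = c i ^ Suc q *\<^sub>R \<phi> (Suc q) (c i)" if "1 \<le> q" "q < 5"
      for q and \<phi> :: "nat \<Rightarrow> real \<Rightarrow> 'a"
      using a_moments_5[OF i, of q \<phi>] that by simp
  qed (use i 5 in auto)
  then show "i \<in> {12..15} \<Longrightarrow> stage_order 6 i" for i by simp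
qed

section \<open>Invariance of the domain of the generator under the method\<close>

lemma orbit_0: "orbit 0 0"
  by (simp add: orbit_def P_def)

lemma orbit_sum:
  assumes "finite I" "\<And>i. i \<in> I \<Longrightarrow> \<exists>z. orbit (x i) z"
  shows "\<exists>z. orbit (\<Sum>i\<in>I. x i) z"
  using assms
proof (induction I)
  case empty
  then show ?case using orbit_0 by auto
next
  case (insert i I)
  obtain z1 where z1: "orbit (x i) z1" using insert.prems[OF insertI1] by blast
  obtain z2 where z2: "orbit (\<Sum>i\<in>I. x i) z2" using insert.IH[OF insert.prems[OF insertI2]] by blast
  have "orbit (x i + (\<Sum>i\<in>I. x i)) (z1 + z2)" by (rule orbit_add[OF z1 z2])
  then show ?case using insert.hyps by auto
qed

text \<open>T h preserves the domain, and all other terms are images under phi_k(hA) with k \<ge> 1.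
  This keeps A applicable at the next step.\<close>

lemma orbit_step:
  assumes "orbit v (A v)" "h > 0"
  shows "\<exists>z. orbit (step h v) z"
proof -
  have scale: "\<exists>z. orbit (r *\<^sub>R x) z" if "\<exists>z. orbit x z" for r x
    using that orbit_scaleR by blast
  have add: "\<exists>z. orbit (x + y) z" if "\<exists>z. orbit x z" "\<exists>z. orbit y z" for x y
    using that orbit_add by blast
  have bop: "\<exists>z. orbit (bop h i x) z" for i x
  proof -
    obtain \<alpha> where "\<And>\<phi>. b \<phi> i = (\<Sum>k\<in>{2..5}. \<alpha> k *\<^sub>R \<phi> k (1 :: real) :: 'a)"
      using phi_comb_b[of c i] unfolding phi_comb_def by blast
    then have eq: "bop h i x = (\<Sum>k\<in>{2..5}. \<alpha> k *\<^sub>R P k (1 * h) x)"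
      unfolding bop_def by blast
    show ?thesis
      unfolding eq using assms(2) by (intro orbit_sum scale orbit_P_ex) auto
  qed
  have "\<exists>z. orbit (T h v) z" using orbit_T[OF assms(1)] assms(2) by (auto intro: less_imp_le)
  moreover have "\<exists>z. orbit (P 1 h (g v)) z" using assms(2) by (intro orbit_P_ex) auto
  ultimately show ?thesis
    unfolding step_eq[OF assms(1) less_imp_le[OF assms(2)]]
    by (intro add scale orbit_sum bop) auto
qed

text \<open>The defect term is kept explicit instead of being bounded, because only its sum over all
  steps is small enough. The vector \<open>uh\<close> stands for the solution at the next time; just
  its Taylor property is required, as the data are the jet at a single time.\<close>

lemma step_bound:
  obtains C h0 \<epsilon> where "C \<ge> 0" "h0 > 0" "\<epsilon> > 0"
    "\<And>y f v h uh. local_data y f \<Longrightarrow> orbit v (A v) \<Longrightarrow> 0 < h \<Longrightarrow> h \<le> h0 \<Longrightarrow> norm (v - y 0) \<le> \<epsilon> \<Longrightarrow>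
      norm (uh - (\<Sum>q<7. (h ^ q / fact q) *\<^sub>R y q)) \<le> Kd * h ^ 7 \<Longrightarrow>
      norm (step h v - uh - T h (v - y 0) - h ^ 6 *\<^sub>R X h (f 5)) \<le> C * (h * norm (v - y 0) + h ^ 7)"
proof -
  have "finite {12..15::nat}" by simp
  from stage_order_uniform[OF this stage_orders(5)]
  obtain C0 h1 \<epsilon>1 where C0: "C0 \<ge> 0" "h1 > 0" "\<epsilon>1 > 0" "\<forall>j\<in>{12..15}. stage_bound C0 h1 \<epsilon>1 6 j"
    by blast
  obtain M where M: "M \<ge> 1" "\<And>t. 0 \<le> t \<Longrightarrow> t \<le> 1 \<Longrightarrow> norm (T t) \<le> M"
    using T_bounded by blast
  obtain K where K: "K \<ge> 0" "\<And>h i v. 0 \<le> h \<Longrightarrow> h \<le> 1 \<Longrightarrow> i \<in> {2..15} \<Longrightarrow> norm (bop h i v) \<le> K * norm v"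
    using ab_bound[of 1] by metis
  define C1 where "C1 = L * C0 + Cg * cm ^ 6"
  define C2 where "C2 = M * L + 15 * (K * (C1 + L)) + (2 * (M * Kd) + Kd)"
  note nn = nonneg K(1) C0(1) M(1) cm(1)
  have nn2: "0 \<le> C1" "0 \<le> C2" using nn by (simp_all add: C1_def C2_def)
  define \<epsilon> where "\<epsilon> = min \<epsilon>1 (\<rho> / 2)"
  define h0 where "h0 = min h1 (min 1 (\<eta> / cm))"
  have "norm (step h v - uh - T h (v - y 0) - h ^ 6 *\<^sub>R X h (f 5)) \<le> C2 * (h * norm (v - y 0) + h ^ 7)"
    if ld: "local_data y f" and orb: "orbit v (A v)" and h: "0 < h" "h \<le> h0" and e: "norm (v - y 0) \<le> \<epsilon>"
      and uh: "norm (uh - (\<Sum>q<7. (h ^ q / fact q) *\<^sub>R y q)) \<le> Kd * h ^ 7" for y f v h uh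
  proof -
    have h': "0 \<le> h" "h \<le> h1" "h \<le> 1" "h \<le> \<eta> / cm" using h by (auto simp: h0_def)
    have e': "norm (v - y 0) \<le> \<epsilon>1" "norm (v - y 0) \<le> \<rho> / 2" using e by (auto simp: \<epsilon>_def)
    have cmh: "cm * h \<le> \<eta>" using h'(4) cm(1) by (simp add: pos_le_divide_eq mult.commute)
    let ?e = "norm (v - y 0)"
    let ?r = "\<lambda>j. g (U h v j) - \<gamma> f (c j * h)"
    let ?W = "\<lambda>q. (\<Sum>j\<in>{2..15}. (c j ^ q / fact q) *\<^sub>R bop h j (f q)) - 1 ^ Suc q *\<^sub>R P (Suc q) h (f q)"
    let ?Y = "\<Sum>q<7. (h ^ q / fact q) *\<^sub>R y q"
    have PM: "norm (P k h x) \<le> M * norm x" for k x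
      using norm_P_le[OF h'(1,3) M(2)] .
    have lin: "linear (bop h j)" for j
      using bounded_linear.linear[OF bop_bounded_linear[OF h'(1)]] .
    \<comment> \<open>The moments of \<open>b\<close> remove the defects with q \<le> 4; the one
      with q = 5 is the operator \<open>X\<close>.\<close>
    have W: "(\<Sum>q=1..5. h ^ Suc q *\<^sub>R ?W q) = h ^ 6 *\<^sub>R X h (f 5)"
    proof -
      have W0: "?W q = 0" if "q \<in> {1..4}" for q
        using b_moments[OF that, of "\<lambda>k r. P k (r * h) (f q)"] by (simp add: bop_def)
      have "(\<Sum>q=1..5. h ^ Suc q *\<^sub>R ?W q) = (\<Sum>q\<in>{5}. h ^ Suc q *\<^sub>R ?W q)"
      proof (rule sum.mono_neutral_right)
        show "\<forall>q\<in>{1..5} - {5}. h ^ Suc q *\<^sub>R ?W q = 0"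
        proof
          fix q :: nat assume "q \<in> {1..5} - {5}"
          then have "q \<in> {1..4}" by auto
          from W0[OF this] show "h ^ Suc q *\<^sub>R ?W q = 0" by simp
        qed
      qed auto
      also have "\<dots> = h ^ 6 *\<^sub>R X h (f 5)"
        unfolding X_def by (simp del: power_Suc)
      finally show ?thesis .
    qed
    have eq: "step h v - uh - T h (v - y 0) - h ^ 6 *\<^sub>R X h (f 5) = h *\<^sub>R P 1 h (g v - f 0)
        + h *\<^sub>R (\<Sum>j\<in>{2..15}. bop h j (?r j - (g v - f 0))) + (h ^ 7 *\<^sub>R (P 7 h (y 7) - P 7 h (f 6)) - (uh - ?Y))"
    proof -
      have "step h v = (T h (y 0) + (\<Sum>q<6. h ^ Suc q *\<^sub>R P (Suc q) h (f q))) + T h (v - y 0) + h *\<^sub>R P 1 h (g v - f 0)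
        + h *\<^sub>R (\<Sum>j\<in>{2..15}. bop h j (?r j - (g v - f 0))) + (\<Sum>q=1..5. h ^ Suc q *\<^sub>R ?W q)"
        unfolding step_eq[OF orb h'(1)]
        by (rule quadrature_identity) (use lin h' in auto)
      \<comment> \<open>The Taylor expansion goes one degree further than the quadrature identity,
        so the term with f 6 joins the remainder of order h^7.\<close>
      moreover have "T h (y 0) + (\<Sum>q<6. h ^ Suc q *\<^sub>R P (Suc q) h (f q)) = ?Y + h ^ 7 *\<^sub>R (P 7 h (y 7) - P 7 h (f 6))"
      proof -
        have six: "Suc 6 = (7::nat)" by simp
        have "(\<Sum>q<7. h ^ Suc q *\<^sub>R P (Suc q) h (f q)) = (\<Sum>q<6. h ^ Suc q *\<^sub>R P (Suc q) h (f q)) + h ^ 7 *\<^sub>R P 7 h (f 6)"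
          using sum.lessThan_Suc[of "\<lambda>q. h ^ Suc q *\<^sub>R P (Suc q) h (f q)" 6] unfolding six .
        moreover have "T h (y 0) + (\<Sum>q<7. h ^ Suc q *\<^sub>R P (Suc q) h (f q)) = ?Y + h ^ 7 *\<^sub>R P 7 h (y 7)"
          using taylor_expansion[OF ld h'(1), of 6] unfolding six by simp
        ultimately show ?thesis by (simp add: algebra_simps)
      qed
      ultimately show ?thesis unfolding W by simp
    qed
    have r0: "norm (g v - f 0) \<le> L * ?e"
      by (rule residual_bound_0[OF ld]) (use e'(2) nonneg in linarith)
    have t2: "norm (h *\<^sub>R P 1 h (g v - f 0)) \<le> M * L * (h * ?e)"
    proof -
      have "h * norm (P 1 h (g v - f 0)) \<le> h * (M * (L * ?e))"
        using h' M(1) by (intro mult_left_mono order_trans[OF PM mult_left_mono[OF r0]]) auto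
      then show ?thesis using h by (simp add: mult_ac)
    qed
    have t3: "norm (h *\<^sub>R (\<Sum>j\<in>{2..15}. bop h j (?r j - (g v - f 0)))) \<le> 15 * (K * (C1 + L)) * (h * ?e + h ^ 7)"
    proof -
      have "norm (bop h j (?r j - (g v - f 0))) \<le> K * (C1 * (?e + h ^ 6) + L * ?e)" if j: "j \<in> {2..15}" for j
      proof (cases "j \<in> {12..15}")
        case True
        have "norm (?r j) \<le> C1 * (?e + h ^ 6)"
          unfolding C1_def using C0(4) True by (intro stage_residual[OF ld _ orb h(1) h'(2,3) cmh e'(1) j]) auto
        then have "norm (?r j - (g v - f 0)) \<le> C1 * (?e + h ^ 6) + L * ?e"
          using r0 norm_triangle_ineq4[of "?r j" "g v - f 0"] by linarith
        then show ?thesis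
          using K(2)[OF h'(1,3) j, of "?r j - (g v - f 0)"] K(1)
          by (meson mult_left_mono order_trans)
      next
        case False
        then show ?thesis using nn nn2 h by (simp add: bop_def b_eq_0)
      qed
      then have "norm (\<Sum>j\<in>{2..15}. bop h j (?r j - (g v - f 0))) \<le> real (card {2..15::nat}) * (K * (C1 * (?e + h ^ 6) + L * ?e))"
        by (rule sum_norm_bound)
      also have "\<dots> \<le> 15 * (K * (C1 * (?e + h ^ 6) + L * ?e))"
        using nn nn2 h by (intro mult_right_mono) auto
      finally have "h * norm (\<Sum>j\<in>{2..15}. bop h j (?r j - (g v - f 0))) \<le> h * (15 * (K * (C1 * (?e + h ^ 6) + L * ?e)))"
        using h by (intro mult_left_mono) auto
      also have "\<dots> = 15 * (K * (C1 * (h * ?e + h ^ 7) + L * (h * ?e)))"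
        by (simp add: algebra_simps power_numeral_reduce)
      also have "\<dots> \<le> 15 * (K * (C1 * (h * ?e + h ^ 7) + L * (h * ?e + h ^ 7)))"
        using nn nn2 h by (intro mult_left_mono add_mono) auto
      also have "\<dots> = 15 * (K * (C1 + L)) * (h * ?e + h ^ 7)" by (simp add: algebra_simps)
      finally show ?thesis using h by simp
    qed
    have t4: "norm (h ^ 7 *\<^sub>R (P 7 h (y 7) - P 7 h (f 6)) - (uh - ?Y)) \<le> (2 * (M * Kd) + Kd) * h ^ 7"
    proof -
      have "norm (P 7 h (y 7)) \<le> M * Kd"
        by (rule order_trans[OF PM mult_left_mono]) (use local_data_bounds(2)[OF ld, of 7] M(1) in auto)
      moreover have "norm (P 7 h (f 6)) \<le> M * Kd"
        by (rule order_trans[OF PM mult_left_mono]) (use local_data_bounds(1)[OF ld, of 6] M(1) in auto)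
      ultimately have "norm (P 7 h (y 7) - P 7 h (f 6)) \<le> 2 * (M * Kd)"
        using norm_triangle_ineq4[of "P 7 h (y 7)" "P 7 h (f 6)"] by linarith
      then have "h ^ 7 * norm (P 7 h (y 7) - P 7 h (f 6)) \<le> h ^ 7 * (2 * (M * Kd))"
        using h by (intro mult_left_mono) auto
      then have "norm (h ^ 7 *\<^sub>R (P 7 h (y 7) - P 7 h (f 6))) \<le> 2 * (M * Kd) * h ^ 7"
        using h by (simp add: mult.commute)
      then show ?thesis
        using uh norm_triangle_ineq4[of "h ^ 7 *\<^sub>R (P 7 h (y 7) - P 7 h (f 6))" "uh - ?Y"] by (simp add: distrib_right)
    qed
    have "norm (step h v - uh - T h (v - y 0) - h ^ 6 *\<^sub>R X h (f 5)) \<le>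
        M * L * (h * ?e) + 15 * (K * (C1 + L)) * (h * ?e + h ^ 7) + (2 * (M * Kd) + Kd) * h ^ 7"
      unfolding eq by (intro norm_triangle_mono t2 t3 t4)
    also have "\<dots> \<le> M * L * (h * ?e + h ^ 7) + 15 * (K * (C1 + L)) * (h * ?e + h ^ 7) + (2 * (M * Kd) + Kd) * (h * ?e + h ^ 7)"
      using nn nn2 h by (intro add_mono mult_left_mono order_refl) auto
    also have "\<dots> = C2 * (h * ?e + h ^ 7)" unfolding C2_def by (simp only: distrib_right)
    finally show ?thesis .
  qed
  moreover have "h0 > 0" "\<epsilon> > 0"
    using C0 nn by (simp_all add: h0_def \<epsilon>_def)
  ultimately show ?thesis using that nn2 by blast
qed

section \<open>Global error\<close>

text \<open>The discrete variation of constants formula.\<close>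

lemma T_linear_recursion:
  assumes z: "z 0 = 0" "\<And>j. j < n \<Longrightarrow> z (Suc j) = T h (z j) + r j" and h: "h \<ge> 0" and k: "k \<le> n"
  shows "z k = (\<Sum>j<k. T (real (k - Suc j) * h) (r j))"
  using k
proof (induction k)
  case (Suc k)
  have "z (Suc k) = T h (\<Sum>j<k. T (real (k - Suc j) * h) (r j)) + r k"
    using z(2)[of k] Suc by simp
  also have "T h (\<Sum>j<k. T (real (k - Suc j) * h) (r j)) = (\<Sum>j<k. T (real (Suc k - Suc j) * h) (r j))"
    unfolding blinfun.sum_right
  proof (rule sum.cong[OF refl])
    fix j assume "j \<in> {..<k}"
    then have "real (Suc k - Suc j) * h = h + real (k - Suc j) * h"
      by (simp add: of_nat_diff algebra_simps)
    then show "T h (T (real (k - Suc j) * h) (r j)) = T (real (Suc k - Suc j) * h) (r j)"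
      using T_add_apply[of h "real (k - Suc j) * h" "r j"] h by simp
  qed
  finally show ?case by simp
qed (use z in simp)

text \<open>Summation by parts. The partial sums S are bounded in norm by a multiple of their
  argument; applied to increments of w of size h, they add up to a bounded quantity over at most R /
  h steps.\<close>

lemma smoothed_recursion:
  assumes z: "z 0 = 0" "\<And>j. j < n \<Longrightarrow> z (Suc j) = T h (z j) + X h (w j)" and h: "h \<ge> 0" and k: "Suc k \<le> n"
  defines "S \<equiv> \<lambda>m x. \<Sum>j<m. T (real j * h) (X h x)"
  shows "z (Suc k) = S (Suc k) (w 0) + (\<Sum>l<k. S (k - l) (w (Suc l) - w l))"
  using k
proof (induction k)
  case 0
  then show ?case using z by (simp add: S_def)
next
  case (Suc k)
  have S_Suc: "T h (S m x) = S (Suc m) x - X h x" for m x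
  proof -
    have "S (Suc m) x = X h x + (\<Sum>j<m. T (real (Suc j) * h) (X h x))"
      unfolding S_def by (subst sum.lessThan_Suc_shift) simp
    moreover have "(\<Sum>j<m. T (real (Suc j) * h) (X h x)) = T h (S m x)"
      unfolding S_def blinfun.sum_right
      using T_add_apply[of h "real _ * h"] h by (intro sum.cong) (auto simp: distrib_right)
    ultimately show ?thesis by simp
  qed
  have tele: "(\<Sum>l<Suc k. X h (w (Suc l) - w l)) = X h (w (Suc k)) - X h (w 0)"
    using sum_lessThan_telescope[of "\<lambda>l. X h (w l)" "Suc k"] X_diff[OF h] by simp
  have "z (Suc (Suc k)) = T h (S (Suc k) (w 0) + (\<Sum>l<k. S (k - l) (w (Suc l) - w l))) + X h (w (Suc k))"
    using z(2)[of "Suc k"] Suc by simp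
  also have "\<dots> = S (Suc (Suc k)) (w 0) - X h (w 0) + (\<Sum>l<k. S (Suc (k - l)) (w (Suc l) - w l) - X h (w (Suc l) - w l)) + X h (w (Suc k))"
    by (simp only: blinfun.add_right blinfun.sum_right S_Suc)
  also have "(\<Sum>l<k. S (Suc (k - l)) (w (Suc l) - w l) - X h (w (Suc l) - w l)) =
      (\<Sum>l<Suc k. S (Suc k - l) (w (Suc l) - w l)) - (\<Sum>l<Suc k. X h (w (Suc l) - w l))"
    by (simp add: sum_subtractf Suc_diff_le S_def)
  finally show ?case unfolding tele by simp
qed

text \<open>A one-step form of Gronwall's lemma, usable inside a strong induction in which the
  hypothesis at n itself depends on the bounds already obtained.\<close>

lemma gronwall_step:
  fixes d :: "nat \<Rightarrow> real"
  assumes "d n \<le> \<alpha> + \<kappa> * (\<Sum>j<n. d j)" "\<And>j. j < n \<Longrightarrow> d j \<le> \<alpha> * (1 + \<kappa>) ^ j" "\<kappa> \<ge> 0"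
  shows "d n \<le> \<alpha> * (1 + \<kappa>) ^ n"
proof -
  have "\<kappa> * (\<Sum>j<n. d j) \<le> \<kappa> * (\<Sum>j<n. \<alpha> * (1 + \<kappa>) ^ j)"
    using assms(2,3) by (intro mult_left_mono sum_mono) auto
  moreover have "\<alpha> + \<kappa> * (\<Sum>j<n. \<alpha> * (1 + \<kappa>) ^ j) = \<alpha> * (1 + \<kappa>) ^ n" for n
    by (induction n) (simp_all add: algebra_simps)
  ultimately show ?thesis using assms(1) by (metis add_left_mono order_trans)
qed

text \<open>The local estimate is valid only while the error is at most \<epsilon>. The induction
  therefore derives this smallness for earlier steps from the bound of order h^6, which is below
  \<epsilon> once h is small.\<close>

lemma convergence:
  fixes ju jf :: "real \<Rightarrow> nat \<Rightarrow> 'a"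
  assumes A: "\<And>v z. orbit v z \<Longrightarrow> orbit v (A v)" and I: "t0 < tend"
    and ld: "\<And>t. t \<in> {t0..tend} \<Longrightarrow> local_data (ju t) (jf t)"
    and taylor: "\<And>t h. t \<in> {t0..tend} \<Longrightarrow> 0 < h \<Longrightarrow> t + h \<in> {t0..tend} \<Longrightarrow>
      norm (ju (t + h) 0 - (\<Sum>q<7. (h ^ q / fact q) *\<^sub>R ju t q)) \<le> Kd * h ^ 7"
    and F5: "\<And>t h. t \<in> {t0..tend} \<Longrightarrow> 0 < h \<Longrightarrow> t + h \<in> {t0..tend} \<Longrightarrow> norm (jf (t + h) 5 - jf t 5) \<le> Kd * h"
  shows "\<exists>C. \<exists>h0>0. \<forall>h n. 0 < h \<longrightarrow> h \<le> h0 \<longrightarrow> t0 + real n * h \<le> tend \<longrightarrow>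
    norm ((step h ^^ n) (ju t0 0) - ju (t0 + real n * h) 0) \<le> C * h ^ 6"
proof -
  define R where "R = tend - t0"
  have R: "R > 0" using I by (simp add: R_def)
  obtain M where M: "M \<ge> 1" "\<And>t. 0 \<le> t \<Longrightarrow> t \<le> R \<Longrightarrow> norm (T t) \<le> M"
    using T_bounded by blast
  obtain Cx where Cx: "Cx \<ge> 0" "\<And>h n x. 0 < h \<Longrightarrow> real n * h \<le> R \<Longrightarrow> norm (\<Sum>j<n. T (real j * h) (X h x)) \<le> Cx * norm x"
    using X_sums_bounded by blast
  obtain C h1 \<epsilon> where C: "C \<ge> 0" "h1 > 0" "\<epsilon> > 0"
    "\<And>y f v h uh. local_data y f \<Longrightarrow> orbit v (A v) \<Longrightarrow> 0 < h \<Longrightarrow> h \<le> h1 \<Longrightarrow> norm (v - y 0) \<le> \<epsilon> \<Longrightarrow>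
      norm (uh - (\<Sum>q<7. (h ^ q / fact q) *\<^sub>R y q)) \<le> Kd * h ^ 7 \<Longrightarrow>
      norm (step h v - uh - T h (v - y 0) - h ^ 6 *\<^sub>R X h (f 5)) \<le> C * (h * norm (v - y 0) + h ^ 7)"
    using step_bound by blast
  \<comment> \<open>The first two terms bound the accumulated defects: the initial value of f^(5),
    and its increments over a time R. The third sums the remainders of size h^7. Gronwall's lemma
    adds the exponential factor in \<open>C4\<close>.\<close>
  define C3 where "C3 = Cx * Kd + R * (Cx * Kd) + M * C * R"
  define C4 where "C4 = C3 * exp (M * C * R)"
  have nn: "C3 \<ge> 0" "C4 \<ge> 0" using nonneg Cx C M R by (simp_all add: C3_def C4_def)
  define h0 where "h0 = min h1 (min 1 (\<epsilon> / (C4 + 1)))"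
  have h0: "h0 > 0" using C nn by (simp add: h0_def)
  have "norm ((step h ^^ n) (ju t0 0) - ju (t0 + real n * h) 0) \<le> C4 * h ^ 6"
    if h: "0 < h" "h \<le> h0" and N: "t0 + real n * h \<le> tend" for h n
  proof -
    define t where "t j = t0 + real j * h" for j
    define v where "v j = (step h ^^ j) (ju t0 0)" for j
    define d where "d j = v j - ju (t j) 0" for j
    have h': "0 \<le> h" "h \<le> h1" "h \<le> 1" "h \<le> \<epsilon> / (C4 + 1)" using h by (auto simp: h0_def)
    have tI: "t j \<in> {t0..tend}" if "j \<le> n" for j
    proof -
      have "real j * h \<le> real n * h" using that h by (intro mult_right_mono) auto
      then have "t0 + real j * h \<le> tend" using N by linarith
      then show ?thesis using h by (simp add: t_def)
    qed
    have t_Suc: "t (Suc j) = t j + h" for j by (simp add: t_def algebra_simps)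
    have orb: "orbit (v j) (A (v j))" for j
    proof (induction j)
      case 0
      have "orbit (ju t0 0) (ju t0 (Suc 0) - jf t0 0)" using ld[of t0] I by (simp add: local_data_def)
      then show ?case using A by (simp add: v_def)
    next
      case (Suc j)
      then show ?case using orbit_step[OF Suc h(1)] A by (auto simp: v_def)
    qed
    define r where "r j = d (Suc j) - T h (d j) - h ^ 6 *\<^sub>R X h (jf (t j) 5)" for j
    have d_0: "d 0 = 0" by (simp add: d_def v_def t_def)
    have r: "norm (r j) \<le> C * (h * norm (d j) + h ^ 7)" if j: "j < n" and dj: "norm (d j) \<le> \<epsilon>" for j
    proof -
      have "norm (ju (t j + h) 0 - (\<Sum>q<7. (h ^ q / fact q) *\<^sub>R ju (t j) q)) \<le> Kd * h ^ 7"
        by (rule taylor) (use tI[of j] tI[of "Suc j"] j h t_Suc in auto)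
      from C(4)[OF ld[OF tI] orb h(1) h'(2) _ this] j dj
      show ?thesis by (simp add: r_def d_def v_def t_Suc)
    qed
    \<comment> \<open>The defects alone, propagated by the semigroup and without their factor h^6.
      Subtracting them from the error leaves a recursion driven by \<open>r\<close>, for which norm
      estimates suffice.\<close>
    define z where "z = rec_nat 0 (\<lambda>j zj. T h zj + X h (jf (t j) 5))"
    have z: "z 0 = 0" "z (Suc j) = T h (z j) + X h (jf (t j) 5)" for j by (simp_all add: z_def)
    have zb: "norm (z k) \<le> Cx * Kd + R * (Cx * Kd)" if k: "k \<le> n" for k
    proof (cases k)
      case 0
      then show ?thesis using z nonneg Cx R by simp
    next
      case (Suc m)
      have mR: "real l * h \<le> R" if "l \<le> n" for l
        using tI[OF that] by (simp add: t_def R_def)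
      have Fb: "norm (jf (t 0) 5) \<le> Kd" using local_data_bounds(1)[OF ld[OF tI[of 0]], of 5] by simp
      have zA: "norm (\<Sum>j<Suc m. T (real j * h) (X h (jf (t 0) 5))) \<le> Cx * Kd"
        by (rule order_trans[OF Cx(2)[OF h(1) mR] mult_left_mono[OF Fb Cx(1)]]) (use k Suc in simp)
      have zB: "norm (\<Sum>l<m. \<Sum>j<m - l. T (real j * h) (X h (jf (t (Suc l)) 5 - jf (t l) 5))) \<le> R * (Cx * Kd)"
      proof -
        have "norm (\<Sum>j<m - l. T (real j * h) (X h (jf (t (Suc l)) 5 - jf (t l) 5))) \<le> Cx * (Kd * h)" if l: "l \<in> {..<m}" for l
        proof (rule order_trans[OF Cx(2)[OF h(1) mR]])
          show "m - l \<le> n" using Suc k by simp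
          have "norm (jf (t (Suc l)) 5 - jf (t l) 5) \<le> Kd * h"
            unfolding t_Suc by (rule F5) (use tI[of l] tI[of "Suc l"] l k Suc h t_Suc in auto)
          then show "Cx * norm (jf (t (Suc l)) 5 - jf (t l) 5) \<le> Cx * (Kd * h)"
            using Cx(1) by (rule mult_left_mono)
        qed
        then have "norm (\<Sum>l<m. \<Sum>j<m - l. T (real j * h) (X h (jf (t (Suc l)) 5 - jf (t l) 5))) \<le> real (card {..<m}) * (Cx * (Kd * h))"
          by (rule sum_norm_bound)
        also have "\<dots> = (real m * h) * (Cx * Kd)" by simp
        also have "\<dots> \<le> R * (Cx * Kd)"
          using mR[of m] Suc k Cx nonneg by (intro mult_right_mono) auto
        finally show ?thesis .
      qed
      have zE: "z (Suc m) = (\<Sum>j<Suc m. T (real j * h) (X h (jf (t 0) 5))) +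
          (\<Sum>l<m. \<Sum>j<m - l. T (real j * h) (X h (jf (t (Suc l)) 5 - jf (t l) 5)))"
        by (rule smoothed_recursion[where n = "Suc m"]) (use z h in auto)
      show ?thesis
        unfolding Suc zE by (rule norm_triangle_mono[OF zA zB])
    qed
    have q: "d k - h ^ 6 *\<^sub>R z k = (\<Sum>j<k. T (real (k - Suc j) * h) (r j))" for k
      by (rule T_linear_recursion[where n = k])
        (use z d_0 h in \<open>auto simp: r_def blinfun.diff_right blinfun.scaleR_right scaleR_add_right\<close>)
    have db: "norm (d k) \<le> h ^ 6 * C3 + (M * C * h) * (\<Sum>j<k. norm (d j))"
      if k: "k \<le> n" and small: "\<And>j. j < k \<Longrightarrow> norm (d j) \<le> \<epsilon>" for k
    proof -
      have kR: "real k * h \<le> R" using tI[OF k] by (simp add: t_def R_def)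
      have "norm (\<Sum>j<k. T (real (k - Suc j) * h) (r j)) \<le> (\<Sum>j<k. M * (C * (h * norm (d j) + h ^ 7)))"
      proof (rule sum_norm_le)
        fix j assume j: "j \<in> {..<k}"
        have "real (k - Suc j) * h \<le> real k * h" using h by (intro mult_right_mono) auto
        then have "real (k - Suc j) * h \<le> R" using kR by linarith
        moreover have "0 \<le> real (k - Suc j) * h" using h by simp
        ultimately have "norm (T (real (k - Suc j) * h)) \<le> M" by (intro M(2))
        moreover have "norm (r j) \<le> C * (h * norm (d j) + h ^ 7)" using j k small by (intro r) auto
        ultimately show "norm (T (real (k - Suc j) * h) (r j)) \<le> M * (C * (h * norm (d j) + h ^ 7))"
          using M(1) by (intro order_trans[OF norm_blinfun] mult_mono) auto
      qed
      also have "\<dots> = (M * C * h) * (\<Sum>j<k. norm (d j)) + (M * C * (real k * h)) * h ^ 6"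
        by (simp add: sum_distrib_left sum.distrib algebra_simps power_numeral_reduce)
      also have "\<dots> \<le> (M * C * h) * (\<Sum>j<k. norm (d j)) + (M * C * R) * h ^ 6"
        using kR M C h by (intro add_left_mono mult_right_mono mult_left_mono) auto
      finally have "norm (d k - h ^ 6 *\<^sub>R z k) \<le> (M * C * h) * (\<Sum>j<k. norm (d j)) + (M * C * R) * h ^ 6"
        unfolding q .
      moreover have "norm (h ^ 6 *\<^sub>R z k) \<le> h ^ 6 * (Cx * Kd + R * (Cx * Kd))"
        using zb[OF k] h by (simp add: mult_left_mono)
      ultimately show ?thesis
        using norm_triangle_ineq[of "d k - h ^ 6 *\<^sub>R z k" "h ^ 6 *\<^sub>R z k"] by (simp add: C3_def algebra_simps)
    qed
    have exp_le: "(h ^ 6 * C3) * (1 + M * C * h) ^ k \<le> C4 * h ^ 6" if k: "k \<le> n" for k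
    proof -
      have "(1 + M * C * h) ^ k \<le> exp (M * C * h) ^ k"
        using M C h exp_ge_add_one_self[of "M * C * h"] by (intro power_mono) auto
      also have "\<dots> = exp (M * C * (real k * h))"
        by (simp add: exp_of_nat_mult[symmetric] mult_ac)
      also have "\<dots> \<le> exp (M * C * R)"
        using tI[OF k] M C by (auto simp: t_def R_def intro!: mult_left_mono)
      finally have "(h ^ 6 * C3) * (1 + M * C * h) ^ k \<le> (h ^ 6 * C3) * exp (M * C * R)"
        using nn h by (intro mult_left_mono) auto
      then show ?thesis by (simp add: C4_def mult_ac)
    qed
    have small: "C4 * h ^ 6 \<le> \<epsilon>"
    proof -
      have "h ^ 6 \<le> h ^ 1" using h' by (intro power_decreasing) auto
      then have "C4 * h ^ 6 \<le> (C4 + 1) * (\<epsilon> / (C4 + 1))"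
        using h' nn by (intro mult_mono) auto
      then show ?thesis using nn by simp
    qed
    have "k \<le> n \<Longrightarrow> norm (d k) \<le> (h ^ 6 * C3) * (1 + M * C * h) ^ k" for k
    proof (induction k rule: less_induct)
      case (less k)
      show ?case
      proof (rule gronwall_step)
        show "norm (d k) \<le> h ^ 6 * C3 + M * C * h * (\<Sum>j<k. norm (d j))"
        proof (rule db[OF less.prems])
          fix j assume j: "j < k"
          then have "norm (d j) \<le> (h ^ 6 * C3) * (1 + M * C * h) ^ j" using less by auto
          also have "\<dots> \<le> C4 * h ^ 6" using j less.prems by (intro exp_le) auto
          finally show "norm (d j) \<le> \<epsilon>" using small by linarith
        qed
        show "norm (d j) \<le> (h ^ 6 * C3) * (1 + M * C * h) ^ j" if "j < k" for j
          using less that by auto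
      qed (use M C h in auto)
    qed
    from order_trans[OF this exp_le] have "norm (d n) \<le> C4 * h ^ 6" by simp
    then show ?thesis by (simp add: d_def v_def t_def)
  qed
  then show ?thesis using h0 by blast
qed

end

section \<open>The jets of the exact solution\<close>

lemma taylor_bound:
  fixes D :: "nat \<Rightarrow> real \<Rightarrow> 'a::banach"
  assumes p: "p \<ge> 1" and ab: "a \<le> b"
    and D: "\<And>m t. m < p \<Longrightarrow> a \<le> t \<Longrightarrow> t \<le> b \<Longrightarrow> (D m has_vector_derivative D (Suc m) t) (at t within {a..b})"
    and B: "\<And>t. a \<le> t \<Longrightarrow> t \<le> b \<Longrightarrow> norm (D p t) \<le> B"
  shows "norm (D 0 b - (\<Sum>i<p. ((b - a) ^ i / fact i) *\<^sub>R D i a)) \<le> B * (b - a) ^ p"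
proof -
  let ?i = "\<lambda>x. ((b - x) ^ (p - 1) / fact (p - 1)) *\<^sub>R D p x"
  have "B \<ge> 0" using B[of a] ab norm_ge_zero order_trans by blast
  have "(?i has_integral D 0 b - (\<Sum>i<p. ((b - a) ^ i / fact i) *\<^sub>R D i a)) {a..b}"
    by (rule Taylor_has_integral) (use p ab D in auto)
  moreover have "((\<lambda>_. (b - a) ^ (p - 1) * B) has_integral (b - a) ^ (p - 1) * B * (b - a)) {a..b}"
    using has_integral_const_real[of "(b - a) ^ (p - 1) * B" a b] ab by (simp add: mult.commute)
  moreover have "norm (?i x) \<le> (b - a) ^ (p - 1) * B" if x: "x \<in> {a..b}" for x
  proof -
    have "(b - x) ^ (p - 1) / fact (p - 1) \<le> (b - a) ^ (p - 1) / 1"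
      using x by (intro frac_le power_mono) auto
    then have "((b - x) ^ (p - 1) / fact (p - 1)) * norm (D p x) \<le> (b - a) ^ (p - 1) * B"
      using x B ab by (intro mult_mono) auto
    then show ?thesis using x by simp
  qed
  ultimately have "norm (D 0 b - (\<Sum>i<p. ((b - a) ^ i / fact i) *\<^sub>R D i a)) \<le> (b - a) ^ (p - 1) * B * (b - a)"
    by (metis (no_types, lifting) has_integral_integrable has_integral_integral integral_norm_bound_integral integral_unique)
  also have "\<dots> = B * (b - a) ^ p"
    using p by (cases p) auto
  finally show ?thesis .
qed

lemma polynomial_jet_deriv:
  fixes z :: "nat \<Rightarrow> 'a::real_normed_vector"
  shows "((\<lambda>r. \<Sum>q<n. (r ^ q / fact q) *\<^sub>R z q) has_vector_derivative (\<Sum>q<n - 1. (r ^ q / fact q) *\<^sub>R z (Suc q))) (at r within S)"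
proof (cases n)
  case (Suc m)
  have "((\<lambda>r. \<Sum>q<Suc m. (r ^ q / fact q) *\<^sub>R z q) has_vector_derivative (\<Sum>q<m. (r ^ q / fact q) *\<^sub>R z (Suc q))) (at r within S)"
  proof (induction m)
    case 0
    then show ?case by simp
  next
    case (Suc m)
    have "((\<lambda>r. r ^ Suc m / fact (Suc m)) has_real_derivative (real (Suc m) * r ^ (Suc m - Suc 0)) / fact (Suc m)) (at r within S)"
      by (rule DERIV_cdivide[OF DERIV_pow[THEN has_field_derivative_at_within]])
    then have "((\<lambda>r. r ^ Suc m / fact (Suc m)) has_real_derivative r ^ m / fact m) (at r within S)"
      by (simp del: of_nat_Suc power_Suc)
    from has_vector_derivative_scaleR[OF this has_vector_derivative_const[of "z (Suc m)"]]
    have "((\<lambda>r. (r ^ Suc m / fact (Suc m)) *\<^sub>R z (Suc m)) has_vector_derivative (r ^ m / fact m) *\<^sub>R z (Suc m)) (at r within S)"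
      by simp
    from has_vector_derivative_add[OF Suc this] show ?case
      by (simp only: sum.lessThan_Suc)
  qed
  then show ?thesis by (simp only: Suc diff_Suc_1)
qed simp

lemma bounded_Frechet_derivatives_imp_chain:
  fixes g :: "'a::real_normed_vector \<Rightarrow> 'a"
  assumes "bounded_Frechet_derivatives m g S"
  shows "\<exists>G. frechet_chain m g S G"
  using assms unfolding bounded_Frechet_derivatives_def
proof (elim exE conjE)
  fix G :: "nat \<Rightarrow> 'a \<Rightarrow> 'a list \<Rightarrow> 'a"
  assume 0: "\<forall>x\<in>S. G 0 x [] = g x"
    and 1: "\<forall>k\<in>{1..m}. \<exists>M. \<forall>x\<in>S. \<forall>vs. length vs = k \<longrightarrow>
           (\<forall>i<k. linear (\<lambda>w. G k x (vs[i := w]))) \<and>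
           norm (G k x vs) \<le> M * prod_list (map norm vs)"
    and 2: "\<forall>k<m. \<forall>x\<in>S. \<forall>\<epsilon>>0. \<exists>\<delta>>0. \<forall>y\<in>S. dist y x < \<delta> \<longrightarrow>
           (\<forall>vs. length vs = k \<longrightarrow>
              norm (G k y vs - G k x vs - G (Suc k) x ((y - x) # vs))
                \<le> \<epsilon> * norm (y - x) * prod_list (map norm vs))"
  have "frechet_chain m g S G"
    by (rule frechet_chain.intro[OF bspec[OF 0] bspec[OF 1] 2[rule_format]])
  then show "\<exists>G. frechet_chain m g S G" by blast
qed

text \<open>Seven derivatives are required because the Taylor remainder of one step has to be of
  order h^7. What remains is to construct the jets of u and of g along u, with bounds uniform in
  time.\<close>

lemma sixth_order_convergence:
  fixes c :: "nat \<Rightarrow> real" and T :: "real \<Rightarrow> 'a::banach \<Rightarrow>\<^sub>L 'a"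
  assumes "exprk_semigroup c T" and gen: "generates A D T" and I: "t0 < tend"
    and ivp: "solves_ivp A D g t0 tend u0 u"
    and td: "bounded_time_derivatives 7 u {t0..tend}"
    and fd: "\<rho> > 0" "bounded_Frechet_derivatives 7 g (strip u {t0..tend} \<rho>)"
  shows "\<exists>C. \<exists>h0>0. \<forall>h n. 0 < h \<longrightarrow> h \<le> h0 \<longrightarrow> t0 + real n * h \<le> tend \<longrightarrow>
    norm (ExpRK6s15_solution c A T g h u0 n - u (t0 + real n * h)) \<le> C * h ^ 6"
proof -
  interpret exprk_semigroup c T by fact
  let ?I = "{t0..tend}" and ?S = "strip u {t0..tend} \<rho>"
  obtain ju :: "nat \<Rightarrow> real \<Rightarrow> 'a" where ju_0: "\<And>t. t \<in> ?I \<Longrightarrow> ju 0 t = u t"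
    and ju: "\<And>k t. k < 7 \<Longrightarrow> t \<in> ?I \<Longrightarrow> (ju k has_vector_derivative ju (Suc k) t) (at t within ?I)"
    and ju_bounded: "\<And>k. k \<le> 7 \<Longrightarrow> bounded (ju k ` ?I)"
    using td unfolding bounded_time_derivatives_def by blast
  obtain G where "frechet_chain 7 g ?S G"
    using bounded_Frechet_derivatives_imp_chain[OF fd(2)] by (rule exE)
  then interpret fc: frechet_chain 7 g ?S G .
  have uS: "ball (u t) \<rho> \<subseteq> ?S" if "t \<in> ?I" for t
    using that unfolding strip_def by blast
  have juS: "ju 0 t \<in> ?S" if "t \<in> ?I" for t
    using uS[OF that] fd(1) ju_0[OF that] by (auto simp: subset_iff)
  define jf where "jf t k = fc.F k (\<lambda>i. ju i t)" for t k
  have jf_0: "jf t 0 = g (u t)" if "t \<in> ?I" for t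
    unfolding jf_def using fc.F_0[of "\<lambda>i. ju i t"] juS[OF that] ju_0[OF that] by simp
  have jf: "((\<lambda>t. jf t k) has_vector_derivative jf t (Suc k)) (at t within ?I)" if "k < 7" "t \<in> ?I" for k t
    unfolding jf_def by (rule fc.F_deriv[OF that(1) ju juS that(2)])
  have bound: "\<exists>K\<ge>0. \<forall>q\<in>{..7}. \<forall>t. t \<in> ?I \<longrightarrow> norm (z q t) \<le> K * 1"
    if z: "\<And>q. q \<le> 7 \<Longrightarrow> bounded (z q ` ?I)" for z :: "nat \<Rightarrow> real \<Rightarrow> 'a"
  proof (rule finite_uniform_bound)
    fix q :: nat assume "q \<in> {..7}"
    then have "bounded (z q ` ?I)" using z by simp
    then obtain K where "\<forall>t\<in>?I. norm (z q t) \<le> K"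
      unfolding bounded_iff by blast
    then show "\<exists>K\<ge>0. \<forall>t. t \<in> ?I \<longrightarrow> norm (z q t) \<le> K * 1"
      by (intro exI[of _ "max K 0"]) (auto simp: max.coboundedI1)
  qed auto
  obtain Ku where Ku: "Ku \<ge> 0" "\<And>q t. q \<le> 7 \<Longrightarrow> t \<in> ?I \<Longrightarrow> norm (ju q t) \<le> Ku"
    using bound[of ju, OF ju_bounded] by auto
  have jf_bounded: "bounded ((\<lambda>t. jf t q) ` ?I)" if q: "q \<le> 7" for q
  proof (cases "q = 0")
    case True
    have "continuous_on ?I (\<lambda>t. jf t 0)"
      unfolding continuous_on_eq_continuous_within
      by (intro ballI has_vector_derivative_continuous[OF jf]) simp_all
    then show ?thesis
      using True compact_imp_bounded compact_continuous_image compact_Icc by blast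
  next
    case False
    then obtain B where B: "\<And>X. X 0 \<in> ?S \<Longrightarrow> (\<And>i. 1 \<le> i \<Longrightarrow> i \<le> q \<Longrightarrow> norm (X i) \<le> Ku) \<Longrightarrow> norm (fc.F q X) \<le> B"
      using fc.F_bound[of q Ku] q by auto
    have "norm (jf t q) \<le> B" if "t \<in> ?I" for t
      unfolding jf_def using juS[OF that] Ku(2)[OF _ that] q by (intro B) auto
    then show ?thesis unfolding bounded_iff by blast
  qed
  obtain Kf where Kf: "Kf \<ge> 0" "\<And>q t. q \<le> 7 \<Longrightarrow> t \<in> ?I \<Longrightarrow> norm (jf t q) \<le> Kf"
    using bound[of "\<lambda>q t. jf t q", OF jf_bounded] by auto
  define Kd where "Kd = max Ku Kf"
  have Kd: "Kd \<ge> 0" "\<And>q t. q \<le> 7 \<Longrightarrow> t \<in> ?I \<Longrightarrow> norm (ju q t) \<le> Kd" "\<And>q t. q \<le> 7 \<Longrightarrow> t \<in> ?I \<Longrightarrow> norm (jf t q) \<le> Kd"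
    using Ku Kf by (auto simp: Kd_def max.coboundedI1 max.coboundedI2)
  \<comment> \<open>Both sides of the integrated identity involve only bounded operators, so
    differentiating it in t passes from the q-th derivative to the next. One-sided derivatives at
    the end points are unique since t0 < tend.\<close>
  have orb: "orbit (ju q t) (ju (Suc q) t - jf t q)" if "q \<le> 6" "t \<in> ?I" for q t
    using that
  proof (induction q arbitrary: t)
    case 0
    have uD: "u t \<in> D" "(u has_vector_derivative (A (u t) + g (u t))) (at t within ?I)"
      using ivp 0 by (auto simp: solves_ivp_def)
    have "(u has_vector_derivative ju (Suc 0) t) (at t within ?I)"
      by (rule has_vector_derivative_transform[OF 0(2) _ ju[of 0 t]]) (use 0(2) ju_0 in auto)
    from vector_derivative_unique_within_closed_interval[OF I _ this[folded cbox_interval] uD(2)[folded cbox_interval]]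
    have "ju (Suc 0) t = A (u t) + g (u t)"
      using 0(2) by simp
    then show ?case
      using generates_iff_orbit(2)[OF gen uD(1)] 0(2) by (simp add: ju_0 jf_0)
  next
    case (Suc q)
    show ?case
      unfolding orbit_def
    proof (intro allI impI)
      fix s :: real assume s: "s \<ge> 0"
      have eq: "T s (ju q x) = ju q x + s *\<^sub>R P 1 s (ju (Suc q) x - jf x q)" if "x \<in> ?I" for x
        using Suc.IH[OF _ that] Suc.prems s by (simp add: orbit_def)
      have 1: "((\<lambda>x. T s (ju q x)) has_vector_derivative T s (ju (Suc q) t)) (at t within ?I)"
        by (rule bounded_linear.has_vector_derivative[OF blinfun.bounded_linear_right ju]) (use Suc.prems in auto)
      have "((\<lambda>x. ju (Suc q) x - jf x q) has_vector_derivative ju (Suc (Suc q)) t - jf t (Suc q)) (at t within ?I)"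
        by (intro has_vector_derivative_diff ju jf) (use Suc.prems in auto)
      from bounded_linear.has_vector_derivative[OF bounded_linear_compose[OF bounded_linear_scaleR_right bounded_linear_P[OF s]] this]
      have "((\<lambda>x. s *\<^sub>R P 1 s (ju (Suc q) x - jf x q)) has_vector_derivative s *\<^sub>R P 1 s (ju (Suc (Suc q)) t - jf t (Suc q))) (at t within ?I)" .
      from has_vector_derivative_add[OF ju this]
      have "((\<lambda>x. ju q x + s *\<^sub>R P 1 s (ju (Suc q) x - jf x q)) has_vector_derivative
          ju (Suc q) t + s *\<^sub>R P 1 s (ju (Suc (Suc q)) t - jf t (Suc q))) (at t within ?I)"
        using Suc.prems by simp
      then have 2: "((\<lambda>x. T s (ju q x)) has_vector_derivative
          ju (Suc q) t + s *\<^sub>R P 1 s (ju (Suc (Suc q)) t - jf t (Suc q))) (at t within ?I)"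
        by (rule has_vector_derivative_transform[rotated 2]) (use eq Suc.prems in auto)
      show "T s (ju (Suc q) t) = ju (Suc q) t + s *\<^sub>R P 1 s (ju (Suc (Suc q)) t - jf t (Suc q))"
        using vector_derivative_unique_within_closed_interval[OF I _ 1[folded cbox_interval] 2[folded cbox_interval]] Suc.prems by simp
    qed
  qed
  obtain L where L: "L \<ge> 0" "\<And>C x y. convex C \<Longrightarrow> C \<subseteq> ?S \<Longrightarrow> x \<in> C \<Longrightarrow> y \<in> C \<Longrightarrow> norm (g x - g y) \<le> L * norm (x - y)"
    using fc.g_lipschitz by auto
  obtain B6 where B6: "\<And>X. X 0 \<in> ?S \<Longrightarrow> (\<And>i. 1 \<le> i \<Longrightarrow> i \<le> 6 \<Longrightarrow> norm (X i) \<le> 6 * Kd) \<Longrightarrow> norm (fc.F 6 X) \<le> B6"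
    using fc.F_bound[of 6 "6 * Kd"] by auto
  \<comment> \<open>The Taylor polynomial has at most six terms, so its speed is at most 6 Kd and it
    stays within \<rho> up to time \<eta>. Times up to 1 keep all powers bounded by 1.\<close>
  define \<eta> where "\<eta> = min 1 (\<rho> / (6 * Kd + 1))"
  define Cg where "Cg = \<bar>B6\<bar>"
  have \<eta>: "\<eta> > 0" "\<eta> \<le> 1" using fd(1) Kd(1) by (auto simp: \<eta>_def)
  interpret pb: exprk_problem c T g A \<rho> \<eta> L Cg Kd
    by unfold_locales (use fd(1) \<eta> L Kd Cg_def in auto)
  have residual: "norm (g x - (\<Sum>q<6. (s ^ q / fact q) *\<^sub>R jf t q)) \<le> L * norm (x - (\<Sum>q<6. (s ^ q / fact q) *\<^sub>R ju q t)) + Cg * s ^ 6"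
    if t: "t \<in> ?I" and s: "0 \<le> s" "s \<le> \<eta>" and x: "norm (x - ju 0 t) < \<rho>" for x s t
  proof -
    \<comment> \<open>The derivatives of the Taylor polynomial of degree 5; the truncated difference
      6 - i makes them vanish for i \<ge> 6.\<close>
    define W where "W i r = (\<Sum>q<6 - i. (r ^ q / fact q) *\<^sub>R ju (q + i) t)" for i :: nat and r :: real
    have W: "(W i has_vector_derivative W (Suc i) r) (at r within {0..s})" for i r
      unfolding W_def using polynomial_jet_deriv[of "\<lambda>q. ju (q + i) t" "6 - i" r "{0..s}"] by simp
    have small: "norm ((r ^ q / fact q) *\<^sub>R ju (q + i) t) \<le> Kd" if "q < 6 - i" "0 \<le> r" "r \<le> s" for q i r
    proof -
      have "r ^ q / fact q \<le> 1 / 1" using that s \<eta> by (intro frac_le) (auto simp: power_le_one)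
      then have "r ^ q / fact q * norm (ju (q + i) t) \<le> 1 * Kd"
        using that Kd(1) Kd(2)[OF _ t, of "q + i"] by (intro mult_mono) auto
      then show ?thesis using that by simp
    qed
    have W_bound: "norm (W i r) \<le> 6 * Kd" if r: "0 \<le> r" "r \<le> s" for i r
    proof -
      have "norm (W i r) \<le> real (card {..<6 - i}) * Kd"
        unfolding W_def by (rule sum_norm_bound) (use small[of _ i r] r in auto)
      also have "\<dots> \<le> 6 * Kd" using Kd(1) by (intro mult_right_mono) auto
      finally show ?thesis .
    qed
    have near: "norm (W 0 r - ju 0 t) < \<rho>" if r: "0 \<le> r" "r \<le> s" for r
    proof -
      have W00: "W 0 0 = ju 0 t"
      proof -
        have "W 0 0 = (\<Sum>q\<in>{0}. ((0::real) ^ q / fact q) *\<^sub>R ju (q + 0) t)"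
          unfolding W_def by (rule sum.mono_neutral_right) auto
        then show ?thesis by simp
      qed
      have "norm (W 0 r - W 0 0) \<le> 6 * Kd * norm (r - 0)"
        by (rule vector_derivative_bound[of "{0..s}" _ "W (Suc 0)"]) (use W W_bound r s in auto)
      also have "\<dots> \<le> 6 * Kd * (\<rho> / (6 * Kd + 1))"
        using r s Kd(1) by (intro mult_left_mono) (auto simp: \<eta>_def)
      also have "\<dots> < \<rho>"
        using Kd(1) fd(1) by (simp add: field_simps)
      finally show ?thesis unfolding W00 .
    qed
    have ball: "y \<in> ball (u t) \<rho>" if "norm (y - ju 0 t) < \<rho>" for y
      using that ju_0[OF t] by (simp add: dist_norm norm_minus_commute)
    have W0S: "W 0 r \<in> ?S" if "0 \<le> r" "r \<le> s" for r
      using ball[OF near[OF that]] uS[OF t] by blast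
    have "norm (fc.F 0 (\<lambda>i. W i s) - (\<Sum>k<6. ((s - 0) ^ k / fact k) *\<^sub>R fc.F k (\<lambda>i. W i 0))) \<le> Cg * (s - 0) ^ 6"
    proof (rule taylor_bound)
      fix k r assume "k < (6::nat)" "0 \<le> r" "r \<le> s"
      then show "((\<lambda>r. fc.F k (\<lambda>i. W i r)) has_vector_derivative fc.F (Suc k) (\<lambda>i. W i r)) (at r within {0..s})"
        by (intro fc.F_deriv W W0S) auto
    next
      fix r assume r: "0 \<le> r" "r \<le> s"
      have "norm (fc.F 6 (\<lambda>i. W i r)) \<le> B6" by (intro B6 W0S W_bound r)
      then show "norm (fc.F 6 (\<lambda>i. W i r)) \<le> Cg" by (simp add: Cg_def)
    qed (use s in auto)
    moreover have "fc.F 0 (\<lambda>i. W i s) = g (W 0 s)"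
      using fc.F_0[of "\<lambda>i. W i s"] W0S[of s] s by simp
    \<comment> \<open>Solution and Taylor polynomial share their derivatives up to order 5, hence so
      do their compositions with g.\<close>
    moreover have "fc.F k (\<lambda>i. W i 0) = jf t k" if "k < 6" for k
      unfolding jf_def
    proof (rule fc.F_cong)
      fix i assume "i \<le> k"
      then have "W i 0 = (\<Sum>q\<in>{0}. ((0::real) ^ q / fact q) *\<^sub>R ju (q + i) t)"
        unfolding W_def using that by (intro sum.mono_neutral_right) auto
      then show "W i 0 = ju i t" by simp
    qed
    ultimately have 1: "norm (g (W 0 s) - (\<Sum>k<6. (s ^ k / fact k) *\<^sub>R jf t k)) \<le> Cg * s ^ 6"
      by simp
    have 2: "norm (g x - g (W 0 s)) \<le> L * norm (x - W 0 s)"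
      by (rule L(2)[OF convex_ball uS[OF t]]) (use ball[OF x] ball[OF near[of s]] s in auto)
    have "W 0 s = (\<Sum>q<6. (s ^ q / fact q) *\<^sub>R ju q t)" by (simp add: W_def)
    with 1 2 show ?thesis
      using norm_triangle_ineq[of "g x - g (W 0 s)" "g (W 0 s) - (\<Sum>k<6. (s ^ k / fact k) *\<^sub>R jf t k)"] by simp
  qed
  have ld: "pb.local_data (\<lambda>q. ju q t) (jf t)" if "t \<in> ?I" for t
    unfolding pb.local_data_def
    by (intro conjI allI impI orb Kd residual that) auto
  have sub: "{t..t + h} \<subseteq> ?I" if "t \<in> ?I" "t + h \<in> ?I" for t h
    using that by auto
  have taylor: "norm (ju 0 (t + h) - (\<Sum>q<7. (h ^ q / fact q) *\<^sub>R ju q t)) \<le> Kd * h ^ 7"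
    if t: "t \<in> ?I" "0 < h" "t + h \<in> ?I" for t h
  proof -
    have "norm (ju 0 (t + h) - (\<Sum>q<7. ((t + h - t) ^ q / fact q) *\<^sub>R ju q t)) \<le> Kd * (t + h - t) ^ 7"
    proof (rule taylor_bound)
      fix k x assume k: "k < (7::nat)" "t \<le> x" "x \<le> t + h"
      then show "(ju k has_vector_derivative ju (Suc k) x) (at x within {t..t + h})"
        using has_vector_derivative_within_subset[OF ju sub[OF t(1,3)]] t by auto
    qed (use t Kd(2) in auto)
    then show ?thesis by simp
  qed
  have jf5: "norm (jf (t + h) 5 - jf t 5) \<le> Kd * h" if t: "t \<in> ?I" "0 < h" "t + h \<in> ?I" for t h
  proof -
    have "norm (jf (t + h) 5 - jf t 5) \<le> Kd * norm (t + h - t)"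
      by (rule vector_derivative_bound[of ?I "\<lambda>t. jf t 5" "\<lambda>t. jf t (Suc 5)"]) (use jf[of 5] Kd(3)[of "Suc 5"] t in auto)
    then show ?thesis using t by simp
  qed
  have "\<exists>C. \<exists>h0>0. \<forall>h n. 0 < h \<longrightarrow> h \<le> h0 \<longrightarrow> t0 + real n * h \<le> tend \<longrightarrow>
    norm ((pb.step h ^^ n) (ju 0 t0) - ju 0 (t0 + real n * h)) \<le> C * h ^ 6"
  proof (rule pb.convergence[where jf = jf and ju = "\<lambda>t q. ju q t", OF _ I ld taylor jf5])
    show "orbit v (A v)" if "orbit v z" for v z
      using that generates_iff_orbit[OF gen] by blast
  qed
  then obtain C h0 where C: "h0 > 0" "\<And>h n. 0 < h \<Longrightarrow> h \<le> h0 \<Longrightarrow> t0 + real n * h \<le> tend \<Longrightarrow>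
    norm ((pb.step h ^^ n) (ju 0 t0) - ju 0 (t0 + real n * h)) \<le> C * h ^ 6"
    by blast
  have sol: "ExpRK6s15_solution c A T g h u0 n = (pb.step h ^^ n) u0" for h n
  proof -
    have "phi_op (exp_scaled T h) = (\<lambda>k r. P k (r * h))"
      by (intro ext) (simp add: phi_op_exp_scaled)
    moreover have "pb.step h = exp_rk_step 15 h c (aop h) (bop h) (\<lambda>k r. P k (r * h)) (\<lambda>u. A u + g u) g"
      by (rule ext) (simp add: pb.step_def)
    ultimately show ?thesis
      by (simp add: ExpRK6s15_solution_def ExpRK6s15_a_op_eq ExpRK6s15_b_op_eq)
  qed
  have u0: "ju 0 t0 = u0" using ivp I ju_0[of t0] by (simp add: solves_ivp_def)
  show ?thesis
  proof (intro exI conjI allI impI)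
    fix h :: real and n :: nat
    assume h: "0 < h" "h \<le> h0" "t0 + real n * h \<le> tend"
    then have "ju 0 (t0 + real n * h) = u (t0 + real n * h)" by (intro ju_0) auto
    then show "norm (ExpRK6s15_solution c A T g h u0 n - u (t0 + real n * h)) \<le> C * h ^ 6"
      using C(2)[OF h] by (simp add: sol u0)
  qed (rule C(1))
qed

section \<open>Values at zero, independence of stages, and the final theorem\<close>

lemma phi_fun_0:
  assumes "k \<ge> 1"
  shows "phi_fun k 0 = complex_of_real (1 / fact k)"
proof -
  have "((\<lambda>\<theta>::real. complex_of_real (\<theta> ^ (k - 1) / fact (k - 1))) has_integral complex_of_real (1 / fact k)) {0..1}"
    by (rule has_integral_of_real[OF weight_integral[OF assms]])
  from integral_unique[OF this] show ?thesis
    by (simp add: phi_fun_def)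
qed

lemma exp_matrix_0: "exp_matrix Z t 0 = 0"
proof -
  have "(((*v) Z) ^^ m) 0 = 0" for m by (induction m) auto
  then show ?thesis by (simp add: exp_matrix_def)
qed

lemma independent_stages_ExpRK6s15:
  "independent_stages (ExpRK6s15_a_fun c) {3,4}" "independent_stages (ExpRK6s15_a_fun c) {5..7}"
  "independent_stages (ExpRK6s15_a_fun c) {8..11}" "independent_stages (ExpRK6s15_a_fun c) {12..15}"
  by (auto simp: independent_stages_def ExpRK6s15_a_fun_def ExpRK6s15_a_def)

theorem mainTheorem3:
  fixes c :: "nat \<Rightarrow> real"
  assumes "\<forall>i\<in>{2..15}. 0 < c i"
    and "c 3 \<noteq> c 4"
    and "inj_on c {5..7}"
    and "inj_on c {8..11}"
    and "inj_on c {12..15}"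
    and "1/5 * (\<Sum>i=12..15. c i)
         - 1/4 * (\<Sum>i=12..15. \<Sum>j=i+1..15. c i * c j)
         + 1/3 * (\<Sum>i=12..15. \<Sum>j=i+1..15. \<Sum>k=j+1..15. c i * c j * c k)
         - 1/2 * (c 12 * c 13 * c 14 * c 15) = 1/6"
  shows
    "(\<forall>(Z :: 'k::{real_normed_field,banach}^'n^'n) J K L B.
        bilinear B \<longrightarrow>
        (\<forall>n\<in>{1..36} - {17}.
           ExpRK6s15_condition c (exp_matrix Z) ((*v) J) ((*v) K) ((*v) L) B n))
   \<and> (\<forall>(A :: 'a::banach \<Rightarrow> 'a) D T h (J :: 'a \<Rightarrow>\<^sub>L 'a) (K :: 'a \<Rightarrow>\<^sub>L 'a) (L :: 'a \<Rightarrow>\<^sub>L 'a) B.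
        analytic_semigroup T \<longrightarrow> generates A D T \<longrightarrow> 0 < h \<longrightarrow> bounded_bilinear B \<longrightarrow>
        (\<forall>n\<in>{1..36} - {17}.
           ExpRK6s15_condition c (exp_scaled T h) (blinfun_apply J) (blinfun_apply K)
             (blinfun_apply L) B n))
   \<and> ((\<Sum>i=2..15. ExpRK6s15_b_fun c i 0 * complex_of_real (c i ^ 5 / fact 5)) = phi_fun 6 0
      \<and> phi_fun 6 0 = 1 / fact 6)
   \<and> (\<exists>m. \<forall>(A :: 'a \<Rightarrow> 'a) D T g u u0 t0 tend.
        analytic_semigroup T \<longrightarrow> generates A D T \<longrightarrow> t0 < tend \<longrightarrow>
        solves_ivp A D g t0 tend u0 u \<longrightarrow>
        bounded_time_derivatives m u {t0..tend} \<longrightarrow>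
        (\<exists>\<rho>>0. bounded_Frechet_derivatives m g (strip u {t0..tend} \<rho>)) \<longrightarrow>
        (\<exists>C. \<exists>h0>0. \<forall>h n. 0 < h \<longrightarrow> h \<le> h0 \<longrightarrow> t0 + real n * h \<le> tend \<longrightarrow>
           norm (ExpRK6s15_solution c A T g h u0 n - u (t0 + real n * h)) \<le> C * h ^ 6))
   \<and> independent_stages (ExpRK6s15_a_fun c) {3,4}
   \<and> independent_stages (ExpRK6s15_a_fun c) {5..7}
   \<and> independent_stages (ExpRK6s15_a_fun c) {8..11}
   \<and> independent_stages (ExpRK6s15_a_fun c) {12..15}"
proof (intro conjI allI impI ballI independent_stages_ExpRK6s15)
  interpret nodes: exprk_nodes c
    by unfold_locales (use assms(1-5) in auto)
  define s1 where "s1 = c 12 + c 13 + c 14 + c 15"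
  define s2 where "s2 = c 12 * c 13 + c 12 * c 14 + c 12 * c 15 + c 13 * c 14 + c 13 * c 15 + c 14 * c 15"
  define s3 where "s3 = c 12 * c 13 * c 14 + c 12 * c 13 * c 15 + c 12 * c 14 * c 15 + c 13 * c 14 * c 15"
  define s4 where "s4 = c 12 * c 13 * c 14 * c 15"
  \<comment> \<open>Unfolding the ranges, down to the empty one, turns the nested sums into
    elementary symmetric functions of the last four nodes.\<close>
  have ivl: "{12..15::nat} = {12,13,14,15}" "{13..15::nat} = {13,14,15}" "{14..15::nat} = {14,15}" "{16..15::nat} = {}"
    by auto
  have weak: "1/5 * s1 - 1/4 * s2 + 1/3 * s3 - 1/2 * s4 = 1/6"
    using assms(6) by (simp add: ivl s1_def s2_def s3_def s4_def algebra_simps)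
  show "ExpRK6s15_condition c (exp_matrix Z) ((*v) J) ((*v) K) ((*v) L) B n"
    if "bilinear B" "n \<in> {1..36} - {17}" for Z J K L :: "'k^'n^'n" and B n
    by (rule nodes.stiff_order_conditions) (use that in \<open>auto simp: exp_matrix_0 bilinear_lzero\<close>)
  show "ExpRK6s15_condition c (exp_scaled T h) (blinfun_apply J) (blinfun_apply K) (blinfun_apply L) B n"
    if "bounded_bilinear B" "n \<in> {1..36} - {17}" for T h and J K L :: "'a \<Rightarrow>\<^sub>L 'a" and B n
    by (rule nodes.stiff_order_conditions) (use that in \<open>auto simp: exp_scaled_def bounded_bilinear.zero_left\<close>)
  show phi6: "phi_fun 6 0 = 1 / fact 6"
    using phi_fun_0[of 6] by simp
  show "(\<Sum>i=2..15. ExpRK6s15_b_fun c i 0 * complex_of_real (c i ^ 5 / fact 5)) = phi_fun 6 0"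
  proof -
    \<comment> \<open>At z = 0 the argument of phi_k does not depend on the node, and phi_k(0) =
      1/k! turns the fifth moment into 1/120 times the left-hand side of the node condition.\<close>
    let ?\<phi> = "\<lambda>k (r::real). phi_fun k 0"
    have "(\<Sum>i=2..15. ExpRK6s15_b_fun c i 0 * complex_of_real (c i ^ 5 / fact 5)) =
        (\<Sum>i\<in>{2..15}. (c i ^ 5 / fact 5) *\<^sub>R ExpRK6s15_b c ?\<phi> i)"
      by (intro sum.cong) (auto simp: ExpRK6s15_b_fun_def scaleR_conv_of_real mult.commute)
    also have "\<dots> = complex_of_real ((1 / 120) * (- s4 / 2 + 2 * s3 / 6 - 6 * s2 / 24 + 24 * s1 / 120))"
      unfolding nodes.b_moment_5[folded s1_def s2_def s3_def s4_def]
      by (simp add: phi_fun_0 scaleR_conv_of_real fact_numeral)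
    also have "(1 / 120) * (- s4 / 2 + 2 * s3 / 6 - 6 * s2 / 24 + 24 * s1 / 120) = 1 / (720 :: real)"
      using weak by simp
    also have "complex_of_real (1 / 720) = phi_fun 6 0"
      using phi_fun_0[of 6] by (simp add: fact_numeral)
    finally show ?thesis .
  qed
  show "\<exists>m. \<forall>(A :: 'a \<Rightarrow> 'a) D T g u u0 t0 tend.
        analytic_semigroup T \<longrightarrow> generates A D T \<longrightarrow> t0 < tend \<longrightarrow>
        solves_ivp A D g t0 tend u0 u \<longrightarrow>
        bounded_time_derivatives m u {t0..tend} \<longrightarrow>
        (\<exists>\<rho>>0. bounded_Frechet_derivatives m g (strip u {t0..tend} \<rho>)) \<longrightarrow>
        (\<exists>C. \<exists>h0>0. \<forall>h n. 0 < h \<longrightarrow> h \<le> h0 \<longrightarrow> t0 + real n * h \<le> tend \<longrightarrow>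
           norm (ExpRK6s15_solution c A T g h u0 n - u (t0 + real n * h)) \<le> C * h ^ 6)"
  proof (rule exI[of _ 7], intro allI impI, elim exE conjE)
    fix A :: "'a \<Rightarrow> 'a" and D T g u u0 t0 tend \<rho>
    assume *: "analytic_semigroup T" "generates A D T" "t0 < tend" "solves_ivp A D g t0 tend u0 u"
      "bounded_time_derivatives 7 u {t0..tend}" "\<rho> > 0" "bounded_Frechet_derivatives 7 g (strip u {t0..tend} \<rho>)"
    have "exprk_semigroup c T"
      by unfold_locales (use *(1) weak in \<open>simp_all add: s1_def s2_def s3_def s4_def\<close>)
    from sixth_order_convergence[OF this *(2-7)]
    show "\<exists>C. \<exists>h0>0. \<forall>h n. 0 < h \<longrightarrow> h \<le> h0 \<longrightarrow> t0 + real n * h \<le> tend \<longrightarrow>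
           norm (ExpRK6s15_solution c A T g h u0 n - u (t0 + real n * h)) \<le> C * h ^ 6" .
  qed
qed

end
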